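(* For all $n\in\mathbb{N}_{>0}$: (1) $(\mathbb{P}_f)_{f\in\mathfrak{F}_n}$ is a basis of $\mathbf{WQSym}_n$; (2) $(\mathbb{P}_t)_{t\in\mathfrak{T}_n}$ is a basis of $\operatorname{Prim}_n$; (3) $(\mathbb{P}_t)_{t\in\mathfrak{P}_n}$ is a basis of $\operatorname{TPrim}_n$.
   Context: Packed words: a word over $\mathbb{N}_{>0}$ is packed if every letter from $1$ to its maximum appears at least once ($\epsilon$ is packed, $\max(\epsilon)=0$); $\mathbf{PW}_n$ is the set of packed words of length $n$; $\mathrm{pack}(w)$ replaces the distinct letters $b_1<\dots<b_r$ of $w$ by $1,\dots,r$. $\mathbf{WQSym}_n$ is the $K$-vector space with basis $(\mathbb{R}_w)_{w\in\mathbf{PW}_n}$, $\mathbf{WQSym}=\bigoplus_{n\ge0}\mathbf{WQSym}_n$, $\mathbf{WQSym}_+=\bigoplus_{n\ge1}\mathbf{WQSym}_n$. Half-products: for non-empty packed words $u$, $v$, let $\bar v$ be $v$ with $\max(u)$ added to each letter. $\mathbb{R}_u\prec\mathbb{R}_v=\sum_w\mathbb{R}_w$ over all shuffles $w$ of $u$ and $\bar v$ (counted with multiplicity) whose last letter comes from $u$, and $\mathbb{R}_u\succ\mathbb{R}_v$ is the same sum over shuffles whose last letter comes from $\bar v$ (e.g. $\mathbb{R}_{221}\succ\mathbb{R}_{12}=\mathbb{R}_{22134}+\mathbb{R}_{22314}+\mathbb{R}_{23214}+\mathbb{R}_{32214}$); extend bilinearly, and set $\mathbb{R}_\epsilon\prec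 x = 0$, $x\prec\mathbb{R}_\epsilon = x$ is not needed below. Half-coproducts: for $u=u_1\cdots u_n$, $n\ge1$, $\Delta_\prec(\mathbb{R}_u)=\sum\mathbb{R}_{\mathrm{pack}(u_1\cdots u_i)}\otimes\mathbb{R}_{\mathrm{pack}(u_{i+1}\cdots u_n)}$ over $1\le i\le n-1$ with $\{u_1,\dots,u_i\}\cap\{u_{i+1},\dots,u_n\}=\emptyset$ and all occurrences of $\max(u)$ in positions $\le i$; $\Delta_\succ$ is the same over such $i$ with all occurrences of $\max(u)$ in positions $>i$. $\operatorname{Prim}=\operatorname{Ker}(\Delta_\prec+\Delta_\succ)$, $\operatorname{TPrim}=\operatorname{Ker}\Delta_\prec\cap\operatorname{Ker}\Delta_\succ$ (in $\mathbf{WQSym}_+$), with homogeneous components $\operatorname{Prim}_n$, $\operatorname{TPrim}_n$. Brace bracket: for $x_1,\dots,x_m\in\mathbf{WQSym}_+$, $m\ge2$, $\langle x_1,\dots,x_{m-1};x_m\rangle=\sum_{i=0}^{m-1}(-1)^{m-1-i}\,\big(x_1\prec(x_2\prec(\cdots\prec x_i)\cdots)\big)\succ x_m\prec\big((\cdots(x_{i+1}\succ x_{i+2})\succ\cdots)\succ x_{m-1}\big)$, where an empty iterated product is omitted (for $i=0$ the term is $\pm x_m\prec(\cdots)$, for $i=m-1$ it is $(\cdots)\succ x_m$), and $(a\succ b)\prec c=a\succ(b\prec c)$. Maps $\Phi_I$: for $I=(i_1<\dots<i_p)$, $p\ge1$, $i_1>0$, and $w\in\mathbf{PW}_n$, $\phi_I(w)$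 is obtained by inserting $p$ copies of $\max(w)+1$ into $w$ at exactly the positions of $I$; the linear map $\Phi_I$ sends $\mathbb{R}_w$ to $\mathbb{R}_{\phi_I(w)}$ if $i_p\le n+p$ and to $0$ otherwise. Packed trees: a labeled biplane tree is $t=\operatorname{Node}(I,f_\ell,f_r)$ with $I=[i_1,\dots,i_p]$ a strictly increasing non-empty list of positive integers and $f_\ell=[\ell_1,\dots,\ell_g]$, $f_r=[r_1,\dots,r_d]$ possibly empty lists of labeled biplane trees. Weight $\omega(t)=p+\sum_a\omega(\ell_a)+\sum_b\omega(r_b)$, right-weight $\omega_r(t)=p+\sum_b\omega(r_b)$. $t$ is packed if: when $d=0$, $i_k=k$ for all $k$; when $d\ge1$, $1\le i_1\le\omega(r_1)$ and $1\le\omega_r(t)+1-i_p\le\omega(r_d)$; and all trees in $f_\ell,f_r$ are packed. A packed forest is a list of packed trees, of weight the sum of the weights. $\mathfrak{F}_n$, $\mathfrak{T}_n$ are the packed forests, resp. packed trees, of weight $n$; $\mathfrak{P}_n\subseteq\mathfrak{T}_n$ are those with empty left forest. The elements $\mathbb{P}$: $\mathbb{P}_{[]}=\mathbb{R}_\epsilon$ for the empty forest; for the one-node tree with label $[1]$, $\mathbb{P}=\mathbb{R}_1$; for a forest $[t_1,\dots,t_k]$, $k\ge1$, $\mathbb{P}_{[t_1,\dots,t_k]}=\mathbb{P}_{t_k}\prec(\mathbb{P}_{t_{k-1}}\prec(\cdots\prec\mathbb{P}_{t_1})\cdots)$; $\mathbb{P}_{\operatorname{Node}(I,[],f_r)}=\Phi_I(\mathbb{P}_{f_r})$;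 and for $g\ge1$, $\mathbb{P}_{\operatorname{Node}(I,[\ell_1,\dots,\ell_g],f_r)}=\langle\mathbb{P}_{\ell_1},\dots,\mathbb{P}_{\ell_g};\Phi_I(\mathbb{P}_{f_r})\rangle$. *)

theory Defs
  imports Complex_Main "HOL-Library.Poly_Mapping"
begin

section \<open>Free vector spaces\<close>

text \<open>The vector space over \<open>'k\<close> with basis \<open>'a\<close> is the type \<open>'a \<Rightarrow>\<^sub>0 'k\<close> of finitely supported
  functions.\<close>

definition scale :: "'k::field \<Rightarrow> ('a \<Rightarrow>\<^sub>0 'k) \<Rightarrow> ('a \<Rightarrow>\<^sub>0 'k)" where
  "scale c x = Poly_Mapping.map ((*) c) x"

lemma lookup_scale [simp]: "Poly_Mapping.lookup (scale c x) a = c * Poly_Mapping.lookup x a"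
  by (simp add: scale_def Poly_Mapping.map.rep_eq when_def)

global_interpretation free: vector_space "scale :: 'k::field \<Rightarrow> ('a \<Rightarrow>\<^sub>0 'k) \<Rightarrow> ('a \<Rightarrow>\<^sub>0 'k)"
  by unfold_locales (auto intro!: poly_mapping_eqI simp: lookup_add algebra_simps)

definition linear_ext :: "('a \<Rightarrow> ('b \<Rightarrow>\<^sub>0 'k::field)) \<Rightarrow> ('a \<Rightarrow>\<^sub>0 'k) \<Rightarrow> ('b \<Rightarrow>\<^sub>0 'k)" where
  "linear_ext f x = (\<Sum>a\<in>Poly_Mapping.keys x. scale (Poly_Mapping.lookup x a) (f a))"

definition bilinear_ext ::
    "('a \<Rightarrow> 'b \<Rightarrow> ('c \<Rightarrow>\<^sub>0 'k::field)) \<Rightarrow> ('a \<Rightarrow>\<^sub>0 'k) \<Rightarrow> ('b \<Rightarrow>\<^sub>0 'k) \<Rightarrow> ('c \<Rightarrow>\<^sub>0 'k)" where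
  "bilinear_ext f x y = linear_ext (\<lambda>a. linear_ext (f a) y) x"

definition is_basis :: "('i \<Rightarrow> ('a \<Rightarrow>\<^sub>0 'k::field)) \<Rightarrow> 'i set \<Rightarrow> ('a \<Rightarrow>\<^sub>0 'k) set \<Rightarrow> bool" where
  "is_basis b I V \<longleftrightarrow> inj_on b I \<and> free.independent (b ` I) \<and> free.span (b ` I) = V"


section \<open>Packed words and the space WQSym\<close>

definition max_letter :: "nat list \<Rightarrow> nat" where
  "max_letter w = Max (insert 0 (set w))"

definition packed_word :: "nat list \<Rightarrow> bool" where
  "packed_word w \<longleftrightarrow> set w = {1..max_letter w}"

definition PW :: "nat \<Rightarrow> nat list set" where
  "PW n = {w. packed_word w \<and> length w = n}"

definition pack :: "nat list \<Rightarrow> nat list" where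
  "pack w = map (\<lambda>a. card {b \<in> set w. b \<le> a}) w"

type_synonym 'k wqsym = "nat list \<Rightarrow>\<^sub>0 'k"

definition R :: "nat list \<Rightarrow> 'k::field wqsym" where
  "R w = Poly_Mapping.single w 1"

definition WQSym :: "nat \<Rightarrow> 'k::field wqsym set" where
  "WQSym n = {x. Poly_Mapping.keys x \<subseteq> PW n}"

definition WQSym_plus :: "'k::field wqsym set" where
  "WQSym_plus = {x. Poly_Mapping.keys x \<subseteq> (\<Union>n\<in>{1..}. PW n)}"


section \<open>Half-products and half-coproducts\<close>

text \<open>Each letter is tagged with its origin (\<open>True\<close> for \<open>u\<close>, \<open>False\<close> for the shifted \<open>v\<close>), so
  that distinct shuffles give distinct tagged words and multiplicities are counted.  The empty
  shuffle is excluded because it has no last letter.\<close>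

definition tagged_shuffles :: "nat list \<Rightarrow> nat list \<Rightarrow> (bool \<times> nat) list set" where
  "tagged_shuffles u v =
     shuffles (map (Pair True) u) (map (Pair False) (map (\<lambda>a. a + max_letter u) v)) - {[]}"

definition half_prec :: "'k::field wqsym \<Rightarrow> 'k wqsym \<Rightarrow> 'k wqsym" (infixr \<open>\<prec>\<prec>\<close> 70) where
  "half_prec = bilinear_ext
     (\<lambda>u v. \<Sum>w\<in>{w \<in> tagged_shuffles u v. fst (last w)}. R (map snd w))"

definition half_succ :: "'k::field wqsym \<Rightarrow> 'k wqsym \<Rightarrow> 'k wqsym" (infixl \<open>\<succ>\<succ>\<close> 70) where
  "half_succ = bilinear_ext
     (\<lambda>u v. \<Sum>w\<in>{w \<in> tagged_shuffles u v. \<not> fst (last w)}. R (map snd w))"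

text \<open>The tensor square is the free vector space on pairs of words, the pair \<open>(u, v)\<close> standing
  for \<open>R u \<otimes> R v\<close>.\<close>

definition deconcat :: "nat list \<Rightarrow> nat \<Rightarrow> (nat list \<times> nat list) \<Rightarrow>\<^sub>0 'k::field" where
  "deconcat u i = Poly_Mapping.single (pack (take i u), pack (drop i u)) 1"

definition Delta_prec :: "'k::field wqsym \<Rightarrow> (nat list \<times> nat list) \<Rightarrow>\<^sub>0 'k" where
  "Delta_prec = linear_ext
     (\<lambda>u. \<Sum>i | 1 \<le> i \<and> i < length u \<and> set (take i u) \<inter> set (drop i u) = {}
                 \<and> max_letter u \<notin> set (drop i u). deconcat u i)"

definition Delta_succ :: "'k::field wqsym \<Rightarrow> (nat list \<times> nat list) \<Rightarrow>\<^sub>0 'k" where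
  "Delta_succ = linear_ext
     (\<lambda>u. \<Sum>i | 1 \<le> i \<and> i < length u \<and> set (take i u) \<inter> set (drop i u) = {}
                 \<and> max_letter u \<notin> set (take i u). deconcat u i)"

definition Prim :: "'k::field wqsym set" where
  "Prim = {x \<in> WQSym_plus. Delta_prec x + Delta_succ x = 0}"

definition TPrim :: "'k::field wqsym set" where
  "TPrim = {x \<in> WQSym_plus. Delta_prec x = 0 \<and> Delta_succ x = 0}"

definition Prim_hom :: "nat \<Rightarrow> 'k::field wqsym set" where
  "Prim_hom n = Prim \<inter> WQSym n"

definition TPrim_hom :: "nat \<Rightarrow> 'k::field wqsym set" where
  "TPrim_hom n = TPrim \<inter> WQSym n"


section \<open>The brace bracket\<close>

text \<open>The value at \<open>[]\<close> of the following two functions is never used.\<close>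

fun prec_iter :: "'k::field wqsym list \<Rightarrow> 'k wqsym" where
  "prec_iter [] = 0"
| "prec_iter [x] = x"
| "prec_iter (x # y # xs) = x \<prec>\<prec> prec_iter (y # xs)"

fun succ_iter :: "'k::field wqsym list \<Rightarrow> 'k wqsym" where
  "succ_iter [] = 0"
| "succ_iter (x # xs) = foldl (\<succ>\<succ>) x xs"

text \<open>\<open>brace [x\<^sub>1, \<dots>, x\<^sub>g] z\<close> is the bracket \<open>\<langle>x\<^sub>1, \<dots>, x\<^sub>g; z\<rangle>\<close>, so \<open>g = m - 1\<close>.  The middle terms
  are bracketed as \<open>(a \<succ> z) \<prec> c\<close>.\<close>

definition brace :: "'k::field wqsym list \<Rightarrow> 'k wqsym \<Rightarrow> 'k wqsym" where
  "brace xs z =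
     (\<Sum>i = 0..length xs.
        let y = (if i = 0 then z else prec_iter (take i xs) \<succ>\<succ> z)
        in scale ((- 1) ^ (length xs - i))
             (if i = length xs then y else y \<prec>\<prec> succ_iter (drop i xs)))"


section \<open>The maps \<open>\<Phi>\<^sub>I\<close>\<close>

text \<open>In the resulting word, a position \<open>i \<notin> I\<close> (counted from 1) holds the letter of \<open>w\<close> whose
  position in \<open>w\<close> is \<open>i\<close> minus the number of inserted letters before it.\<close>

definition phi :: "nat list \<Rightarrow> nat list \<Rightarrow> nat list" where
  "phi I w = map (\<lambda>i. if i \<in> set I then max_letter w + 1
                      else w ! (i - card {j \<in> set I. j < i} - 1))
               [1..<length w + length I + 1]"

definition Phi :: "nat list \<Rightarrow> 'k::field wqsym \<Rightarrow> 'k wqsym" where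
  "Phi I = linear_ext (\<lambda>w. if last I \<le> length w + length I then R (phi I w) else 0)"


section \<open>Packed trees and forests\<close>

datatype biplane_tree = Node "nat list" "biplane_tree list" "biplane_tree list"

fun weight :: "biplane_tree \<Rightarrow> nat" where
  "weight (Node I fl fr) = length I + sum_list (map weight fl) + sum_list (map weight fr)"

fun right_weight :: "biplane_tree \<Rightarrow> nat" where
  "right_weight (Node I fl fr) = length I + sum_list (map weight fr)"

definition valid_label :: "nat list \<Rightarrow> bool" where
  "valid_label I \<longleftrightarrow> I \<noteq> [] \<and> sorted_wrt (<) I \<and> 0 \<notin> set I"

text \<open>The truncated subtraction below is harmless: if \<open>last I > right_weight t\<close>, it yields 0
  and the lower bound fails, as it does over the integers.\<close>

fun packed_tree :: "biplane_tree \<Rightarrow> bool" where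
  "packed_tree (Node I fl fr) \<longleftrightarrow>
     valid_label I \<and>
     (fr = [] \<longrightarrow> I = [1..<length I + 1]) \<and>
     (fr \<noteq> [] \<longrightarrow>
        1 \<le> hd I \<and> hd I \<le> weight (hd fr) \<and>
        1 \<le> right_weight (Node I fl fr) + 1 - last I \<and>
        right_weight (Node I fl fr) + 1 - last I \<le> weight (last fr)) \<and>
     (\<forall>t\<in>set fl. packed_tree t) \<and> (\<forall>t\<in>set fr. packed_tree t)"

definition packed_forests :: "nat \<Rightarrow> biplane_tree list set" where
  "packed_forests n = {f. (\<forall>t\<in>set f. packed_tree t) \<and> sum_list (map weight f) = n}"

definition packed_trees :: "nat \<Rightarrow> biplane_tree set" where
  "packed_trees n = {t. packed_tree t \<and> weight t = n}"

definition packed_trees_left_empty :: "nat \<Rightarrow> biplane_tree set" where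
  "packed_trees_left_empty n = {t \<in> packed_trees n. \<exists>I fr. t = Node I [] fr}"


section \<open>The elements \<open>\<P>\<close>\<close>

definition forest_prod :: "'k::field wqsym list \<Rightarrow> 'k wqsym" where
  "forest_prod xs = (if xs = [] then R [] else prec_iter (rev xs))"

fun P_tree :: "biplane_tree \<Rightarrow> 'k::field wqsym" where
  "P_tree (Node I fl fr) =
     (if fl = [] then Phi I (forest_prod (map P_tree fr))
      else brace (map P_tree fl) (Phi I (forest_prod (map P_tree fr))))"

definition P_forest :: "biplane_tree list \<Rightarrow> 'k::field wqsym" where
  "P_forest f = forest_prod (map P_tree f)"

text \<open>The base case of the recursion, the one-node tree labeled \<open>[1]\<close>, needs no equation of its
  own:\<close>

lemma P_tree_one_node: "P_tree (Node [1] [] []) = R [1]"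
  by (simp add: forest_prod_def Phi_def linear_ext_def R_def phi_def max_letter_def scale_def)

end

theory Submission
  imports Defs
begin

text \<open>All three statements are proved together by strong induction on \<open>n\<close>, without counting trees.

  Write the elements of \<open>WQSym n\<close> as sums of \<open>Phi I (y I)\<close>.  A deconcatenation of such a word
  before the first or after the last maximal letter is a deconcatenation of \<open>y I\<close>, so the sum is
  totally primitive iff every \<open>y I\<close> has no coproduct of small positive left or right degree.  On
  the basis of forests the coproduct is deconcatenation of forests, so this condition bounds the
  weights of the first and the last tree: this is (3).

  For (2), the half-coproduct \<open>Delta_succ\<close> of a brace \<open>\<langle>x\<^sub>1, \<dots>, x\<^sub>g; z\<rangle>\<close> with \<open>z\<close> totally primitive has
  \<open>x\<^sub>1 \<prec> (x\<^sub>2 \<prec> \<cdots> x\<^sub>g) \<otimes> z\<close> as its term of lowest right degree, while coassociativity shows that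
  the term of lowest right degree of \<open>Delta_succ x\<close>, for a primitive \<open>x\<close>, has totally primitive
  right factors.  Hence braces eliminate \<open>Delta_succ x\<close> degree by degree.  In the same way (1)
  follows from (2), as the term of lowest left degree of the coproduct of an arbitrary element has
  primitive left factors.\<close>


section \<open>Coefficients of linear extensions\<close>

text \<open>Tensors are handled only through their coefficients at pairs of words. In the basis
  \<open>R\<close> a product is a sum over cuts of the values of a word and a coproduct a sum over
  cuts of its positions. The two kinds of cut commute, which is the compatibility of the
  half-products with the coproducts. The simultaneous induction is not circular. A label is
  non-empty, so (3) in degree \<open>n\<close> involves only forests of smaller weight. A brace has
  a non-empty left forest and a last argument of positive degree, so (2) adds to (3) only forests of
  weight below \<open>n\<close>. Cutting off the first tree reduces (1) to (2) up to degree
  \<open>n\<close> and to (1) below. Hence the order (3), (2), (1) inside one degree. On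
  \<open>Prim\<close> the two half-coproducts are opposite, so \<open>Delta_succ\<close> alone
  detects \<open>TPrim\<close> there. That braces of primitive elements are primitive rests on an
  antipode identity: up to sign, the products \<open>om'\<close> are the convolution inverse of the
  products \<open>om\<close> under deconcatenation of lists.\<close>

abbreviation cf :: "('a \<Rightarrow>\<^sub>0 'k::zero) \<Rightarrow> 'a \<Rightarrow> 'k" where
  "cf \<equiv> Poly_Mapping.lookup"

lemma cf_linear_ext:
  assumes "finite A" "Poly_Mapping.keys x \<subseteq> A"
  shows "cf (linear_ext f x) b = (\<Sum>a\<in>A. cf x a * cf (f a) b)"
proof -
  have "cf (linear_ext f x) b = (\<Sum>a\<in>Poly_Mapping.keys x. cf x a * cf (f a) b)"
    by (simp add: linear_ext_def lookup_sum)
  also have "\<dots> = (\<Sum>a\<in>A. cf x a * cf (f a) b)"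
    using assms by (intro sum.mono_neutral_left) (auto simp: in_keys_iff)
  finally show ?thesis .
qed

lemma linear_ext_add: "linear_ext f (x + y) = linear_ext f x + linear_ext f y"
proof (rule poly_mapping_eqI)
  fix b
  let ?A = "Poly_Mapping.keys x \<union> Poly_Mapping.keys y"
  have "cf (linear_ext f (x + y)) b = (\<Sum>a\<in>?A. cf (x + y) a * cf (f a) b)"
    by (rule cf_linear_ext) (use Poly_Mapping.keys_add[of x y] in auto)
  also have "\<dots> = cf (linear_ext f x) b + cf (linear_ext f y) b"
    by (simp add: cf_linear_ext[of ?A] lookup_add distrib_right sum.distrib)
  finally show "cf (linear_ext f (x + y)) b = cf (linear_ext f x + linear_ext f y) b"
    by (simp add: lookup_add)
qed

lemma linear_ext_scale: "linear_ext f (scale c x) = scale c (linear_ext f x)"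
proof (rule poly_mapping_eqI)
  fix b
  have "cf (linear_ext f (scale c x)) b
      = (\<Sum>a\<in>Poly_Mapping.keys x. cf (scale c x) a * cf (f a) b)"
    by (rule cf_linear_ext) (auto simp: in_keys_iff)
  then show "cf (linear_ext f (scale c x)) b = cf (scale c (linear_ext f x)) b"
    by (simp add: cf_linear_ext[of "Poly_Mapping.keys x"] sum_distrib_left mult.assoc)
qed

lemma linear_ext_fun_add:
  "linear_ext (\<lambda>a. f a + g a) x = linear_ext f x + linear_ext g x"
  by (simp add: linear_ext_def free.scale_right_distrib sum.distrib)

lemma linear_ext_fun_scale:
  "linear_ext (\<lambda>a. scale c (f a)) x = scale c (linear_ext f x)"
  by (simp add: linear_ext_def free.scale_sum_right mult.commute)

lemma bilinear_ext_add_left: "bilinear_ext f (x + y) z = bilinear_ext f x z + bilinear_ext f y z"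
  and bilinear_ext_add_right: "bilinear_ext f z (x + y) = bilinear_ext f z x + bilinear_ext f z y"
  and bilinear_ext_scale_left: "bilinear_ext f (scale c x) z = scale c (bilinear_ext f x z)"
  and bilinear_ext_scale_right: "bilinear_ext f z (scale c x) = scale c (bilinear_ext f z x)"
  by (simp_all add: bilinear_ext_def linear_ext_add linear_ext_scale linear_ext_fun_add
      linear_ext_fun_scale)

lemma cf_bilinear_ext:
  "cf (bilinear_ext f x y) w
     = (\<Sum>u\<in>Poly_Mapping.keys x. \<Sum>v\<in>Poly_Mapping.keys y. cf x u * cf y v * cf (f u v) w)"
  by (simp add: bilinear_ext_def cf_linear_ext[OF _ order_refl] sum_distrib_left mult.assoc)


section \<open>Restricting packed words to value intervals\<close>

lemma max_letter_Nil [simp]: "max_letter [] = 0"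
  by (simp add: max_letter_def)

lemma max_letter_eqI: "set w = {1..p} \<Longrightarrow> max_letter w = p"
proof -
  assume w: "set w = {1..p}"
  have "insert 0 {1..p} = {0..p}" by auto
  then have "max_letter w = Max {0..p}" by (simp only: max_letter_def w)
  then show ?thesis using Max_eqI[of "{0..p}" p] by simp
qed

lemma packed_wordI: "set w = {1..p} \<Longrightarrow> packed_word w"
  using max_letter_eqI[of w p] by (simp add: packed_word_def)

lemma packed_word_set: "packed_word w \<Longrightarrow> set w = {1..max_letter w}"
  by (simp add: packed_word_def)

lemma packed_word_Nil [simp]: "packed_word []"
  by (simp add: packed_word_def)

lemma packed_max_letter_0: "packed_word w \<Longrightarrow> max_letter w = 0 \<longleftrightarrow> w = []"
  by (auto dest: packed_word_set)

lemma last_letter_bounds: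
  assumes "packed_word w" "w \<noteq> []"
  shows "1 \<le> last w" "last w \<le> max_letter w"
  using last_in_set[OF assms(2)] packed_word_set[OF assms(1)] by auto

text \<open>\<open>R w\<close> occurs in the product of \<open>R u\<close> and \<open>R v\<close> iff \<open>u = lo m w\<close> and \<open>v = hi m w\<close> for some \<open>m\<close>,
  so that products are convolutions over the cuts \<open>m\<close> of the range of values.\<close>

definition lo :: "nat \<Rightarrow> nat list \<Rightarrow> nat list" where
  "lo m w = filter (\<lambda>c. c \<le> m) w"

definition hi :: "nat \<Rightarrow> nat list \<Rightarrow> nat list" where
  "hi m w = map (\<lambda>c. c - m) (filter (\<lambda>c. m < c) w)"

lemma set_lo: "packed_word w \<Longrightarrow> m \<le> max_letter w \<Longrightarrow> set (lo m w) = {1..m}"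
  by (auto simp: lo_def packed_word_set)

lemma set_hi: "packed_word w \<Longrightarrow> m \<le> max_letter w \<Longrightarrow> set (hi m w) = {1..max_letter w - m}"
proof -
  assume w: "packed_word w" and m: "m \<le> max_letter w"
  have "set (hi m w) = (\<lambda>c. c - m) ` {m<..max_letter w}"
    using packed_word_set[OF w] by (auto simp: hi_def)
  also have "\<dots> = {1..max_letter w - m}"
  proof (intro equalityI subsetI)
    fix c assume "c \<in> {1..max_letter w - m}"
    then show "c \<in> (\<lambda>c. c - m) ` {m<..max_letter w}"
      by (intro image_eqI[of _ _ "c + m"]) auto
  qed auto
  finally show ?thesis .
qed

lemma packed_lo [simp]: "packed_word w \<Longrightarrow> m \<le> max_letter w \<Longrightarrow> packed_word (lo m w)"
  using packed_wordI set_lo by metis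

lemma packed_hi [simp]: "packed_word w \<Longrightarrow> m \<le> max_letter w \<Longrightarrow> packed_word (hi m w)"
  using packed_wordI set_hi by metis

lemma max_letter_lo [simp]: "packed_word w \<Longrightarrow> m \<le> max_letter w \<Longrightarrow> max_letter (lo m w) = m"
  using max_letter_eqI set_lo by metis

lemma max_letter_hi [simp]:
  "packed_word w \<Longrightarrow> m \<le> max_letter w \<Longrightarrow> max_letter (hi m w) = max_letter w - m"
  using max_letter_eqI set_hi by metis

lemma length_lo_hi: "length (lo m w) + length (hi m w) = length w"
  using sum_length_filter_compl[of "\<lambda>c. c \<le> m" w] by (simp add: lo_def hi_def not_le)

lemma lo_lo: "k \<le> m \<Longrightarrow> lo k (lo m w) = lo k w"
  unfolding lo_def filter_filter by (rule filter_cong) auto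

lemma hi_hi: "hi k (hi m w) = hi (m + k) w"
  by (induction w) (auto simp: hi_def)

lemma lo_hi: "lo k (hi m w) = hi m (lo (m + k) w)"
  by (induction w) (auto simp: hi_def lo_def)

lemma lo_max [simp]: "packed_word w \<Longrightarrow> lo (max_letter w) w = w"
  by (auto simp: lo_def filter_id_conv packed_word_set)

lemma hi_0 [simp]: "packed_word w \<Longrightarrow> hi 0 w = w"
  by (auto simp: hi_def filter_id_conv packed_word_set)

lemma lo_eq_Nil: "packed_word w \<Longrightarrow> m \<le> max_letter w \<Longrightarrow> lo m w = [] \<longleftrightarrow> m = 0"
  by (metis max_letter_lo packed_lo packed_max_letter_0)

lemma hi_eq_Nil: "packed_word w \<Longrightarrow> m \<le> max_letter w \<Longrightarrow> hi m w = [] \<longleftrightarrow> m = max_letter w"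
  by (metis diff_is_0_eq le_antisym max_letter_hi packed_hi packed_max_letter_0 order_refl)

lemma last_lo: "w \<noteq> [] \<Longrightarrow> last w \<le> m \<Longrightarrow> lo m w \<noteq> [] \<and> last (lo m w) = last w"
  by (induction w rule: rev_induct) (auto simp: lo_def)

lemma last_hi: "w \<noteq> [] \<Longrightarrow> m < last w \<Longrightarrow> hi m w \<noteq> [] \<and> last (hi m w) = last w - m"
  by (induction w rule: rev_induct) (auto simp: hi_def)


section \<open>Coefficients of half-products\<close>

definition packed_span :: "'k::field wqsym set" where
  "packed_span = {x. Poly_Mapping.keys x \<subseteq> Collect packed_word}"

lemma packed_spanD: "x \<in> packed_span \<Longrightarrow> \<not> packed_word w \<Longrightarrow> cf x w = 0"
  by (auto simp: packed_span_def in_keys_iff)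

lemma packed_spanI: "(\<And>w. \<not> packed_word w \<Longrightarrow> cf x w = 0) \<Longrightarrow> x \<in> packed_span"
  by (auto simp: packed_span_def in_keys_iff)

lemma packed_span_eqI: "x \<in> packed_span \<Longrightarrow> y \<in> packed_span \<Longrightarrow> (\<And>w. packed_word w \<Longrightarrow> cf x w = cf y w) \<Longrightarrow> x = y"
  by (rule poly_mapping_eqI) (metis packed_spanD)

lemma cf_R: "cf (R u) w = (if w = u then 1 else 0)"
  by (simp add: R_def lookup_single when_def)

definition tag :: "nat \<Rightarrow> nat list \<Rightarrow> (bool \<times> nat) list" where
  "tag m w = map (\<lambda>c. (c \<le> m, c)) w"

text \<open>A letter stems from \<open>u\<close> exactly if it is at most
  \<open>max_letter u\<close>, so the word determines the tags. Hence every multiplicity in a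
  half-product of two basis elements is 0 or 1.\<close>

lemma tagged_shuffles_iff:
  assumes "packed_word u" "packed_word v"
  shows "\<tau> \<in> tagged_shuffles u v \<and> map snd \<tau> = w \<longleftrightarrow>
         w \<noteq> [] \<and> \<tau> = tag (max_letter u) w \<and> lo (max_letter u) w = u \<and> hi (max_letter u) w = v"
proof -
  let ?m = "max_letter u"
  let ?U = "map (Pair True) u" and ?V = "map (Pair False) (map (\<lambda>a. a + ?m) v)"
  have u: "\<forall>c\<in>set u. c \<le> ?m" and v: "\<forall>c\<in>set v. 0 < c"
    using assms by (auto dest: packed_word_set)
  have disj: "set ?U \<inter> set ?V = {}" by auto
  show ?thesis
  proof (intro iffI; elim conjE)
    assume \<tau>: "\<tau> \<in> tagged_shuffles u v" and w: "map snd \<tau> = w"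
    have sh: "\<tau> \<in> shuffles ?U ?V" and ne: "\<tau> \<noteq> []"
      using \<tau> by (auto simp: tagged_shuffles_def)
    have set\<tau>: "set \<tau> = set ?U \<union> set ?V" using set_shuffles[OF sh] .
    have "\<forall>p\<in>set \<tau>. fst p = (snd p \<le> ?m)"
      unfolding set\<tau> using u v by auto
    then have tag: "\<tau> = tag ?m w"
      unfolding tag_def w[symmetric] by (auto simp: map_idI prod_eq_iff)
    have fU: "filter fst \<tau> = ?U"
    proof -
      have "filter fst \<tau> = filter (\<lambda>x. x \<in> set ?U) \<tau>"
        by (rule filter_cong[OF refl]) (auto simp: set\<tau>)
      then show ?thesis using filter_shuffles_disjoint1(1)[OF disj sh] by simp
    qed
    have fV: "filter (\<lambda>p. \<not> fst p) \<tau> = ?V"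
    proof -
      have "filter (\<lambda>p. \<not> fst p) \<tau> = filter (\<lambda>x. x \<notin> set ?U) \<tau>"
        by (rule filter_cong[OF refl]) (auto simp: set\<tau>)
      then show ?thesis using filter_shuffles_disjoint1(2)[OF disj sh] by simp
    qed
    have "lo ?m w = map snd (filter fst \<tau>)"
      unfolding tag by (induction w) (auto simp: lo_def tag_def)
    then have "lo ?m w = u" by (simp add: fU comp_def)
    moreover have "hi ?m w = map (\<lambda>c. c - ?m) (map snd (filter (\<lambda>p. \<not> fst p) \<tau>))"
      unfolding tag by (induction w) (auto simp: hi_def tag_def)
    then have "hi ?m w = v" by (simp add: fV comp_def)
    ultimately show "w \<noteq> [] \<and> \<tau> = tag ?m w \<and> lo ?m w = u \<and> hi ?m w = v"
      using tag ne w by auto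
  next
    assume ne: "w \<noteq> []" and \<tau>: "\<tau> = tag ?m w" and lo: "lo ?m w = u" and hi: "hi ?m w = v"
    have "filter fst \<tau> = map (Pair True) (lo ?m w)"
      unfolding \<tau> by (induction w) (auto simp: lo_def tag_def)
    moreover have "filter (\<lambda>p. \<not> fst p) \<tau> = map (Pair False) (map (\<lambda>a. a + ?m) (hi ?m w))"
      unfolding \<tau> by (induction w) (auto simp: hi_def tag_def)
    ultimately have "\<tau> \<in> shuffles ?U ?V"
      using partition_in_shuffles[of \<tau> fst] lo hi by simp
    then show "\<tau> \<in> tagged_shuffles u v \<and> map snd \<tau> = w"
      using ne \<tau> by (auto simp: tagged_shuffles_def tag_def comp_def)
  qed
qed

lemma finite_tagged_shuffles: "finite (tagged_shuffles u v)"
  by (simp add: tagged_shuffles_def)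

lemma cf_sum_tagged:
  assumes "packed_word u" "packed_word v"
  shows "cf (\<Sum>\<tau>\<in>{\<tau> \<in> tagged_shuffles u v. Q \<tau>}. R (map snd \<tau>)) w
       = (if w \<noteq> [] \<and> Q (tag (max_letter u) w) \<and> lo (max_letter u) w = u
             \<and> hi (max_letter u) w = v then 1 else 0)"
proof -
  let ?S = "{\<tau> \<in> tagged_shuffles u v. Q \<tau>}"
  have fin: "finite ?S" using finite_tagged_shuffles by simp
  have "cf (\<Sum>\<tau>\<in>?S. R (map snd \<tau>)) w = (\<Sum>\<tau>\<in>?S. if map snd \<tau> = w then 1 else 0)"
    by (simp add: lookup_sum cf_R eq_commute)
  also have "\<dots> = of_nat (card {\<tau>\<in>?S. map snd \<tau> = w})"
    by (simp only: sum.inter_filter[OF fin, symmetric]) simp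
  also have "{\<tau>\<in>?S. map snd \<tau> = w} = {\<tau>. (\<tau> \<in> tagged_shuffles u v \<and> map snd \<tau> = w) \<and> Q \<tau>}"
    by blast
  also have "\<dots> = (if w \<noteq> [] \<and> Q (tag (max_letter u) w) \<and> lo (max_letter u) w = u
      \<and> hi (max_letter u) w = v then {tag (max_letter u) w} else {})"
    unfolding tagged_shuffles_iff[OF assms] by auto
  finally show ?thesis by (auto split: if_splits)
qed

text \<open>For a fixed \<open>w\<close> each \<open>u\<close> admits at most one \<open>v\<close>,
  and \<open>u\<close> itself is \<open>lo m w\<close> for \<open>m = max_letter u\<close>. So the
  double sum over the supports collapses to a sum over \<open>m\<close>.\<close>

lemma cf_tagged_product:
  assumes x: "x \<in> packed_span" and y: "y \<in> packed_span" and w: "packed_word w" "w \<noteq> []"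
    and Q: "\<And>m. Q (tag m w) \<longleftrightarrow> Q' m"
  shows "cf (bilinear_ext (\<lambda>u v. \<Sum>\<tau>\<in>{\<tau> \<in> tagged_shuffles u v. Q \<tau>}. R (map snd \<tau>)) x y) w
       = (\<Sum>m | m \<le> max_letter w \<and> Q' m. cf x (lo m w) * cf y (hi m w))"
    (is "cf ?p w = _")
proof -
  let ?X = "Poly_Mapping.keys x" and ?Y = "Poly_Mapping.keys y"
  have X: "u \<in> ?X \<Longrightarrow> packed_word u" and Y: "u \<in> ?Y \<Longrightarrow> packed_word u" for u
    using x y by (auto simp: packed_span_def)
  let ?M = "{m. m \<le> max_letter w \<and> Q' m}"
  let ?C = "\<lambda>u v. Q' (max_letter u) \<and> lo (max_letter u) w = u \<and> hi (max_letter u) w = v"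
  have "cf ?p w = (\<Sum>u\<in>?X. \<Sum>v\<in>?Y. cf x u * cf y v * (if ?C u v then 1 else 0))"
    unfolding cf_bilinear_ext
    by (intro sum.cong refl) (simp add: cf_sum_tagged X Y Q w)
  also have "\<dots> = (\<Sum>u\<in>?X. if Q' (max_letter u) \<and> lo (max_letter u) w = u
      then cf x u * cf y (hi (max_letter u) w) else 0)"
  proof (intro sum.cong refl)
    fix u
    have "(\<Sum>v\<in>?Y. cf x u * cf y v * (if ?C u v then 1 else 0))
        = (\<Sum>v\<in>?Y. if v = hi (max_letter u) w then
             (if Q' (max_letter u) \<and> lo (max_letter u) w = u then cf x u * cf y v else 0) else 0)"
      by (intro sum.cong refl) auto
    then show "(\<Sum>v\<in>?Y. cf x u * cf y v * (if ?C u v then 1 else 0))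
      = (if Q' (max_letter u) \<and> lo (max_letter u) w = u
         then cf x u * cf y (hi (max_letter u) w) else 0)"
      by (simp add: sum.delta' in_keys_iff)
  qed
  also have "\<dots> = (\<Sum>u\<in>{u\<in>?X. Q' (max_letter u) \<and> lo (max_letter u) w = u}.
      cf x u * cf y (hi (max_letter u) w))"
    by (subst sum.inter_filter) auto
  also have "\<dots> = (\<Sum>m\<in>?M. cf x (lo m w) * cf y (hi m w))"
  \<comment> \<open>\<open>T'\<close> collects the cuts whose lower word is outside the support of
    \<open>x\<close>; their summands are zero.\<close>
  proof (rule sum.reindex_bij_witness_not_neutral[where
      j = "max_letter" and i = "\<lambda>m. lo m w" and S' = "{}" and
      T' = "{m \<in> ?M. lo m w \<notin> ?X}"])
    fix u assume "u \<in> {u\<in>?X. Q' (max_letter u) \<and> lo (max_letter u) w = u} - {}"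
    then have u: "u \<in> ?X" "Q' (max_letter u)" "lo (max_letter u) w = u" by auto
    have "max_letter u \<le> max_letter w"
    proof (cases "u = []")
      case False
      then have "max_letter u \<in> set u"
        using packed_word_set[OF X[OF u(1)]] packed_max_letter_0[OF X[OF u(1)]] by auto
      then have "max_letter u \<in> set w" using u(3) by (metis filter_is_subset lo_def subsetD)
      then show ?thesis using packed_word_set[OF w(1)] by auto
    qed simp
    then show "max_letter u \<in> ?M - {m \<in> ?M. lo m w \<notin> ?X}" using u by simp
  qed (auto simp: w in_keys_iff)
  finally show ?thesis .
qed

lemma last_tag: "w \<noteq> [] \<Longrightarrow> fst (last (tag m w)) \<longleftrightarrow> last w \<le> m"
  by (simp add: tag_def last_map)

lemma cf_prec:
  assumes "x \<in> packed_span" "y \<in> packed_span" "packed_word w" "w \<noteq> []"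
  shows "cf (x \<prec>\<prec> y) w = (\<Sum>m | m \<le> max_letter w \<and> last w \<le> m. cf x (lo m w) * cf y (hi m w))"
  unfolding half_prec_def
  by (rule cf_tagged_product[OF assms]) (simp add: last_tag assms)

lemma cf_succ:
  assumes "x \<in> packed_span" "y \<in> packed_span" "packed_word w" "w \<noteq> []"
  shows "cf (x \<succ>\<succ> y) w = (\<Sum>m | m \<le> max_letter w \<and> m < last w. cf x (lo m w) * cf y (hi m w))"
  unfolding half_succ_def
  by (rule cf_tagged_product[OF assms]) (auto simp: last_tag assms)

text \<open>With \<open>Q\<close> left open, this yields packedness, degree and absence of a
  constant term for both half-products at once.\<close>

lemma cf_tagged_product_support:
  assumes x: "x \<in> packed_span" and y: "y \<in> packed_span"
    and nz: "cf (bilinear_ext (\<lambda>u v. \<Sum>\<tau>\<in>{\<tau> \<in> tagged_shuffles u v. Q \<tau>}. R (map snd \<tau>)) x y) w \<noteq> 0"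
  shows "\<exists>u v. cf x u \<noteq> 0 \<and> cf y v \<noteq> 0 \<and> packed_word w \<and> w \<noteq> [] \<and> length w = length u + length v"
proof -
  from nz obtain u v where uv: "u \<in> Poly_Mapping.keys x" "v \<in> Poly_Mapping.keys y"
    and nz': "cf (\<Sum>\<tau>\<in>{\<tau> \<in> tagged_shuffles u v. Q \<tau>}. R (map snd \<tau>)) w \<noteq> (0::'a)"
    unfolding cf_bilinear_ext by (elim sum.not_neutral_contains_not_neutral) auto
  have p: "packed_word u" "packed_word v" using uv x y by (auto simp: packed_span_def)
  have C: "w \<noteq> []" "lo (max_letter u) w = u" "hi (max_letter u) w = v"
    using nz' unfolding cf_sum_tagged[OF p] by (simp_all split: if_splits)
  let ?m = "max_letter u"
  have "set w = {c\<in>set w. c \<le> ?m} \<union> {c\<in>set w. ?m < c}" by auto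
  also have "{c\<in>set w. c \<le> ?m} = {1..?m}"
    using packed_word_set[OF p(1)] C(2) by (metis lo_def set_filter)
  also have "{c\<in>set w. ?m < c} = (\<lambda>c. c + ?m) ` set (hi ?m w)"
    by (force simp: hi_def)
  also have "\<dots> = {?m + 1..?m + max_letter v}"
    unfolding C packed_word_set[OF p(2)] by (simp add: add.commute)
  also have "{1..?m} \<union> \<dots> = {1..?m + max_letter v}" by auto
  finally have "packed_word w" by (rule packed_wordI)
  moreover have "length w = length u + length v"
    using length_lo_hi[of ?m w] C by simp
  ultimately show ?thesis using uv C(1) by (auto simp: in_keys_iff)
qed

lemma prec_packed_span [simp]: "x \<in> packed_span \<Longrightarrow> y \<in> packed_span \<Longrightarrow> x \<prec>\<prec> y \<in> packed_span"
  and succ_packed_span [simp]: "x \<in> packed_span \<Longrightarrow> y \<in> packed_span \<Longrightarrow> x \<succ>\<succ> y \<in> packed_span"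
  unfolding half_prec_def half_succ_def
  using cf_tagged_product_support[of x y] by (intro packed_spanI; meson)+

lemma cf_prec_Nil [simp]: "x \<in> packed_span \<Longrightarrow> y \<in> packed_span \<Longrightarrow> cf (x \<prec>\<prec> y) [] = 0"
  and cf_succ_Nil [simp]: "x \<in> packed_span \<Longrightarrow> y \<in> packed_span \<Longrightarrow> cf (x \<succ>\<succ> y) [] = 0"
  unfolding half_prec_def half_succ_def
  using cf_tagged_product_support[of x y _ "[]"] by meson+

lemma WQSym_packed_span: "x \<in> WQSym n \<Longrightarrow> x \<in> packed_span"
  by (auto simp: WQSym_def packed_span_def PW_def)

lemma WQSymD: "x \<in> WQSym n \<Longrightarrow> length w \<noteq> n \<Longrightarrow> cf x w = 0"
  by (auto simp: WQSym_def PW_def in_keys_iff)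

lemma WQSymI: "x \<in> packed_span \<Longrightarrow> (\<And>w. packed_word w \<Longrightarrow> length w \<noteq> n \<Longrightarrow> cf x w = 0) \<Longrightarrow> x \<in> WQSym n"
  by (auto simp: WQSym_def PW_def packed_span_def in_keys_iff)

lemma prec_WQSym: "x \<in> WQSym i \<Longrightarrow> y \<in> WQSym j \<Longrightarrow> x \<prec>\<prec> y \<in> WQSym (i + j)"
  and succ_WQSym: "x \<in> WQSym i \<Longrightarrow> y \<in> WQSym j \<Longrightarrow> x \<succ>\<succ> y \<in> WQSym (i + j)"
proof -
  assume xy: "x \<in> WQSym i" "y \<in> WQSym j"
  show "x \<prec>\<prec> y \<in> WQSym (i + j)" "x \<succ>\<succ> y \<in> WQSym (i + j)"
    unfolding half_prec_def half_succ_def WQSym_def PW_def mem_Collect_eq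
    using WQSymD[OF xy(1)] WQSymD[OF xy(2)]
    by (auto simp: in_keys_iff dest!: cf_tagged_product_support[OF WQSym_packed_span[OF xy(1)] WQSym_packed_span[OF xy(2)]])
      (metis add.commute)+
qed


section \<open>Dendriform relations\<close>

lemma prec_add_right: "z \<prec>\<prec> (x + y) = z \<prec>\<prec> x + z \<prec>\<prec> y"
  and prec_scale_right: "z \<prec>\<prec> scale c x = scale c (z \<prec>\<prec> x)"
  and succ_add_left: "(x + y) \<succ>\<succ> z = x \<succ>\<succ> z + y \<succ>\<succ> z"
  and succ_scale_left: "scale c x \<succ>\<succ> z = scale c (x \<succ>\<succ> z)"
  by (simp_all add: half_prec_def half_succ_def bilinear_ext_add_left bilinear_ext_add_right
      bilinear_ext_scale_left bilinear_ext_scale_right)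

lemma prec_zero_right [simp]: "z \<prec>\<prec> 0 = 0"
  and succ_zero_left [simp]: "0 \<succ>\<succ> z = 0"
  using prec_scale_right[of z 0 0] succ_scale_left[of 0 0 z] by simp_all

lemma prec_sum_right: "z \<prec>\<prec> (\<Sum>i\<in>I. f i) = (\<Sum>i\<in>I. z \<prec>\<prec> f i)"
  by (induction I rule: infinite_finite_induct) (simp_all add: prec_add_right)

lemma succ_sum_left: "(\<Sum>i\<in>I. f i) \<succ>\<succ> z = (\<Sum>i\<in>I. f i \<succ>\<succ> z)"
  by (induction I rule: infinite_finite_induct) (simp_all add: succ_add_left)

lemma packed_span_zero [simp]: "0 \<in> packed_span"
  and packed_span_add [simp]: "x \<in> packed_span \<Longrightarrow> y \<in> packed_span \<Longrightarrow> x + y \<in> packed_span"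
  and packed_span_scale [simp]: "x \<in> packed_span \<Longrightarrow> scale c x \<in> packed_span"
  by (auto intro!: packed_spanI simp: lookup_add packed_spanD)

lemma packed_span_sum: "(\<And>i. i \<in> I \<Longrightarrow> f i \<in> packed_span) \<Longrightarrow> (\<Sum>i\<in>I. f i) \<in> packed_span"
  by (induction I rule: infinite_finite_induct) auto

lemma packed_span_R [simp]: "packed_word u \<Longrightarrow> R u \<in> packed_span"
  by (rule packed_spanI) (auto simp: cf_R)

lemma WQSym_plus_iff: "x \<in> WQSym_plus \<longleftrightarrow> x \<in> packed_span \<and> cf x [] = 0"
proof -
  have "(\<Union>n\<in>{1..}. PW n) = {w. packed_word w \<and> w \<noteq> []}"
    by (auto simp: PW_def Suc_le_eq)
  then show ?thesis by (auto simp: WQSym_plus_def packed_span_def in_keys_iff)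
qed

lemma WQSym_plus_packed_span: "x \<in> WQSym_plus \<Longrightarrow> x \<in> packed_span"
  and WQSym_plus_Nil: "x \<in> WQSym_plus \<Longrightarrow> cf x [] = 0"
  by (simp_all add: WQSym_plus_iff)

text \<open>The full product. The half-products skip the empty shuffle, so the product of the
  constant terms is added by hand.\<close>

definition mul :: "'k::field wqsym \<Rightarrow> 'k wqsym \<Rightarrow> 'k wqsym" where
  "mul x y = x \<prec>\<prec> y + x \<succ>\<succ> y + scale (cf x [] * cf y []) (R [])"

lemma mul_packed_span [simp]: "x \<in> packed_span \<Longrightarrow> y \<in> packed_span \<Longrightarrow> mul x y \<in> packed_span"
  by (simp add: mul_def)

lemma cf_mul:
  assumes "x \<in> packed_span" "y \<in> packed_span" "packed_word w"
  shows "cf (mul x y) w = (\<Sum>m\<le>max_letter w. cf x (lo m w) * cf y (hi m w))"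
proof (cases "w = []")
  case True
  then show ?thesis
    by (simp add: mul_def lookup_add assms cf_R lo_def hi_def)
next
  case False
  let ?f = "\<lambda>m. cf x (lo m w) * cf y (hi m w)"
  have "cf (mul x y) w = (\<Sum>m | m \<le> max_letter w \<and> last w \<le> m. ?f m)
      + (\<Sum>m | m \<le> max_letter w \<and> m < last w. ?f m)"
    using False by (simp add: mul_def lookup_add cf_R cf_prec cf_succ assms)
  also have "\<dots> = (\<Sum>m\<in>{m. m \<le> max_letter w \<and> last w \<le> m} \<union> {m. m \<le> max_letter w \<and> m < last w}. ?f m)"
    by (rule sum.union_disjoint[symmetric]) auto
  also have "{m. m \<le> max_letter w \<and> last w \<le> m} \<union> {m. m \<le> max_letter w \<and> m < last w}
      = {..max_letter w}" by auto
  finally show ?thesis .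
qed

lemma sum_triangle:
  fixes M :: nat
  assumes "\<And>k r. k + r \<le> M \<Longrightarrow> P (k + r) \<and> Q k (k + r) \<longleftrightarrow> P' k \<and> Q' k r"
  shows "(\<Sum>m | m \<le> M \<and> P m. \<Sum>k | k \<le> m \<and> Q k m. f k m)
       = (\<Sum>k | k \<le> M \<and> P' k. \<Sum>r | r \<le> M - k \<and> Q' k r. f k (k + r))"
proof -
  have "(\<Sum>m | m \<le> M \<and> P m. \<Sum>k | k \<le> m \<and> Q k m. f k m)
      = (\<Sum>(m, k)\<in>(SIGMA m:{m. m \<le> M \<and> P m}. {k. k \<le> m \<and> Q k m}). f k m)"
    by (rule sum.Sigma) auto
  also have "\<dots> = (\<Sum>(k, r)\<in>(SIGMA k:{k. k \<le> M \<and> P' k}. {r. r \<le> M - k \<and> Q' k r}). f k (k + r))"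
  proof (rule sum.reindex_bij_witness[where i = "\<lambda>(k, r). (k + r, k)" and j = "\<lambda>(m, k). (k, m - k)"])
    fix a assume "a \<in> (SIGMA m:{m. m \<le> M \<and> P m}. {k. k \<le> m \<and> Q k m})"
    then show "(case a of (m, k) \<Rightarrow> (k, m - k)) \<in> (SIGMA k:{k. k \<le> M \<and> P' k}. {r. r \<le> M - k \<and> Q' k r})"
      using assms[of "snd a" "fst a - snd a"] by auto
  next
    fix a assume "a \<in> (SIGMA k:{k. k \<le> M \<and> P' k}. {r. r \<le> M - k \<and> Q' k r})"
    then show "(case a of (k, r) \<Rightarrow> (k + r, k)) \<in> (SIGMA m:{m. m \<le> M \<and> P m}. {k. k \<le> m \<and> Q k m})"
      using assms[of "fst a" "snd a"] by auto
  qed auto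
  also have "\<dots> = (\<Sum>k | k \<le> M \<and> P' k. \<Sum>r | r \<le> M - k \<and> Q' k r. f k (k + r))"
    by (rule sum.Sigma[symmetric]) auto
  finally show ?thesis .
qed

text \<open>Two cuts \<open>k \<le> m\<close> of the values of \<open>w\<close> can be made in
  either order. The predicates record in which of the three value intervals the last letter lies, so
  each dendriform relation is one instance.\<close>

lemma conv_assoc:
  fixes a b c :: "nat list \<Rightarrow> 'k::field"
  assumes "\<And>k r. k + r \<le> M \<Longrightarrow> P (k + r) \<and> Q k (k + r) \<longleftrightarrow> P' k \<and> Q' k r"
  shows "(\<Sum>m | m \<le> M \<and> P m.
            (\<Sum>k | k \<le> m \<and> Q k m. a (lo k (lo m w)) * b (hi k (lo m w))) * c (hi m w))
       = (\<Sum>k | k \<le> M \<and> P' k.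
            a (lo k w) * (\<Sum>r | r \<le> M - k \<and> Q' k r. b (lo r (hi k w)) * c (hi r (hi k w))))"
proof -
  have "(\<Sum>m | m \<le> M \<and> P m.
            (\<Sum>k | k \<le> m \<and> Q k m. a (lo k (lo m w)) * b (hi k (lo m w))) * c (hi m w))
      = (\<Sum>m | m \<le> M \<and> P m. \<Sum>k | k \<le> m \<and> Q k m. a (lo k w) * b (hi k (lo m w)) * c (hi m w))"
    unfolding sum_distrib_right by (intro sum.cong refl) (simp add: lo_lo)
  also have "\<dots> = (\<Sum>k | k \<le> M \<and> P' k. \<Sum>r | r \<le> M - k \<and> Q' k r.
      a (lo k w) * b (hi k (lo (k + r) w)) * c (hi (k + r) w))"
    using assms by (intro sum_triangle) blast
  finally show ?thesis by (simp add: lo_hi hi_hi sum_distrib_left mult.assoc)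
qed

text \<open>In this relation the last letter of \<open>w\<close> lies in the lowest of the three
  value intervals, in \<open>succ_prec\<close> in the middle one and in \<open>mul_succ\<close> in
  the highest one.\<close>

lemma prec_prec:
  assumes "a \<in> packed_span" "b \<in> packed_span" "c \<in> packed_span"
  shows "(a \<prec>\<prec> b) \<prec>\<prec> c = a \<prec>\<prec> mul b c"
proof (rule packed_span_eqI)
  fix w assume w: "packed_word w"
  show "cf ((a \<prec>\<prec> b) \<prec>\<prec> c) w = cf (a \<prec>\<prec> mul b c) w"
  proof (cases "w = []")
    case False
    have "cf ((a \<prec>\<prec> b) \<prec>\<prec> c) w = (\<Sum>m | m \<le> max_letter w \<and> last w \<le> m.
        (\<Sum>k | k \<le> m \<and> last w \<le> k. cf a (lo k (lo m w)) * cf b (hi k (lo m w))) * cf c (hi m w))"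
      using False w by (simp add: cf_prec assms last_lo cong: sum.cong_simp)
    also have "\<dots> = (\<Sum>k | k \<le> max_letter w \<and> last w \<le> k. cf a (lo k w) *
        (\<Sum>r | r \<le> max_letter w - k \<and> True. cf b (lo r (hi k w)) * cf c (hi r (hi k w))))"
      by (rule conv_assoc) auto
    also have "\<dots> = cf (a \<prec>\<prec> mul b c) w"
      using False w by (simp add: cf_prec cf_mul assms atMost_def cong: sum.cong_simp)
    finally show ?thesis .
  qed (simp add: assms)
qed (simp_all add: assms)

lemma succ_prec:
  assumes "a \<in> packed_span" "b \<in> packed_span" "c \<in> packed_span"
  shows "(a \<succ>\<succ> b) \<prec>\<prec> c = a \<succ>\<succ> (b \<prec>\<prec> c)"
proof (rule packed_span_eqI)
  fix w assume w: "packed_word w"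
  show "cf ((a \<succ>\<succ> b) \<prec>\<prec> c) w = cf (a \<succ>\<succ> (b \<prec>\<prec> c)) w"
  proof (cases "w = []")
    case False
    have "cf ((a \<succ>\<succ> b) \<prec>\<prec> c) w = (\<Sum>m | m \<le> max_letter w \<and> last w \<le> m.
        (\<Sum>k | k \<le> m \<and> k < last w. cf a (lo k (lo m w)) * cf b (hi k (lo m w))) * cf c (hi m w))"
      using False w by (simp add: cf_prec cf_succ assms last_lo cong: sum.cong_simp)
    also have "\<dots> = (\<Sum>k | k \<le> max_letter w \<and> k < last w. cf a (lo k w) *
        (\<Sum>r | r \<le> max_letter w - k \<and> last w - k \<le> r. cf b (lo r (hi k w)) * cf c (hi r (hi k w))))"
      by (rule conv_assoc) auto
    also have "\<dots> = cf (a \<succ>\<succ> (b \<prec>\<prec> c)) w"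
      using False w by (simp add: cf_prec cf_succ assms last_hi cong: sum.cong_simp)
    finally show ?thesis .
  qed (simp add: assms)
qed (simp_all add: assms)

lemma mul_succ:
  assumes "a \<in> packed_span" "b \<in> packed_span" "c \<in> packed_span"
  shows "mul a b \<succ>\<succ> c = a \<succ>\<succ> (b \<succ>\<succ> c)"
proof (rule packed_span_eqI)
  fix w assume w: "packed_word w"
  show "cf (mul a b \<succ>\<succ> c) w = cf (a \<succ>\<succ> (b \<succ>\<succ> c)) w"
  proof (cases "w = []")
    case False
    have "cf (mul a b \<succ>\<succ> c) w = (\<Sum>m | m \<le> max_letter w \<and> m < last w.
        (\<Sum>k | k \<le> m \<and> True. cf a (lo k (lo m w)) * cf b (hi k (lo m w))) * cf c (hi m w))"
      using False w by (simp add: cf_succ cf_mul assms last_lo atMost_def cong: sum.cong_simp)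
    also have "\<dots> = (\<Sum>k | k \<le> max_letter w \<and> k < last w. cf a (lo k w) *
        (\<Sum>r | r \<le> max_letter w - k \<and> r < last w - k. cf b (lo r (hi k w)) * cf c (hi r (hi k w))))"
      by (rule conv_assoc) auto
    also have "\<dots> = cf (a \<succ>\<succ> (b \<succ>\<succ> c)) w"
      using False w by (simp add: cf_succ assms last_hi cong: sum.cong_simp)
    finally show ?thesis .
  qed (simp add: assms)
qed (simp_all add: assms)

lemma prec_unit_right: "x \<in> WQSym_plus \<Longrightarrow> x \<prec>\<prec> R [] = x"
proof (rule packed_span_eqI)
  fix w assume x: "x \<in> WQSym_plus" and w: "packed_word w"
  show "cf (x \<prec>\<prec> R []) w = cf x w"
  proof (cases "w = []")
    case False
    have "cf (x \<prec>\<prec> R []) w = (\<Sum>m | m \<le> max_letter w \<and> last w \<le> m.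
        if m = max_letter w then cf x w else 0)"
      unfolding cf_prec[OF WQSym_plus_packed_span[OF x] packed_span_R[OF packed_word_Nil] w False]
      by (intro sum.cong refl) (auto simp: cf_R hi_eq_Nil w)
    then show ?thesis using last_letter_bounds[OF w False] by (simp add: sum.delta)
  qed (use x in \<open>simp add: WQSym_plus_packed_span WQSym_plus_Nil\<close>)
qed (simp_all add: WQSym_plus_packed_span)

lemma succ_unit_left: "x \<in> WQSym_plus \<Longrightarrow> R [] \<succ>\<succ> x = x"
proof (rule packed_span_eqI)
  fix w assume x: "x \<in> WQSym_plus" and w: "packed_word w"
  show "cf (R [] \<succ>\<succ> x) w = cf x w"
  proof (cases "w = []")
    case False
    have "cf (R [] \<succ>\<succ> x) w = (\<Sum>m | m \<le> max_letter w \<and> m < last w.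
        if m = 0 then cf x w else 0)"
      unfolding cf_succ[OF packed_span_R[OF packed_word_Nil] WQSym_plus_packed_span[OF x] w False]
      by (intro sum.cong refl) (auto simp: cf_R lo_eq_Nil w)
    then show ?thesis using last_letter_bounds[OF w False] by (simp add: sum.delta)
  qed (use x in \<open>simp add: WQSym_plus_packed_span WQSym_plus_Nil\<close>)
qed (simp_all add: WQSym_plus_packed_span)

lemma prec_unit_left: "x \<in> packed_span \<Longrightarrow> R [] \<prec>\<prec> x = 0"
proof (rule packed_span_eqI)
  fix w assume x: "x \<in> packed_span" and w: "packed_word w"
  show "cf (R [] \<prec>\<prec> x) w = cf 0 w"
  proof (cases "w = []")
    case False
    then show ?thesis using w x last_letter_bounds[OF w False]
      by (auto simp: cf_prec cf_R lo_eq_Nil intro!: sum.neutral)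
  qed (simp add: x)
qed simp_all

lemma succ_unit_right: "x \<in> packed_span \<Longrightarrow> x \<succ>\<succ> R [] = 0"
proof (rule packed_span_eqI)
  fix w assume x: "x \<in> packed_span" and w: "packed_word w"
  show "cf (x \<succ>\<succ> R []) w = cf 0 w"
  proof (cases "w = []")
    case False
    then show ?thesis using w x last_letter_bounds[OF w False]
      by (auto simp: cf_succ cf_R hi_eq_Nil intro!: sum.neutral)
  qed (simp add: x)
qed simp_all


section \<open>Iterated half-products\<close>

text \<open>Since \<open>R [] \<succ> x = x\<close> and \<open>x \<prec> R [] = x\<close>, the initial value \<open>R []\<close> covers the empty products
  that are omitted in the brace bracket.\<close>

definition om :: "'k::field wqsym list \<Rightarrow> 'k wqsym" where
  "om xs = foldr (\<prec>\<prec>) xs (R [])"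

definition om' :: "'k::field wqsym list \<Rightarrow> 'k wqsym" where
  "om' xs = foldl (\<succ>\<succ>) (R []) xs"

lemma om_Nil [simp]: "om [] = R []" and om_Cons [simp]: "om (x # xs) = x \<prec>\<prec> om xs"
  and om'_Nil [simp]: "om' [] = R []" and om'_snoc [simp]: "om' (xs @ [x]) = om' xs \<succ>\<succ> x"
  by (simp_all add: om_def om'_def)

lemma om_packed_span [simp]: "set xs \<subseteq> WQSym_plus \<Longrightarrow> om xs \<in> packed_span"
  by (induction xs) (auto simp: WQSym_plus_packed_span)

lemma om'_packed_span [simp]: "set xs \<subseteq> WQSym_plus \<Longrightarrow> om' xs \<in> packed_span"
  by (induction xs rule: rev_induct) (auto simp: WQSym_plus_packed_span)

lemma om_WQSym_plus: "set xs \<subseteq> WQSym_plus \<Longrightarrow> xs \<noteq> [] \<Longrightarrow> om xs \<in> WQSym_plus"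
  by (cases xs) (auto simp: WQSym_plus_iff)

lemma om'_WQSym_plus: "set xs \<subseteq> WQSym_plus \<Longrightarrow> xs \<noteq> [] \<Longrightarrow> om' xs \<in> WQSym_plus"
  by (cases xs rule: rev_cases) (auto simp: WQSym_plus_iff)

lemma prec_iter_eq_om: "set xs \<subseteq> WQSym_plus \<Longrightarrow> xs \<noteq> [] \<Longrightarrow> prec_iter xs = om xs"
  by (induction xs rule: prec_iter.induct) (auto simp: prec_unit_right)

lemma succ_iter_eq_om': "set xs \<subseteq> WQSym_plus \<Longrightarrow> xs \<noteq> [] \<Longrightarrow> succ_iter xs = om' xs"
  by (cases xs) (auto simp: om'_def succ_unit_left)

text \<open>The vanishing of this sum makes braces of primitive elements primitive.\<close>

definition antipode_sum :: "'k::field wqsym list \<Rightarrow> 'k wqsym" where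
  "antipode_sum xs = (\<Sum>i\<le>length xs. scale ((- 1) ^ i) (mul (om (take i xs)) (om' (drop i xs))))"

text \<open>The term for \<open>i = 0\<close> vanishes by \<open>prec_unit_left\<close>. In every
  other term \<open>x\<close> is the first factor and comes out to the left by
  \<open>prec_prec\<close>; the index shift produces the minus sign.\<close>

lemma antipode_prec_part:
  assumes "set (x # xs) \<subseteq> WQSym_plus"
  shows "(\<Sum>i\<le>Suc (length xs). scale ((- 1) ^ i)
            (om (take i (x # xs)) \<prec>\<prec> om' (drop i (x # xs)))) = - (x \<prec>\<prec> antipode_sum xs)"
proof -
  have sub: "set (take i xs) \<subseteq> WQSym_plus" "set (drop i xs) \<subseteq> WQSym_plus" for i
    using assms set_take_subset[of i xs] set_drop_subset[of i xs] by auto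
  have "(\<Sum>i\<le>Suc (length xs). scale ((- 1) ^ i) (om (take i (x # xs)) \<prec>\<prec> om' (drop i (x # xs))))
      = (\<Sum>i\<le>length xs. scale (- ((- 1) ^ i)) ((x \<prec>\<prec> om (take i xs)) \<prec>\<prec> om' (drop i xs)))"
    using assms om'_packed_span[of "x # xs"]
    by (simp add: sum.atMost_Suc_shift prec_unit_left del: sum.atMost_Suc)
  also have "\<dots> = (\<Sum>i\<le>length xs. - (x \<prec>\<prec> scale ((- 1) ^ i) (mul (om (take i xs)) (om' (drop i xs)))))"
    using assms sub by (intro sum.cong refl) (simp add: prec_prec WQSym_plus_packed_span prec_scale_right)
  finally show ?thesis by (simp add: antipode_sum_def prec_sum_right sum_negf)
qed

text \<open>Mirror image: the last term vanishes by \<open>succ_unit_right\<close>, and in the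
  others \<open>x\<close> comes out to the right by \<open>mul_succ\<close>. No index is shifted,
  hence no sign.\<close>

lemma antipode_succ_part:
  assumes "set (xs @ [x]) \<subseteq> WQSym_plus"
  shows "(\<Sum>i\<le>Suc (length xs). scale ((- 1) ^ i)
            (om (take i (xs @ [x])) \<succ>\<succ> om' (drop i (xs @ [x])))) = antipode_sum xs \<succ>\<succ> x"
proof -
  have sub: "set (take i xs) \<subseteq> WQSym_plus" "set (drop i xs) \<subseteq> WQSym_plus" for i
    using assms set_take_subset[of i xs] set_drop_subset[of i xs] by auto
  have "om (xs @ [x]) \<succ>\<succ> R [] = 0"
    by (rule succ_unit_right) (simp only: om_packed_span assms)
  then have "(\<Sum>i\<le>Suc (length xs). scale ((- 1) ^ i)
            (om (take i (xs @ [x])) \<succ>\<succ> om' (drop i (xs @ [x]))))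
      = (\<Sum>i\<le>length xs. scale ((- 1) ^ i) (om (take i xs) \<succ>\<succ> (om' (drop i xs) \<succ>\<succ> x)))"
    by simp
  also have "\<dots> = (\<Sum>i\<le>length xs. scale ((- 1) ^ i) (mul (om (take i xs)) (om' (drop i xs))) \<succ>\<succ> x)"
    using assms sub by (intro sum.cong refl) (simp add: mul_succ WQSym_plus_packed_span succ_scale_left)
  finally show ?thesis by (simp add: antipode_sum_def succ_sum_left)
qed

text \<open>Splitting \<open>mul\<close> into its halves leaves \<open>- (x \<prec>\<prec>
  antipode_sum ys) + antipode_sum zs \<succ>\<succ> z\<close>, where \<open>ys\<close> lacks the
  first entry and \<open>zs\<close> the last. For a single entry the two summands are
  \<open>- x\<close> and \<open>x\<close>; for longer lists both vanish by induction.\<close>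

lemma antipode_sum_eq:
  "set xs \<subseteq> WQSym_plus \<Longrightarrow> antipode_sum xs = (if xs = [] then R [] else 0)"
proof (induction "length xs" arbitrary: xs rule: less_induct)
  case less
  show ?case
  proof (cases "xs = []")
    case True
    then show ?thesis
      by (simp add: antipode_sum_def mul_def prec_unit_left succ_unit_right cf_R)
  next
    case False
    then obtain x ys z zs where xs: "xs = x # ys" "xs = zs @ [z]"
      by (metis list.exhaust rev_exhaust)
    have len: "length ys < length xs" "length zs < length xs"
      and len': "length xs = Suc (length ys)" "length xs = Suc (length zs)"
      using xs by (simp, metis length_append_singleton lessI, simp, metis length_append_singleton)
    have sub: "set ys \<subseteq> WQSym_plus" "set zs \<subseteq> WQSym_plus" "x \<in> WQSym_plus" "z \<in> WQSym_plus"
      using less.prems xs by (simp, metis Un_subset_iff set_append, simp, metis in_set_conv_decomp subsetD)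
    have sub': "set (take i xs) \<subseteq> WQSym_plus" "set (drop i xs) \<subseteq> WQSym_plus" for i
      using less.prems set_take_subset[of i xs] set_drop_subset[of i xs] by auto
    \<comment> \<open>One of the two lists is non-empty and its product has no constant term, so
      \<open>mul\<close> reduces to the two half-products.\<close>
    have no_unit: "cf (om (take i xs)) [] * cf (om' (drop i xs)) [] = 0" for i
    proof (cases "take i xs = []")
      case True
      then have "drop i xs \<noteq> []" using False by auto
      then show ?thesis using om'_WQSym_plus[OF sub'(2)] by (simp add: WQSym_plus_Nil)
    next
      case False
      then show ?thesis using om_WQSym_plus[OF sub'(1)] by (simp add: WQSym_plus_Nil)
    qed
    have "antipode_sum xs
      = (\<Sum>i\<le>length xs. scale ((- 1) ^ i) (om (take i xs) \<prec>\<prec> om' (drop i xs)))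
      + (\<Sum>i\<le>length xs. scale ((- 1) ^ i) (om (take i xs) \<succ>\<succ> om' (drop i xs)))"
      by (simp add: antipode_sum_def mul_def no_unit free.scale_right_distrib sum.distrib)
    also have "(\<Sum>i\<le>length xs. scale ((- 1) ^ i) (om (take i xs) \<prec>\<prec> om' (drop i xs)))
        = - (x \<prec>\<prec> antipode_sum ys)"
      unfolding len'(1) unfolding xs(1) by (rule antipode_prec_part) (use sub in simp)
    also have "(\<Sum>i\<le>length xs. scale ((- 1) ^ i) (om (take i xs) \<succ>\<succ> om' (drop i xs)))
        = antipode_sum zs \<succ>\<succ> z"
      unfolding len'(2) unfolding xs(2) by (rule antipode_succ_part) (use sub in simp)
    also have "- (x \<prec>\<prec> antipode_sum ys) + antipode_sum zs \<succ>\<succ> z = 0"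
    proof (cases "ys = []")
      case True
      then have "zs = []" "z = x" using xs by auto
      then show ?thesis
        using True sub less.hyps[OF len(1)] by (simp add: prec_unit_right succ_unit_left)
    next
      case F: False
      then have "zs \<noteq> []" using xs by auto
      then show ?thesis
        using F sub less.hyps[OF len(1)] less.hyps[OF len(2)] by simp
    qed
    finally show ?thesis using False by simp
  qed
qed


section \<open>Positions of letters and joins\<close>

text \<open>\<open>occ \<tau> c i\<close> is the position, counted from 1, of the \<open>i\<close>-th occurrence of \<open>c\<close> in \<open>\<tau>\<close>.  Beyond the last
  occurrence it runs on past the end of \<open>\<tau>\<close>, which keeps it strictly monotone in \<open>i\<close>.\<close>

fun occ :: "'c list \<Rightarrow> 'c \<Rightarrow> nat \<Rightarrow> nat" where
  "occ [] c i = i"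
| "occ (d # \<tau>) c i = (if i = 0 then 0 else Suc (occ \<tau> c (if d = c then i - 1 else i)))"

lemma occ_0 [simp]: "occ \<tau> c 0 = 0"
  by (cases \<tau>) auto

lemma occ_strict_mono: "i < j \<Longrightarrow> occ \<tau> c i < occ \<tau> c j"
  by (induction \<tau> arbitrary: i j) auto

lemma occ_le_iff [simp]: "occ \<tau> c i \<le> occ \<tau> c j \<longleftrightarrow> i \<le> j"
  using occ_strict_mono[of i j \<tau> c] occ_strict_mono[of j i \<tau> c]
  by (cases i j rule: linorder_cases) auto

lemma occ_inj: "occ \<tau> c i = occ \<tau> c j \<Longrightarrow> i = j"
  by (metis occ_le_iff order_antisym order_refl)

lemma occ_eq_0 [simp]: "occ \<tau> c i = 0 \<longleftrightarrow> i = 0"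
  by (metis occ_0 occ_inj)

lemma occ_append:
  "occ (\<tau>1 @ \<tau>2) c i = (if i \<le> count_list \<tau>1 c then occ \<tau>1 c i
     else length \<tau>1 + occ \<tau>2 c (i - count_list \<tau>1 c))"
  by (induction \<tau>1 arbitrary: i) auto

lemma occ_le_length: "i \<le> count_list \<tau> c \<Longrightarrow> occ \<tau> c i \<le> length \<tau>"
proof (induction \<tau> arbitrary: i)
  case (Cons d \<tau>)
  then show ?case using Cons.IH[of "i - 1"] Cons.IH[of i] by (auto split: if_splits)
qed simp

lemma occ_image: "occ \<tau> c ` {1..count_list \<tau> c} = {j \<in> {1..length \<tau>}. \<tau> ! (j - 1) = c}"
proof (induction \<tau> rule: rev_induct)
  case (snoc d \<tau>)
  have *: "occ (\<tau> @ [d]) c ` {1..count_list \<tau> c} = {j \<in> {1..length \<tau>}. \<tau> ! (j - 1) = c}"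
    unfolding snoc[symmetric] by (intro image_cong refl) (simp add: occ_append)
  have **: "{j \<in> {1..length (\<tau> @ [d])}. (\<tau> @ [d]) ! (j - 1) = c}
      = {j \<in> {1..length \<tau>}. \<tau> ! (j - 1) = c} \<union> (if d = c then {Suc (length \<tau>)} else {})"
    by (auto simp: nth_append le_Suc_eq)
  show ?case
  proof (cases "d = c")
    case True
    then have "{1..count_list (\<tau> @ [d]) c} = insert (Suc (count_list \<tau> c)) {1..count_list \<tau> c}"
      by auto
    then have "occ (\<tau> @ [d]) c ` {1..count_list (\<tau> @ [d]) c}
        = insert (occ (\<tau> @ [d]) c (Suc (count_list \<tau> c))) (occ (\<tau> @ [d]) c ` {1..count_list \<tau> c})"
      by (simp only: image_insert)
    also have "occ (\<tau> @ [d]) c (Suc (count_list \<tau> c)) = Suc (length \<tau>)"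
      using True by (simp add: occ_append)
    finally show ?thesis using * ** True by simp
  next
    case False
    then have "count_list (\<tau> @ [d]) c = count_list \<tau> c" by simp
    then show ?thesis using * ** False by simp
  qed
qed simp

lemma occ_replicate [simp]: "occ (replicate q c) c i = i"
  by (induction q arbitrary: i) auto

lemma occ_count_take:
  "1 \<le> a \<Longrightarrow> a \<le> length \<tau> \<Longrightarrow> \<tau> ! (a - 1) = c \<Longrightarrow> occ \<tau> c (count_list (take a \<tau>) c) = a"
proof (induction \<tau> arbitrary: a)
  case (Cons d \<tau>)
  show ?case
  proof (cases "a = 1")
    case False
    then obtain b where "a = Suc (Suc b)" using Cons.prems by (metis One_nat_def Suc_le_D not0_implies_Suc)
    moreover have "count_list (take (Suc b) \<tau>) c \<noteq> 0"
      using Cons.prems calculation by (auto simp: count_list_0_iff in_set_conv_nth)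
    ultimately show ?thesis using Cons.IH[of "Suc b"] Cons.prems by auto
  qed (use Cons.prems in auto)
qed simp

text \<open>Codes of cuts: which of \<open>p + q\<close> values go to the left factor
  (\<open>True\<close>) and which to the right one.\<close>

definition bool_words :: "nat \<Rightarrow> nat \<Rightarrow> bool list set" where
  "bool_words p q = {\<beta>. count_list \<beta> True = p \<and> count_list \<beta> False = q}"

lemma length_bool_list: "length \<beta> = count_list \<beta> True + count_list \<beta> False"
  by (induction \<beta>) auto

lemma bool_words_length: "\<beta> \<in> bool_words p q \<Longrightarrow> length \<beta> = p + q"
  by (simp add: bool_words_def length_bool_list)

lemma finite_bool_words [simp]: "finite (bool_words p q)"
  by (rule finite_subset[OF _ finite_lists_length_eq[OF finite[of UNIV], of "p + q"]])
    (auto simp: bool_words_length)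

lemma bool_words_0_left: "bool_words 0 q = {replicate q False}"
proof -
  have "\<beta> = replicate q False" if "count_list \<beta> True = 0" "count_list \<beta> False = q" for \<beta>
    using that by (induction \<beta> arbitrary: q) (auto split: if_splits)
  moreover have "replicate q False \<in> bool_words 0 q" by (induction q) (auto simp: bool_words_def)
  ultimately show ?thesis by (auto simp: bool_words_def)
qed

lemma bool_words_0_right: "bool_words p 0 = {replicate p True}"
proof -
  have "\<beta> = replicate p True" if "count_list \<beta> False = 0" "count_list \<beta> True = p" for \<beta>
    using that by (induction \<beta> arbitrary: p) (auto split: if_splits)
  moreover have "replicate p True \<in> bool_words p 0" by (induction p) (auto simp: bool_words_def)
  ultimately show ?thesis by (auto simp: bool_words_def)
qed

text \<open>Letter \<open>j\<close> of the packed word \<open>join \<beta> s t\<close> belongs to the first factor iff \<open>\<beta> ! (j - 1)\<close>.\<close>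

definition join :: "bool list \<Rightarrow> nat list \<Rightarrow> nat list \<Rightarrow> nat list" where
  "join \<beta> s t = map (occ \<beta> True) s @ map (occ \<beta> False) t"

lemma length_join [simp]: "length (join \<beta> s t) = length s + length t"
  by (simp add: join_def)

lemma set_map_occ:
  assumes "packed_word s" "count_list \<tau> c = max_letter s"
  shows "set (map (occ \<tau> c) s) = {j \<in> {1..length \<tau>}. \<tau> ! (j - 1) = c}"
  using occ_image[of \<tau> c] assms by (simp add: packed_word_set)

lemma set_join:
  assumes "packed_word s" "packed_word t" "\<beta> \<in> bool_words (max_letter s) (max_letter t)"
  shows "set (join \<beta> s t) = {1..length \<beta>}"
proof -
  have "set (join \<beta> s t) = set (map (occ \<beta> True) s) \<union> set (map (occ \<beta> False) t)"
    by (simp add: join_def)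
  also have "set (map (occ \<beta> True) s) = {j \<in> {1..length \<beta>}. \<beta> ! (j - 1) = True}"
    using assms by (intro set_map_occ) (simp_all add: bool_words_def)
  also have "set (map (occ \<beta> False) t) = {j \<in> {1..length \<beta>}. \<beta> ! (j - 1) = False}"
    using assms by (intro set_map_occ) (simp_all add: bool_words_def)
  finally show ?thesis by blast
qed

lemma packed_join:
  assumes "packed_word s" "packed_word t" "\<beta> \<in> bool_words (max_letter s) (max_letter t)"
  shows "packed_word (join \<beta> s t)" "max_letter (join \<beta> s t) = length \<beta>"
  using set_join[OF assms] packed_wordI max_letter_eqI by blast+

lemma pack_map_occ:
  assumes "packed_word s"
  shows "pack (map (occ \<tau> c) s) = s"
proof -
  have "card {b \<in> occ \<tau> c ` set s. b \<le> occ \<tau> c a} = a" if "a \<in> set s" for a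
  proof -
    have "{b \<in> occ \<tau> c ` set s. b \<le> occ \<tau> c a} = occ \<tau> c ` {1..a}"
      using that packed_word_set[OF assms] by auto
    also have "card \<dots> = a"
      by (subst card_image) (auto intro: inj_onI occ_inj)
    finally show ?thesis .
  qed
  then show ?thesis by (simp add: pack_def map_idI)
qed

section \<open>Packing and its inverse\<close>

lemma length_pack [simp]: "length (pack u) = length u"
  by (simp add: pack_def)

lemma set_pack: "set (pack u) = {1..card (set u)}"
proof -
  let ?r = "\<lambda>a. card {b \<in> set u. b \<le> a}"
  have inj: "inj_on ?r (set u)"
  proof (rule linorder_inj_onI')
    fix a b assume ab: "a \<in> set u" "b \<in> set u" "a < b"
    then have "b \<in> {c \<in> set u. c \<le> b} - {c \<in> set u. c \<le> a}" by auto
    moreover have "{c \<in> set u. c \<le> a} \<subseteq> {c \<in> set u. c \<le> b}" using ab by auto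
    ultimately have "?r a < ?r b" by (intro psubset_card_mono) auto
    then show "?r a \<noteq> ?r b" by simp
  qed
  have "?r ` set u \<subseteq> {1..card (set u)}"
  proof
    fix k assume "k \<in> ?r ` set u"
    then obtain a where a: "a \<in> set u" "k = ?r a" by auto
    then have "a \<in> {b \<in> set u. b \<le> a}" by simp
    then have "k \<noteq> 0" using a(2) by (metis (lifting) List.finite_set card_0_eq empty_iff finite_Collect_conjI finite_nat_set_iff_bounded_le mem_Collect_eq)
    moreover have "k \<le> card (set u)" using a by (auto intro: card_mono)
    ultimately show "k \<in> {1..card (set u)}" by simp
  qed
  moreover have "card (?r ` set u) = card {1..card (set u)}"
    using inj by (simp add: card_image)
  ultimately have "?r ` set u = {1..card (set u)}"
    by (intro card_subset_eq) auto
  then show ?thesis by (simp add: pack_def)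
qed

lemma packed_pack: "packed_word (pack u)" and max_letter_pack: "max_letter (pack u) = card (set u)"
  using set_pack packed_wordI max_letter_eqI by blast+

lemma count_list_map_upt: "count_list (map f [1..<Suc a]) c = card {j \<in> {1..a}. f j = c}"
proof (induction a)
  case (Suc a)
  have "{j \<in> {1..Suc a}. f j = c} = {j \<in> {1..a}. f j = c} \<union> (if f (Suc a) = c then {Suc a} else {})"
    by (auto simp: le_Suc_eq)
  then have "card {j \<in> {1..Suc a}. f j = c} = card {j \<in> {1..a}. f j = c} + (if f (Suc a) = c then 1 else 0)"
    by (auto simp: card_insert_if)
  then show ?case using Suc by simp
qed simp

text \<open>\<open>pack\<close> replaces a letter by its rank in \<open>set u\<close>, and
  \<open>occ\<close> in the indicator word of \<open>set u\<close> returns the element of a given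
  rank.\<close>

lemma map_occ_pack:
  assumes "set u = {j \<in> {1..M}. f j = c}"
  shows "map (occ (map f [1..<Suc M]) c) (pack u) = u"
proof -
  have "occ (map f [1..<Suc M]) c (card {b \<in> set u. b \<le> a}) = a" if a: "a \<in> set u" for a
  proof -
    have aM: "1 \<le> a" "a \<le> M" "f a = c" using a assms by auto
    have "take a (map f [1..<Suc M]) = map f [1..<Suc a]"
      using aM by (simp add: take_map take_upt del: upt_Suc)
    moreover have "{j \<in> {1..a}. f j = c} = {b \<in> set u. b \<le> a}"
      unfolding assms using aM by auto
    ultimately have "count_list (take a (map f [1..<Suc M])) c = card {b \<in> set u. b \<le> a}"
      by (simp only: count_list_map_upt)
    then show ?thesis
      using occ_count_take[of a "map f [1..<Suc M]" c] aM by (simp del: upt_Suc)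
  qed
  then show ?thesis by (simp add: pack_def map_idI del: upt_Suc)
qed


section \<open>Coefficients of half-coproducts\<close>

text \<open>The coefficient at \<open>R s \<otimes> R t\<close> of the coproduct restricted to the cuts in \<open>Q\<close>.  Unlike \<open>Delta_prec\<close>
  and \<open>Delta_succ\<close>, it includes the trivial cuts \<open>s = []\<close> and \<open>t = []\<close>.\<close>

definition cop :: "(bool list \<Rightarrow> bool) \<Rightarrow> 'k::field wqsym \<Rightarrow> nat list \<Rightarrow> nat list \<Rightarrow> 'k" where
  "cop Q x s t = (\<Sum>\<beta> | \<beta> \<in> bool_words (max_letter s) (max_letter t) \<and> Q \<beta>. cf x (join \<beta> s t))"

abbreviation "all_cuts \<equiv> (\<lambda>_::bool list. True)"
text \<open>The largest letter of \<open>join \<beta> s t\<close> is \<open>length \<beta>\<close>,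
  so the last entry of \<open>\<beta>\<close> says which factor owns it (\<open>last_code\<close>).
  The two conditions select the terms of \<open>Delta_prec\<close> and of
  \<open>Delta_succ\<close>.\<close>

abbreviation "max_left \<equiv> (\<lambda>\<beta>. \<beta> \<noteq> [] \<and> last \<beta>)"
abbreviation "max_right \<equiv> (\<lambda>\<beta>. \<beta> \<noteq> [] \<and> \<not> last \<beta>)"

definition cut_words :: "nat list \<Rightarrow> nat list \<Rightarrow> nat list set" where
  "cut_words s t = {w. packed_word w \<and> length w = length s + length t
     \<and> set (take (length s) w) \<inter> set (drop (length s) w) = {}
     \<and> pack (take (length s) w) = s \<and> pack (drop (length s) w) = t}"

definition cut_code :: "nat list \<Rightarrow> nat list \<Rightarrow> bool list" where
  "cut_code s w = map (\<lambda>j. j \<in> set (take (length s) w)) [1..<Suc (max_letter w)]"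

text \<open>A packed word whose parts before and after position \<open>length s\<close> share no
  letter is determined by the two packed parts and the set of values on the left. Thus
  \<open>cut_code\<close> inverts \<open>join\<close>, and coefficients of coproducts become sums
  over codes.\<close>

lemma join_bij:
  assumes "packed_word s" "packed_word t"
  shows "\<beta> \<in> bool_words (max_letter s) (max_letter t) \<Longrightarrow> join \<beta> s t \<in> cut_words s t"
    and "\<beta> \<in> bool_words (max_letter s) (max_letter t) \<Longrightarrow> cut_code s (join \<beta> s t) = \<beta>"
    and "w \<in> cut_words s t \<Longrightarrow> cut_code s w \<in> bool_words (max_letter s) (max_letter t)"
    and "w \<in> cut_words s t \<Longrightarrow> join (cut_code s w) s t = w"
proof -
  { assume \<beta>: "\<beta> \<in> bool_words (max_letter s) (max_letter t)"
    have S: "set (map (occ \<beta> True) s) = {j \<in> {1..length \<beta>}. \<beta> ! (j - 1)}"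
      and T: "set (map (occ \<beta> False) t) = {j \<in> {1..length \<beta>}. \<not> \<beta> ! (j - 1)}"
      using \<beta> set_map_occ[of s \<beta> True] set_map_occ[of t \<beta> False] assms
      by (auto simp: bool_words_def simp del: set_map)
    have "set (map (occ \<beta> True) s) \<inter> set (map (occ \<beta> False) t) = {}"
      unfolding S T by auto
    then show "join \<beta> s t \<in> cut_words s t"
      using assms packed_join[OF assms \<beta>]
      by (simp add: cut_words_def join_def pack_map_occ del: set_map)
    show "cut_code s (join \<beta> s t) = \<beta>"
    proof (rule nth_equalityI)
      fix i assume "i < length (cut_code s (join \<beta> s t))"
      then show "cut_code s (join \<beta> s t) ! i = \<beta> ! i"
        using packed_join(2)[OF assms \<beta>] S
        by (simp add: cut_code_def join_def del: set_map upt_Suc)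
    qed (simp add: cut_code_def packed_join(2)[OF assms \<beta>] del: upt_Suc) }
  { assume w: "w \<in> cut_words s t"
    let ?u = "take (length s) w" and ?v = "drop (length s) w" and ?M = "max_letter w"
    let ?f = "\<lambda>j. j \<in> set ?u"
    have sw: "set ?u \<union> set ?v = {1..?M}" and disj: "set ?u \<inter> set ?v = {}"
      and pk: "pack ?u = s" "pack ?v = t"
      using w packed_word_set[of w] by (auto simp: cut_words_def simp flip: set_append)
    have U: "set ?u = {j \<in> {1..?M}. ?f j = True}" and V: "set ?v = {j \<in> {1..?M}. ?f j = False}"
      using sw disj by auto
    have cs: "card (set ?u) = max_letter s" "card (set ?v) = max_letter t"
      using max_letter_pack[of ?u] max_letter_pack[of ?v] by (simp_all only: pk)
    show "cut_code s w \<in> bool_words (max_letter s) (max_letter t)"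
      unfolding bool_words_def cut_code_def mem_Collect_eq count_list_map_upt
      using U V cs by auto
    show "join (cut_code s w) s t = w"
      using map_occ_pack[OF U] map_occ_pack[OF V]
      by (simp add: join_def cut_code_def pk del: upt_Suc) }
qed

text \<open>Serves both half-coproducts: \<open>N\<close> is their condition on the largest letter,
  \<open>Q\<close> the same condition read off the code.\<close>

lemma cf_Delta:
  fixes x :: "'k::field wqsym"
  assumes x: "x \<in> packed_span"
    and N: "\<And>s t \<beta>. packed_word s \<Longrightarrow> packed_word t \<Longrightarrow> s \<noteq> [] \<Longrightarrow> t \<noteq> [] \<Longrightarrow>
       \<beta> \<in> bool_words (max_letter s) (max_letter t) \<Longrightarrow> N (join \<beta> s t) (length s) \<longleftrightarrow> Q \<beta>"
  shows "cf (linear_ext (\<lambda>u. \<Sum>i | 1 \<le> i \<and> i < length u \<and> set (take i u) \<inter> set (drop i u) = {}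
            \<and> N u i. deconcat u i) x) (s, t)
       = (if packed_word s \<and> packed_word t \<and> s \<noteq> [] \<and> t \<noteq> [] then cop Q x s t else 0)"
    (is "cf (linear_ext (\<lambda>u. \<Sum>i | ?C u i. deconcat u i) x) (s, t) = _")
proof -
  let ?X = "Poly_Mapping.keys x"
  let ?W = "{w \<in> cut_words s t. N w (length s)}"
  have inner: "cf (\<Sum>i | ?C u i. deconcat u i) (s, t)
      = (if u \<in> ?W \<and> s \<noteq> [] \<and> t \<noteq> [] then 1 else (0::'k))" if u: "u \<in> ?X" for u
  proof -
    have pu: "packed_word u" using u x by (auto simp: packed_span_def)
    have fin: "finite {i. ?C u i}" by (rule finite_subset[of _ "{..length u}"]) auto
    \<comment> \<open>\<open>pack\<close> preserves lengths, so only the cut at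
      \<open>i = length s\<close> can produce the pair \<open>(s, t)\<close>.\<close>
    have "cf (\<Sum>i | ?C u i. deconcat u i) (s, t)
        = (\<Sum>i | ?C u i. if i = length s then
             (if pack (take i u) = s \<and> pack (drop i u) = t then 1 else (0::'k)) else 0)"
      unfolding lookup_sum deconcat_def
      by (intro sum.cong refl) (auto simp: lookup_single when_def)
    also have "\<dots> = (if ?C u (length s) then
        (if pack (take (length s) u) = s \<and> pack (drop (length s) u) = t then 1 else 0) else 0)"
      using fin by (simp add: sum.delta)
    also have "\<dots> = (if u \<in> ?W \<and> s \<noteq> [] \<and> t \<noteq> [] then 1 else 0)"
    proof -
      have "pack (drop (length s) u) = t \<Longrightarrow> length u - length s = length t"
        by (metis length_drop length_pack)
      then show ?thesis
        using pu by (auto simp: cut_words_def Suc_le_eq)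
    qed
    finally show ?thesis .
  qed
  have lhs: "cf (linear_ext (\<lambda>u. \<Sum>i | ?C u i. deconcat u i) x) (s, t)
      = (\<Sum>u\<in>?X. if u \<in> ?W \<and> s \<noteq> [] \<and> t \<noteq> [] then cf x u else 0)"
    unfolding cf_linear_ext[OF finite_keys order_refl]
    by (intro sum.cong refl, subst inner) simp_all
  show ?thesis
  proof (cases "packed_word s \<and> packed_word t \<and> s \<noteq> [] \<and> t \<noteq> []")
    case False
    have "packed_word s \<and> packed_word t" if "u \<in> cut_words s t" for u
    proof -
      have "pack (take (length s) u) = s" "pack (drop (length s) u) = t"
        using that by (simp_all add: cut_words_def)
      then show ?thesis using packed_pack by metis
    qed
    then have *: "\<not> (u \<in> ?W \<and> s \<noteq> [] \<and> t \<noteq> [])" for u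
      using False by blast
    show ?thesis
      unfolding lhs if_not_P[OF False] if_not_P[OF *] by simp
  next
    case True
    note j = join_bij[OF conjunct1[OF True] conjunct1[OF conjunct2[OF True]]]
    have "(\<Sum>u\<in>?X. if u \<in> ?W \<and> s \<noteq> [] \<and> t \<noteq> [] then cf x u else 0) = (\<Sum>u\<in>?X \<inter> ?W. cf x u)"
      using True by (subst sum.inter_restrict) auto
    also have "\<dots> = (\<Sum>\<beta> | \<beta> \<in> bool_words (max_letter s) (max_letter t) \<and> Q \<beta>. cf x (join \<beta> s t))"
    proof (rule sum.reindex_bij_witness_not_neutral[where i = "\<lambda>\<beta>. join \<beta> s t" and j = "cut_code s"
          and S' = "{}" and T' = "{\<beta>. \<beta> \<in> bool_words (max_letter s) (max_letter t) \<and> Q \<beta> \<and> join \<beta> s t \<notin> ?X}"])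
      show "finite {\<beta>. \<beta> \<in> bool_words (max_letter s) (max_letter t) \<and> Q \<beta> \<and> join \<beta> s t \<notin> ?X}"
        by simp
    next
      fix w assume "w \<in> ?X \<inter> ?W - {}"
      then have w: "w \<in> ?X" "w \<in> cut_words s t" "N w (length s)" by auto
      have "Q (cut_code s w)"
        using N[of s t "cut_code s w"] True j(3,4)[OF w(2)] w(3) by simp
      then show "cut_code s w \<in> {\<beta>. \<beta> \<in> bool_words (max_letter s) (max_letter t) \<and> Q \<beta>}
          - {\<beta>. \<beta> \<in> bool_words (max_letter s) (max_letter t) \<and> Q \<beta> \<and> join \<beta> s t \<notin> ?X}"
        using j(3,4)[OF w(2)] w by simp
    qed (use j N True in \<open>auto simp: in_keys_iff\<close>)
    finally show ?thesis using True lhs by (simp add: cop_def)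
  qed
qed

lemma last_code:
  assumes "packed_word s" "packed_word t" "\<beta> \<in> bool_words (max_letter s) (max_letter t)" "\<beta> \<noteq> []"
  shows "max_letter (join \<beta> s t) \<in> set (map (occ \<beta> True) s) \<longleftrightarrow> last \<beta>"
    and "max_letter (join \<beta> s t) \<in> set (map (occ \<beta> False) t) \<longleftrightarrow> \<not> last \<beta>"
  using assms set_map_occ[of s \<beta> True] set_map_occ[of t \<beta> False] packed_join(2)[OF assms(1-3)]
  by (auto simp: bool_words_def last_conv_nth Suc_le_eq simp del: set_map)

lemma bool_words_ne: "packed_word s \<Longrightarrow> s \<noteq> [] \<Longrightarrow> \<beta> \<in> bool_words (max_letter s) q \<Longrightarrow> \<beta> \<noteq> []"
  by (auto simp: bool_words_def packed_max_letter_0)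

lemma cf_Delta_prec:
  assumes x: "x \<in> packed_span"
  shows "cf (Delta_prec x) (s, t)
       = (if packed_word s \<and> packed_word t \<and> s \<noteq> [] \<and> t \<noteq> [] then cop max_left x s t else 0)"
  unfolding Delta_prec_def
proof (rule cf_Delta[OF x])
  fix s t \<beta>
  assume *: "packed_word s" "packed_word t" "s \<noteq> []" "t \<noteq> []" "\<beta> \<in> bool_words (max_letter s) (max_letter t)"
  then have ne: "\<beta> \<noteq> []" using bool_words_ne by blast
  have "drop (length s) (join \<beta> s t) = map (occ \<beta> False) t" by (simp add: join_def)
  then show "max_letter (join \<beta> s t) \<notin> set (drop (length s) (join \<beta> s t)) \<longleftrightarrow> max_left \<beta>"
    using last_code(2)[OF *(1,2,5) ne] ne by simp
qed

lemma cf_Delta_succ: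
  assumes x: "x \<in> packed_span"
  shows "cf (Delta_succ x) (s, t)
       = (if packed_word s \<and> packed_word t \<and> s \<noteq> [] \<and> t \<noteq> [] then cop max_right x s t else 0)"
  unfolding Delta_succ_def
proof (rule cf_Delta[OF x])
  fix s t \<beta>
  assume *: "packed_word s" "packed_word t" "s \<noteq> []" "t \<noteq> []" "\<beta> \<in> bool_words (max_letter s) (max_letter t)"
  then have ne: "\<beta> \<noteq> []" using bool_words_ne by blast
  have "take (length s) (join \<beta> s t) = map (occ \<beta> True) s" by (simp add: join_def)
  then show "max_letter (join \<beta> s t) \<notin> set (take (length s) (join \<beta> s t)) \<longleftrightarrow> max_right \<beta>"
    using last_code(1)[OF *(1,2,5) ne] ne by simp
qed

lemma cop_left_right:
  assumes "packed_word s" "s \<noteq> []"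
  shows "cop all_cuts x s t = cop max_left x s t + cop max_right x s t"
proof -
  let ?B = "bool_words (max_letter s) (max_letter t)"
  have "{\<beta>. \<beta> \<in> ?B \<and> True} = {\<beta>. \<beta> \<in> ?B \<and> max_left \<beta>} \<union> {\<beta>. \<beta> \<in> ?B \<and> max_right \<beta>}"
    using bool_words_ne[OF assms] by auto
  then show ?thesis
    unfolding cop_def by (simp only:) (rule sum.union_disjoint, auto)
qed

lemma Prim_iff:
  "x \<in> Prim \<longleftrightarrow> x \<in> WQSym_plus \<and>
    (\<forall>s t. packed_word s \<longrightarrow> packed_word t \<longrightarrow> s \<noteq> [] \<longrightarrow> t \<noteq> [] \<longrightarrow> cop all_cuts x s t = 0)"
proof -
  have "Delta_prec x + Delta_succ x = 0 \<longleftrightarrow>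
    (\<forall>s t. packed_word s \<longrightarrow> packed_word t \<longrightarrow> s \<noteq> [] \<longrightarrow> t \<noteq> [] \<longrightarrow> cop all_cuts x s t = 0)"
    if "x \<in> packed_span"
    unfolding poly_mapping_eq_iff fun_eq_iff split_paired_All
    by (auto simp: lookup_add cf_Delta_prec[OF that] cf_Delta_succ[OF that] cop_left_right)
  then show ?thesis by (auto simp: Prim_def WQSym_plus_packed_span)
qed

lemma TPrim_iff:
  "x \<in> TPrim \<longleftrightarrow> x \<in> WQSym_plus \<and>
    (\<forall>s t. packed_word s \<longrightarrow> packed_word t \<longrightarrow> s \<noteq> [] \<longrightarrow> t \<noteq> [] \<longrightarrow>
      cop max_left x s t = 0 \<and> cop max_right x s t = 0)"
proof -
  have "Delta_prec x = 0 \<and> Delta_succ x = 0 \<longleftrightarrow>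
    (\<forall>s t. packed_word s \<longrightarrow> packed_word t \<longrightarrow> s \<noteq> [] \<longrightarrow> t \<noteq> [] \<longrightarrow>
      cop max_left x s t = 0 \<and> cop max_right x s t = 0)"
    if "x \<in> packed_span"
    unfolding poly_mapping_eq_iff fun_eq_iff split_paired_All
    by (auto simp: cf_Delta_prec[OF that] cf_Delta_succ[OF that])
  then show ?thesis by (auto simp: TPrim_def WQSym_plus_packed_span)
qed

lemma cop_add: "cop Q (x + y) s t = cop Q x s t + cop Q y s t"
  and cop_scale: "cop Q (scale c x) s t = c * cop Q x s t"
  by (simp_all add: cop_def lookup_add sum.distrib sum_distrib_left)

lemma cop_zero [simp]: "cop Q 0 s t = 0"
  by (simp add: cop_def)

lemma cop_sum: "cop Q (\<Sum>i\<in>I. f i) s t = (\<Sum>i\<in>I. cop Q (f i) s t)"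
  by (induction I rule: infinite_finite_induct) (simp_all add: cop_add)

lemma cop_hom: "x \<in> WQSym n \<Longrightarrow> length s + length t \<noteq> n \<Longrightarrow> cop Q x s t = 0"
  by (simp add: cop_def WQSymD)

lemma map_occ_replicate: "map (occ (replicate q c) c) s = s"
  by (simp add: map_idI)

text \<open>The terms \<open>1 \<otimes> x\<close> and \<open>x \<otimes> 1\<close> that the
  half-coproducts leave out. The largest letter lies on the right in the former and on the left in
  the latter, so \<open>max_right\<close> keeps only the former.\<close>

lemma cop_Nil_left: "packed_word t \<Longrightarrow> cop all_cuts x [] t = cf x t"
  and cop_Nil_right: "cop all_cuts x s [] = cf x s"
  and cop_max_right_Nil: "cop max_right x s [] = 0"
  and cop_max_right_Nil_left: "packed_word t \<Longrightarrow> t \<noteq> [] \<Longrightarrow> cop max_right x [] t = cf x t"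
proof -
  show "cop all_cuts x [] t = cf x t" if "packed_word t"
    by (simp add: cop_def bool_words_0_left join_def map_occ_replicate)
  show "cop all_cuts x s [] = cf x s"
    by (simp add: cop_def bool_words_0_right join_def map_occ_replicate)
  have "{\<beta>. \<beta> \<in> bool_words (max_letter s) (max_letter []) \<and> max_right \<beta>} = {}"
    by (cases "max_letter s = 0") (auto simp: bool_words_0_right)
  then show "cop max_right x s [] = 0"
    unfolding cop_def by (simp only: sum.empty)
  show "cop max_right x [] t = cf x t" if "packed_word t" "t \<noteq> []"
  proof -
    have "{\<beta>. \<beta> \<in> bool_words (max_letter []) (max_letter t) \<and> max_right \<beta>} = {replicate (max_letter t) False}"
      using that by (auto simp: bool_words_0_left packed_max_letter_0)
    then show ?thesis
      unfolding cop_def by (simp add: join_def map_occ_replicate)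
  qed
qed


section \<open>Compatibility of half-products and half-coproducts\<close>

text \<open>Cutting a code at \<open>m\<close> amounts to choosing the numbers \<open>a\<close> and
  \<open>b\<close> of left and right values below the cut, and then one code below and one above.
  This exchanges the value cut of a product with the position cut of a coproduct.\<close>

lemma sum_bool_words_split:
  "(\<Sum>\<beta>\<in>bool_words p q. \<Sum>m\<le>length \<beta>. G (take m \<beta>) (drop m \<beta>))
     = (\<Sum>a\<le>p. \<Sum>b\<le>q. \<Sum>\<beta>1\<in>bool_words a b. \<Sum>\<beta>2\<in>bool_words (p - a) (q - b). G \<beta>1 \<beta>2)"
proof -
  have "(\<Sum>\<beta>\<in>bool_words p q. \<Sum>m\<le>length \<beta>. G (take m \<beta>) (drop m \<beta>))
      = (\<Sum>(\<beta>, m)\<in>(SIGMA \<beta>:bool_words p q. {..length \<beta>}). G (take m \<beta>) (drop m \<beta>))"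
    by (rule sum.Sigma) auto
  also have "\<dots> = (\<Sum>((a, b), (\<beta>1, \<beta>2))\<in>(SIGMA ab:{..p} \<times> {..q}.
      bool_words (fst ab) (snd ab) \<times> bool_words (p - fst ab) (q - snd ab)). G \<beta>1 \<beta>2)"
  proof (rule sum.reindex_bij_witness[where
      i = "\<lambda>((a, b), (\<beta>1, \<beta>2)). (\<beta>1 @ \<beta>2, length \<beta>1)" and
      j = "\<lambda>(\<beta>, m). ((count_list (take m \<beta>) True, count_list (take m \<beta>) False), (take m \<beta>, drop m \<beta>))"])
    fix z assume z: "z \<in> (SIGMA \<beta>:bool_words p q. {..length \<beta>})"
    obtain \<beta> m where zz: "z = (\<beta>, m)" by (cases z)
    have "count_list \<beta> c = count_list (take m \<beta>) c + count_list (drop m \<beta>) c" for c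
      by (metis append_take_drop_id count_list_append)
    then show "(case z of (\<beta>, m) \<Rightarrow>
        ((count_list (take m \<beta>) True, count_list (take m \<beta>) False), (take m \<beta>, drop m \<beta>)))
        \<in> (SIGMA ab:{..p} \<times> {..q}. bool_words (fst ab) (snd ab) \<times> bool_words (p - fst ab) (q - snd ab))"
      using z by (auto simp: zz bool_words_def)
  qed (auto simp: bool_words_def)
  also have "\<dots> = (\<Sum>ab\<in>{..p} \<times> {..q}. \<Sum>\<beta>12\<in>bool_words (fst ab) (snd ab) \<times> bool_words (p - fst ab) (q - snd ab).
      G (fst \<beta>12) (snd \<beta>12))"
    by (subst sum.Sigma) (auto simp: case_prod_beta)
  also have "\<dots> = (\<Sum>a\<le>p. \<Sum>b\<le>q. \<Sum>\<beta>1\<in>bool_words a b. \<Sum>\<beta>2\<in>bool_words (p - a) (q - b). G \<beta>1 \<beta>2)"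
    by (simp add: sum.cartesian_product case_prod_beta)
  finally show ?thesis .
qed

lemma occ_append_le_iff: "occ (\<tau>1 @ \<tau>2) c i \<le> length \<tau>1 \<longleftrightarrow> i \<le> count_list \<tau>1 c"
  by (simp add: occ_append occ_le_length)

lemma lo_map_occ: "lo (length \<tau>1) (map (occ (\<tau>1 @ \<tau>2) c) s) = map (occ \<tau>1 c) (lo (count_list \<tau>1 c) s)"
  by (induction s) (simp_all add: lo_def occ_append_le_iff, simp add: occ_append)

lemma hi_map_occ: "hi (length \<tau>1) (map (occ (\<tau>1 @ \<tau>2) c) s) = map (occ \<tau>2 c) (hi (count_list \<tau>1 c) s)"
  by (induction s) (simp_all add: hi_def occ_append_le_iff not_le[symmetric], simp add: occ_append)

text \<open>With \<open>hi_join\<close> this is the compatibility of products and coproducts on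
  single words: a cut of the values of a join cuts both factors, \<open>s\<close> at
  \<open>a\<close> and \<open>t\<close> at \<open>b\<close>.\<close>

lemma lo_join: "\<beta>1 \<in> bool_words a b \<Longrightarrow> lo (length \<beta>1) (join (\<beta>1 @ \<beta>2) s t) = join \<beta>1 (lo a s) (lo b t)"
  using lo_map_occ[of \<beta>1 \<beta>2 True s] lo_map_occ[of \<beta>1 \<beta>2 False t] by (simp add: join_def lo_def bool_words_def)

lemma hi_join: "\<beta>1 \<in> bool_words a b \<Longrightarrow> hi (length \<beta>1) (join (\<beta>1 @ \<beta>2) s t) = join \<beta>2 (hi a s) (hi b t)"
  using hi_map_occ[of \<beta>1 \<beta>2 True s] hi_map_occ[of \<beta>1 \<beta>2 False t] by (simp add: join_def hi_def bool_words_def)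

text \<open>\<open>P\<close> is the condition on the last letter in one of the two half-products. As
  \<open>t\<close> is not empty, the last letter of the join comes from \<open>last t\<close>, so
  the condition falls on \<open>b\<close> alone and leaves \<open>a\<close> free.\<close>

lemma cop_conv:
  assumes st: "packed_word s" "packed_word t" "t \<noteq> []"
    and P: "P = (\<lambda>m l. l \<le> m) \<or> P = (\<lambda>m l. m < l)"
    and z: "\<And>w. packed_word w \<Longrightarrow> w \<noteq> [] \<Longrightarrow>
        cf z w = (\<Sum>m | m \<le> max_letter w \<and> P m (last w). cf x (lo m w) * cf y (hi m w))"
  shows "cop Q z s t = (\<Sum>a\<le>max_letter s. \<Sum>b | b \<le> max_letter t \<and> P b (last t).
      \<Sum>\<beta>1\<in>bool_words a b. \<Sum>\<beta>2\<in>bool_words (max_letter s - a) (max_letter t - b).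
        if Q (\<beta>1 @ \<beta>2) then cf x (join \<beta>1 (lo a s) (lo b t)) * cf y (join \<beta>2 (hi a s) (hi b t)) else 0)"
proof -
  let ?p = "max_letter s" and ?q = "max_letter t"
  let ?G = "\<lambda>\<beta>1 \<beta>2. if Q (\<beta>1 @ \<beta>2) \<and> P (count_list \<beta>1 False) (last t) then
      cf x (lo (length \<beta>1) (join (\<beta>1 @ \<beta>2) s t)) * cf y (hi (length \<beta>1) (join (\<beta>1 @ \<beta>2) s t)) else 0"
  have "cop Q z s t = (\<Sum>\<beta>\<in>bool_words ?p ?q. if Q \<beta> then cf z (join \<beta> s t) else 0)"
    by (simp add: cop_def sum.inter_filter)
  also have "\<dots> = (\<Sum>\<beta>\<in>bool_words ?p ?q. \<Sum>m\<le>length \<beta>. ?G (take m \<beta>) (drop m \<beta>))"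
  proof (intro sum.cong refl)
    fix \<beta> assume \<beta>: "\<beta> \<in> bool_words ?p ?q"
    let ?w = "join \<beta> s t"
    have w: "packed_word ?w" "max_letter ?w = length \<beta>" "?w \<noteq> []"
      using packed_join[OF st(1,2) \<beta>] st(3) by (auto simp: join_def)
    have last: "last ?w = occ \<beta> False (last t)"
      using st(3) by (simp add: join_def last_map)
    have P': "P m (last ?w) \<longleftrightarrow> P (count_list (take m \<beta>) False) (last t)" if "m \<le> length \<beta>" for m
      using P occ_append_le_iff[of "take m \<beta>" "drop m \<beta>" False "last t"] that
      by (auto simp: last not_le[symmetric])
    show "(if Q \<beta> then cf z ?w else 0) = (\<Sum>m\<le>length \<beta>. ?G (take m \<beta>) (drop m \<beta>))"
    proof (cases "Q \<beta>")
      case True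
      have "cf z ?w = (\<Sum>m | m \<le> length \<beta> \<and> P m (last ?w). cf x (lo m ?w) * cf y (hi m ?w))"
        using z[OF w(1,3)] w(2) by simp
      also have "\<dots> = (\<Sum>m\<le>length \<beta>. if P m (last ?w) then cf x (lo m ?w) * cf y (hi m ?w) else 0)"
        by (subst sum.inter_filter[symmetric]) auto
      finally show ?thesis using True P' by (simp cong: sum.cong_simp if_cong)
    qed simp
  qed
  also have "\<dots> = (\<Sum>a\<le>?p. \<Sum>b\<le>?q. \<Sum>\<beta>1\<in>bool_words a b. \<Sum>\<beta>2\<in>bool_words (?p - a) (?q - b). ?G \<beta>1 \<beta>2)"
    by (rule sum_bool_words_split)
  also have "\<dots> = (\<Sum>a\<le>?p. \<Sum>b\<le>?q. if P b (last t) then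
      (\<Sum>\<beta>1\<in>bool_words a b. \<Sum>\<beta>2\<in>bool_words (?p - a) (?q - b).
        if Q (\<beta>1 @ \<beta>2) then cf x (join \<beta>1 (lo a s) (lo b t)) * cf y (join \<beta>2 (hi a s) (hi b t)) else 0) else 0)"
  proof (intro sum.cong refl)
    fix a b
    have "count_list \<beta>1 False = b" if "\<beta>1 \<in> bool_words a b" for \<beta>1 using that by (simp add: bool_words_def)
    then show "(\<Sum>\<beta>1\<in>bool_words a b. \<Sum>\<beta>2\<in>bool_words (?p - a) (?q - b). ?G \<beta>1 \<beta>2) = (if P b (last t) then
      (\<Sum>\<beta>1\<in>bool_words a b. \<Sum>\<beta>2\<in>bool_words (?p - a) (?q - b).
        if Q (\<beta>1 @ \<beta>2) then cf x (join \<beta>1 (lo a s) (lo b t)) * cf y (join \<beta>2 (hi a s) (hi b t)) else 0) else 0)"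
      by (cases "P b (last t)") (simp_all add: lo_join hi_join cong: sum.cong_simp if_cong)
  qed
  also have "\<dots> = (\<Sum>a\<le>?p. \<Sum>b | b \<le> ?q \<and> P b (last t).
      \<Sum>\<beta>1\<in>bool_words a b. \<Sum>\<beta>2\<in>bool_words (?p - a) (?q - b).
        if Q (\<beta>1 @ \<beta>2) then cf x (join \<beta>1 (lo a s) (lo b t)) * cf y (join \<beta>2 (hi a s) (hi b t)) else 0)"
    by (rule sum.cong[OF refl], subst sum.inter_filter[symmetric]) auto
  finally show ?thesis .
qed

lemma cop_conv_all:
  assumes st: "packed_word s" "packed_word t" "t \<noteq> []"
    and P: "P = (\<lambda>m l. l \<le> m) \<or> P = (\<lambda>m l. m < l)"
    and z: "\<And>w. packed_word w \<Longrightarrow> w \<noteq> [] \<Longrightarrow>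
        cf z w = (\<Sum>m | m \<le> max_letter w \<and> P m (last w). cf x (lo m w) * cf y (hi m w))"
  shows "cop all_cuts z s t = (\<Sum>a\<le>max_letter s. \<Sum>b | b \<le> max_letter t \<and> P b (last t).
      cop all_cuts x (lo a s) (lo b t) * cop all_cuts y (hi a s) (hi b t))"
proof -
  have "cop all_cuts z s t = (\<Sum>a\<le>max_letter s. \<Sum>b | b \<le> max_letter t \<and> P b (last t).
      \<Sum>\<beta>1\<in>bool_words a b. \<Sum>\<beta>2\<in>bool_words (max_letter s - a) (max_letter t - b).
        if True then cf x (join \<beta>1 (lo a s) (lo b t)) * cf y (join \<beta>2 (hi a s) (hi b t)) else 0)"
    by (rule cop_conv[OF st P]) (rule z)
  also have "\<dots> = (\<Sum>a\<le>max_letter s. \<Sum>b | b \<le> max_letter t \<and> P b (last t).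
      cop all_cuts x (lo a s) (lo b t) * cop all_cuts y (hi a s) (hi b t))"
    by (intro sum.cong refl) (simp add: cop_def st sum_product)
  finally show ?thesis .
qed

text \<open>The largest letter belongs to the upper value part, so its side is decided by the code
  \<open>\<beta>2\<close> of \<open>y\<close>, unless that part is empty. An empty upper part cannot
  occur for \<open>half_succ\<close>; for \<open>half_prec\<close> its term is killed by
  \<open>cf y [] = 0\<close>.\<close>

lemma cop_conv_max_right:
  assumes st: "packed_word s" "packed_word t" "t \<noteq> []"
    and P: "P = (\<lambda>m l. l \<le> m) \<or> P = (\<lambda>m l. m < l)"
    and z: "\<And>w. packed_word w \<Longrightarrow> w \<noteq> [] \<Longrightarrow>
        cf z w = (\<Sum>m | m \<le> max_letter w \<and> P m (last w). cf x (lo m w) * cf y (hi m w))"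
    and y: "P = (\<lambda>m l. m < l) \<or> cf y [] = 0"
  shows "cop max_right z s t = (\<Sum>a\<le>max_letter s. \<Sum>b | b \<le> max_letter t \<and> P b (last t).
      cop all_cuts x (lo a s) (lo b t) * cop max_right y (hi a s) (hi b t))"
proof (subst cop_conv[OF st P], rule z, assumption, assumption, intro sum.cong refl)
  fix a b assume a: "a \<in> {..max_letter s}" and b: "b \<in> {b. b \<le> max_letter t \<and> P b (last t)}"
  let ?X = "\<lambda>\<beta>1. cf x (join \<beta>1 (lo a s) (lo b t))" and ?Y = "\<lambda>\<beta>2. cf y (join \<beta>2 (hi a s) (hi b t))"
  let ?B = "bool_words (max_letter s - a) (max_letter t - b)"
  have "(if max_right (\<beta>1 @ \<beta>2) then ?X \<beta>1 * ?Y \<beta>2 else 0)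
      = ?X \<beta>1 * (if max_right \<beta>2 then ?Y \<beta>2 else 0)" if "\<beta>2 \<in> ?B" for \<beta>1 \<beta>2
  proof (cases "\<beta>2 = []")
    case True
    then have "a = max_letter s" "b = max_letter t" using that a b by (auto simp: bool_words_def)
    then have "P \<noteq> (\<lambda>m l. m < l)" using b last_letter_bounds[OF st(2,3)] by auto
    moreover have "hi a s = []" "hi b t = []"
      using \<open>a = _\<close> \<open>b = _\<close> st by (simp_all add: hi_eq_Nil)
    ultimately show ?thesis using y True by (simp add: join_def)
  qed auto
  then have "(\<Sum>\<beta>1\<in>bool_words a b. \<Sum>\<beta>2\<in>?B. if max_right (\<beta>1 @ \<beta>2) then ?X \<beta>1 * ?Y \<beta>2 else 0)
      = (\<Sum>\<beta>1\<in>bool_words a b. \<Sum>\<beta>2\<in>?B. ?X \<beta>1 * (if max_right \<beta>2 then ?Y \<beta>2 else 0))"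
    by (intro sum.cong refl) blast
  also have "\<dots> = (\<Sum>\<beta>1\<in>bool_words a b. ?X \<beta>1) * (\<Sum>\<beta>2\<in>?B. if max_right \<beta>2 then ?Y \<beta>2 else 0)"
    by (simp add: sum_product)
  also have "\<dots> = cop all_cuts x (lo a s) (lo b t) * cop max_right y (hi a s) (hi b t)"
    using a b by (simp add: cop_def st sum.inter_filter)
  finally show "(\<Sum>\<beta>1\<in>bool_words a b. \<Sum>\<beta>2\<in>?B. if max_right (\<beta>1 @ \<beta>2) then ?X \<beta>1 * ?Y \<beta>2 else 0)
      = cop all_cuts x (lo a s) (lo b t) * cop max_right y (hi a s) (hi b t)" .
qed

lemma cop_prec:
  assumes "x \<in> packed_span" "y \<in> packed_span" "packed_word s" "packed_word t" "t \<noteq> []"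
  shows "cop all_cuts (x \<prec>\<prec> y) s t = (\<Sum>a\<le>max_letter s. \<Sum>b | b \<le> max_letter t \<and> last t \<le> b.
      cop all_cuts x (lo a s) (lo b t) * cop all_cuts y (hi a s) (hi b t))"
  by (rule cop_conv_all[where P = "\<lambda>m l. l \<le> m"]) (simp_all add: assms cf_prec)

lemma cop_succ:
  assumes "x \<in> packed_span" "y \<in> packed_span" "packed_word s" "packed_word t" "t \<noteq> []"
  shows "cop all_cuts (x \<succ>\<succ> y) s t = (\<Sum>a\<le>max_letter s. \<Sum>b | b \<le> max_letter t \<and> b < last t.
      cop all_cuts x (lo a s) (lo b t) * cop all_cuts y (hi a s) (hi b t))"
  by (rule cop_conv_all[where P = "\<lambda>m l. m < l"]) (simp_all add: assms cf_succ)

lemma cop_max_right_prec: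
  assumes "x \<in> packed_span" "y \<in> packed_span" "packed_word s" "packed_word t" "t \<noteq> []" "cf y [] = 0"
  shows "cop max_right (x \<prec>\<prec> y) s t = (\<Sum>a\<le>max_letter s. \<Sum>b | b \<le> max_letter t \<and> last t \<le> b.
      cop all_cuts x (lo a s) (lo b t) * cop max_right y (hi a s) (hi b t))"
  by (rule cop_conv_max_right[where P = "\<lambda>m l. l \<le> m"]) (simp_all add: assms cf_prec)

lemma cop_max_right_succ:
  assumes "x \<in> packed_span" "y \<in> packed_span" "packed_word s" "packed_word t" "t \<noteq> []"
  shows "cop max_right (x \<succ>\<succ> y) s t = (\<Sum>a\<le>max_letter s. \<Sum>b | b \<le> max_letter t \<and> b < last t.
      cop all_cuts x (lo a s) (lo b t) * cop max_right y (hi a s) (hi b t))"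
  by (rule cop_conv_max_right[where P = "\<lambda>m l. m < l"]) (simp_all add: assms cf_succ)


section \<open>Coassociativity\<close>

text \<open>The renumbering behind \<open>pack\<close>, with the reference set as a separate
  argument: a prefix of \<open>pack v\<close> is the prefix of \<open>v\<close> renumbered by the
  ranks in all of \<open>set v\<close>, not in the prefix.\<close>

definition rank :: "nat set \<Rightarrow> nat \<Rightarrow> nat" where
  "rank S a = card {b \<in> S. b \<le> a}"

lemma pack_rank: "pack u = map (rank (set u)) u"
  by (simp add: pack_def rank_def)

lemma rank_less: "finite S \<Longrightarrow> b \<in> S \<Longrightarrow> a < b \<Longrightarrow> rank S a < rank S b"
proof -
  assume S: "finite S" "b \<in> S" "a < b"
  then have "b \<in> {c \<in> S. c \<le> b} - {c \<in> S. c \<le> a}" by auto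
  moreover have "{c \<in> S. c \<le> a} \<subseteq> {c \<in> S. c \<le> b}" using S by auto
  ultimately show ?thesis using S(1) unfolding rank_def by (intro psubset_card_mono) auto
qed

lemma rank_inj: "finite S \<Longrightarrow> inj_on (rank S) S"
  by (rule linorder_inj_onI') (metis rank_less less_irrefl)

lemma rank_Max: "finite S \<Longrightarrow> S \<noteq> {} \<Longrightarrow> rank S (Max S) = card S"
  unfolding rank_def by (rule arg_cong[of _ _ card]) auto

lemma pack_map_mono:
  assumes "\<And>a b. a \<in> set u \<Longrightarrow> b \<in> set u \<Longrightarrow> a < b \<Longrightarrow> f a < f b"
  shows "pack (map f u) = pack u"
proof -
  have inj: "inj_on f (set u)"
    by (rule linorder_inj_onI') (metis assms less_irrefl)
  have "card {b \<in> f ` set u. b \<le> f a} = card {b \<in> set u. b \<le> a}" if a: "a \<in> set u" for a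
  proof -
    have "{b \<in> f ` set u. b \<le> f a} = f ` {b \<in> set u. b \<le> a}"
      using a assms by (auto simp: image_iff) (metis linorder_not_le, metis le_less)
    then show ?thesis
      by (simp add: card_image inj_on_subset[OF inj])
  qed
  then show ?thesis by (simp add: pack_def)
qed

lemma pack_take_pack: "pack (take i (pack v)) = pack (take i v)"
  and pack_drop_pack: "pack (drop i (pack v)) = pack (drop i v)"
  unfolding pack_rank[of v] take_map drop_map
  by (rule pack_map_mono, rule rank_less; auto dest: in_set_takeD in_set_dropD)+

lemma pack_disjoint_iff:
  assumes "set a \<subseteq> S" "set b \<subseteq> S" "finite S"
  shows "set (map (rank S) a) \<inter> set (map (rank S) b) = {} \<longleftrightarrow> set a \<inter> set b = {}"
  using inj_on_image_Int[OF rank_inj[OF assms(3)] assms(1,2)] by auto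

lemma max_pack_iff:
  assumes w: "packed_word w" and v: "set v \<subseteq> set w" "max_letter w \<in> set v" and b: "set b \<subseteq> set v"
  shows "max_letter (pack v) \<in> set (map (rank (set v)) b) \<longleftrightarrow> max_letter w \<in> set b"
proof -
  have "Max (set v) = max_letter w"
    using v packed_word_set[OF w] by (intro Max_eqI) auto
  moreover have "set v \<noteq> {}" using v by auto
  ultimately have "max_letter (pack v) = rank (set v) (max_letter w)"
    using rank_Max[of "set v"] by (simp add: max_letter_pack)
  then show ?thesis
    using inj_on_image_mem_iff[OF rank_inj[of "set v"] v(2) b] by simp
qed

section \<open>Cuts into three blocks\<close>

lemma finite_cut_words: "packed_word s \<Longrightarrow> packed_word t \<Longrightarrow> finite (cut_words s t)"
proof -
  assume st: "packed_word s" "packed_word t"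
  have "cut_words s t \<subseteq> (\<lambda>\<beta>. join \<beta> s t) ` bool_words (max_letter s) (max_letter t)"
    using join_bij[OF st] by (metis image_eqI subsetI)
  then show ?thesis by (rule finite_subset) simp
qed

text \<open>Coassociativity is checked on words instead of codes, because there an iterated cut in
  either order is just a word with three blocks of pairwise disjoint letters.\<close>

lemma cut_sum:
  assumes st: "packed_word s" "packed_word t"
    and N: "\<And>\<beta>. \<beta> \<in> bool_words (max_letter s) (max_letter t) \<Longrightarrow> Q \<beta> \<longleftrightarrow> N (join \<beta> s t)"
  shows "(\<Sum>\<beta> | \<beta> \<in> bool_words (max_letter s) (max_letter t) \<and> Q \<beta>. F (join \<beta> s t))
       = (\<Sum>w | w \<in> cut_words s t \<and> N w. F w)"
  by (rule sum.reindex_bij_witness[where j = "\<lambda>\<beta>. join \<beta> s t" and i = "cut_code s"])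
    (auto simp: join_bij[OF st] N)

definition cut3 :: "nat list \<Rightarrow> nat list \<Rightarrow> nat list \<Rightarrow> nat list set" where
  "cut3 s r t = {w. packed_word w \<and> length w = length s + length r + length t
     \<and> set (take (length s) w) \<inter> set (take (length r) (drop (length s) w)) = {}
     \<and> set (take (length s) w) \<inter> set (drop (length s + length r) w) = {}
     \<and> set (take (length r) (drop (length s) w)) \<inter> set (drop (length s + length r) w) = {}
     \<and> pack (take (length s) w) = s \<and> pack (take (length r) (drop (length s) w)) = r
     \<and> pack (drop (length s + length r) w) = t}"

text \<open>The intermediate word \<open>u\<close> of an iterated cut is recovered from
  \<open>w\<close> by packing the first two blocks together, so a sum over \<open>u\<close> and
  \<open>w\<close> is a sum over \<open>w\<close> alone. Ranks are strictly monotone on these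
  blocks, so this packing affects neither their disjointness nor their packed forms.\<close>

lemma cut3_left:
  "u \<in> cut_words s r \<and> w \<in> cut_words u t \<longleftrightarrow>
   w \<in> cut3 s r t \<and> u = pack (take (length s + length r) w)"
proof -
  let ?v = "take (length s + length r) w" and ?A = "take (length s) w"
    and ?B = "take (length r) (drop (length s) w)" and ?C = "drop (length s + length r) w"
  have vA: "take (length s) ?v = ?A" and vB: "drop (length s) ?v = ?B"
    by (simp_all add: drop_take)
  have vAB: "?v = ?A @ ?B" by (simp add: take_add)
  have sub: "set ?A \<subseteq> set ?v" "set ?B \<subseteq> set ?v" unfolding vAB by auto
  show ?thesis
  proof (cases "u = pack ?v \<and> length w = length s + length r + length t")
    case True
    then have lu: "length u = length s + length r" by simp
    have R: "take (length s) u = map (rank (set ?v)) ?A" "drop (length s) u = map (rank (set ?v)) ?B"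
      using True vA vB by (simp_all only: pack_rank take_map drop_map)
    have R': "pack (map (rank (set ?v)) ?A) = pack ?A" "pack (map (rank (set ?v)) ?B) = pack ?B"
      using True R pack_take_pack[of "length s" ?v] pack_drop_pack[of "length s" ?v] vA vB by simp_all
    have "set ?v = set ?A \<union> set ?B" by (metis vAB set_append)
    then show ?thesis
      using True packed_pack[of ?v]
      unfolding cut_words_def cut3_def mem_Collect_eq lu R R' pack_disjoint_iff[OF sub finite_set]
      by blast
  next
    case False
    moreover have "u = pack ?v \<and> length w = length s + length r + length t"
      if "u \<in> cut_words s r" "w \<in> cut_words u t" using that by (auto simp: cut_words_def)
    ultimately show ?thesis unfolding cut3_def by blast
  qed
qed

lemma cut3_right:
  "u \<in> cut_words r t \<and> w \<in> cut_words s u \<longleftrightarrow>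
   w \<in> cut3 s r t \<and> u = pack (drop (length s) w)"
proof -
  let ?v = "drop (length s) w" and ?A = "take (length s) w"
    and ?B = "take (length r) (drop (length s) w)" and ?C = "drop (length s + length r) w"
  have vC: "drop (length r) ?v = ?C"
    by (simp add: add.commute)
  have vBC: "?v = ?B @ ?C" using append_take_drop_id[of "length r" ?v] vC by simp
  have sub: "set ?B \<subseteq> set ?v" "set ?C \<subseteq> set ?v"
    by (metis set_take_subset, metis vC set_drop_subset)
  show ?thesis
  proof (cases "u = pack ?v \<and> length w = length s + length r + length t")
    case True
    then have lu: "length u = length r + length t" by simp
    have R: "take (length r) u = map (rank (set ?v)) ?B" "drop (length r) u = map (rank (set ?v)) ?C"
      using True vC by (simp_all only: pack_rank take_map drop_map)
    have R': "pack (map (rank (set ?v)) ?B) = pack ?B" "pack (map (rank (set ?v)) ?C) = pack ?C"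
      using True R pack_take_pack[of "length r" ?v] pack_drop_pack[of "length r" ?v] vC by simp_all
    have "set ?v = set ?B \<union> set ?C" by (metis vBC set_append)
    then show ?thesis
      using True packed_pack[of ?v]
      unfolding cut_words_def cut3_def mem_Collect_eq lu R R' pack_disjoint_iff[OF sub finite_set]
        add.assoc[symmetric]
      by blast
  next
    case False
    moreover have "u = pack ?v \<and> length w = length s + length r + length t"
      if "u \<in> cut_words r t" "w \<in> cut_words s u" using that by (auto simp: cut_words_def)
    ultimately show ?thesis unfolding cut3_def by blast
  qed
qed

lemma sum_cut3_left:
  assumes "packed_word s" "packed_word r" "packed_word t"
  shows "(\<Sum>u | u \<in> cut_words s r \<and> N' u. \<Sum>w | w \<in> cut_words u t \<and> N w. F w)
       = (\<Sum>w | w \<in> cut3 s r t \<and> N' (pack (take (length s + length r) w)) \<and> N w. F w)"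
proof -
  have fin: "finite {u. u \<in> cut_words s r \<and> N' u}"
    using finite_cut_words[OF assms(1,2)] by simp
  have fin': "finite {w. w \<in> cut_words u t \<and> N w}" if "u \<in> {u. u \<in> cut_words s r \<and> N' u}" for u
  proof -
    have "packed_word u" using that unfolding cut_words_def by blast
    then show ?thesis using finite_cut_words[of u t] assms by simp
  qed
  have "(\<Sum>u | u \<in> cut_words s r \<and> N' u. \<Sum>w | w \<in> cut_words u t \<and> N w. F w)
      = (\<Sum>(u, w)\<in>(SIGMA u:{u. u \<in> cut_words s r \<and> N' u}. {w. w \<in> cut_words u t \<and> N w}). F w)"
    using fin fin' by (intro sum.Sigma) simp_all
  also have "\<dots> = (\<Sum>w | w \<in> cut3 s r t \<and> N' (pack (take (length s + length r) w)) \<and> N w. F w)"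
  proof (rule sum.reindex_bij_witness[where j = snd and
          i = "\<lambda>w. (pack (take (length s + length r) w), w)"])
    fix z assume "z \<in> (SIGMA u:{u. u \<in> cut_words s r \<and> N' u}. {w. w \<in> cut_words u t \<and> N w})"
    then have "fst z \<in> cut_words s r \<and> snd z \<in> cut_words (fst z) t" "N' (fst z)" "N (snd z)" by auto
    then show "(pack (take (length s + length r) (snd z)), snd z) = z"
      "snd z \<in> {w. w \<in> cut3 s r t \<and> N' (pack (take (length s + length r) w)) \<and> N w}"
      unfolding cut3_left by (simp_all add: prod_eq_iff)
  next
    fix w assume "w \<in> {w. w \<in> cut3 s r t \<and> N' (pack (take (length s + length r) w)) \<and> N w}"
    then show "(pack (take (length s + length r) w), w)
        \<in> (SIGMA u:{u. u \<in> cut_words s r \<and> N' u}. {w. w \<in> cut_words u t \<and> N w})"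
      using cut3_left[of "pack (take (length s + length r) w)" s r w t] by simp
  qed (simp_all add: case_prod_beta)
  finally show ?thesis .
qed

lemma sum_cut3_right:
  assumes "packed_word s" "packed_word r" "packed_word t"
  shows "(\<Sum>u | u \<in> cut_words r t \<and> N' u. \<Sum>w | w \<in> cut_words s u \<and> N w. F w)
       = (\<Sum>w | w \<in> cut3 s r t \<and> N' (pack (drop (length s) w)) \<and> N w. F w)"
proof -
  have fin: "finite {u. u \<in> cut_words r t \<and> N' u}"
    using finite_cut_words[OF assms(2,3)] by simp
  have fin': "finite {w. w \<in> cut_words s u \<and> N w}" if "u \<in> {u. u \<in> cut_words r t \<and> N' u}" for u
  proof -
    have "packed_word u" using that unfolding cut_words_def by blast
    then show ?thesis using finite_cut_words[of s u] assms by simp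
  qed
  have "(\<Sum>u | u \<in> cut_words r t \<and> N' u. \<Sum>w | w \<in> cut_words s u \<and> N w. F w)
      = (\<Sum>(u, w)\<in>(SIGMA u:{u. u \<in> cut_words r t \<and> N' u}. {w. w \<in> cut_words s u \<and> N w}). F w)"
    using fin fin' by (intro sum.Sigma) simp_all
  also have "\<dots> = (\<Sum>w | w \<in> cut3 s r t \<and> N' (pack (drop (length s) w)) \<and> N w. F w)"
  proof (rule sum.reindex_bij_witness[where j = snd and i = "\<lambda>w. (pack (drop (length s) w), w)"])
    fix z assume "z \<in> (SIGMA u:{u. u \<in> cut_words r t \<and> N' u}. {w. w \<in> cut_words s u \<and> N w})"
    then have "fst z \<in> cut_words r t \<and> snd z \<in> cut_words s (fst z)" "N' (fst z)" "N (snd z)" by auto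
    then show "(pack (drop (length s) (snd z)), snd z) = z"
      "snd z \<in> {w. w \<in> cut3 s r t \<and> N' (pack (drop (length s) w)) \<and> N w}"
      unfolding cut3_right by (simp_all add: prod_eq_iff)
  next
    fix w assume "w \<in> {w. w \<in> cut3 s r t \<and> N' (pack (drop (length s) w)) \<and> N w}"
    then show "(pack (drop (length s) w), w)
        \<in> (SIGMA u:{u. u \<in> cut_words r t \<and> N' u}. {w. w \<in> cut_words s u \<and> N w})"
      using cut3_right[of "pack (drop (length s) w)" r t w s] by simp
  qed (simp_all add: case_prod_beta)
  finally show ?thesis .
qed

lemma max_join_iff:
  assumes "packed_word s" "packed_word t" "s \<noteq> []" "\<beta> \<in> bool_words (max_letter s) (max_letter t)"
  shows "max_left \<beta> \<longleftrightarrow> max_letter (join \<beta> s t) \<in> set (take (length s) (join \<beta> s t))"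
    and "max_right \<beta> \<longleftrightarrow> max_letter (join \<beta> s t) \<in> set (drop (length s) (join \<beta> s t))"
proof -
  have ne: "\<beta> \<noteq> []" using assms bool_words_ne by blast
  have "take (length s) (join \<beta> s t) = map (occ \<beta> True) s"
    "drop (length s) (join \<beta> s t) = map (occ \<beta> False) t" by (simp_all add: join_def)
  then show "max_left \<beta> \<longleftrightarrow> max_letter (join \<beta> s t) \<in> set (take (length s) (join \<beta> s t))"
    and "max_right \<beta> \<longleftrightarrow> max_letter (join \<beta> s t) \<in> set (drop (length s) (join \<beta> s t))"
    using last_code[OF assms(1,2,4) ne] ne by simp_all
qed

lemma cop_cut:
  assumes "packed_word s" "packed_word t" "s \<noteq> []"
  shows "cop all_cuts x s t = (\<Sum>w | w \<in> cut_words s t \<and> True. cf x w)"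
    and "cop max_left x s t
      = (\<Sum>w | w \<in> cut_words s t \<and> max_letter w \<in> set (take (length s) w). cf x w)"
    and "cop max_right x s t
      = (\<Sum>w | w \<in> cut_words s t \<and> max_letter w \<in> set (drop (length s) w). cf x w)"
  unfolding cop_def using max_join_iff[OF assms]
  by (intro cut_sum assms; blast)+

lemma cut_words_packed:
  assumes "u \<in> cut_words s t" "s \<noteq> []"
  shows "packed_word u" "u \<noteq> []"
  using assms by (auto simp: cut_words_def)

text \<open>The two sides are the coefficients at \<open>s \<otimes> r \<otimes> t\<close> of
  \<open>(Delta \<otimes> id) (Delta x)\<close> and \<open>(id \<otimes> Delta) (Delta x)\<close>;
  both add up the coefficients of \<open>x\<close> over \<open>cut3 s r t\<close>.\<close>

lemma coassoc_all:
  assumes p: "packed_word s" "packed_word r" "packed_word t" and ne: "s \<noteq> []" "r \<noteq> []"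
  shows "(\<Sum>\<beta> | \<beta> \<in> bool_words (max_letter s) (max_letter r) \<and> True. cop all_cuts x (join \<beta> s r) t)
       = (\<Sum>\<beta> | \<beta> \<in> bool_words (max_letter r) (max_letter t) \<and> True. cop all_cuts x s (join \<beta> r t))"
proof -
  have "(\<Sum>\<beta> | \<beta> \<in> bool_words (max_letter s) (max_letter r) \<and> True. cop all_cuts x (join \<beta> s r) t)
      = (\<Sum>u | u \<in> cut_words s r \<and> True. cop all_cuts x u t)"
    by (rule cut_sum) (use p in auto)
  also have "\<dots> = (\<Sum>u | u \<in> cut_words s r \<and> True. \<Sum>w | w \<in> cut_words u t \<and> True. cf x w)"
    using p ne by (intro sum.cong refl cop_cut) (auto dest: cut_words_packed)
  also have "\<dots> = (\<Sum>u | u \<in> cut_words r t \<and> True. \<Sum>w | w \<in> cut_words s u \<and> True. cf x w)"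
    unfolding sum_cut3_left[OF p] sum_cut3_right[OF p] ..
  also have "\<dots> = (\<Sum>u | u \<in> cut_words r t \<and> True. cop all_cuts x s u)"
    using p ne by (intro sum.cong refl cop_cut[symmetric]) (auto dest: cut_words_packed)
  also have "\<dots> = (\<Sum>\<beta> | \<beta> \<in> bool_words (max_letter r) (max_letter t) \<and> True. cop all_cuts x s (join \<beta> r t))"
    by (rule cut_sum[symmetric]) (use p in auto)
  finally show ?thesis .
qed

lemma cut3_max:
  assumes w: "w \<in> cut3 s r t"
  shows "max_letter (pack (take (length s + length r) w)) \<in> set (drop (length s) (pack (take (length s + length r) w)))
      \<and> max_letter w \<in> set (take (length s + length r) w)
     \<longleftrightarrow> max_letter w \<in> set (take (length r) (drop (length s) w))"
    (is "?L1 \<longleftrightarrow> ?B")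
    and "max_letter (pack (drop (length s) w)) \<in> set (take (length r) (pack (drop (length s) w)))
      \<and> max_letter w \<in> set (drop (length s) w) \<longleftrightarrow> max_letter w \<in> set (take (length r) (drop (length s) w))"
    (is "?L2 \<longleftrightarrow> ?B")
    and "max_letter (pack (drop (length s) w)) \<in> set (drop (length r) (pack (drop (length s) w)))
      \<and> max_letter w \<in> set (drop (length s) w) \<longleftrightarrow> max_letter w \<in> set (drop (length s + length r) w)"
    (is "?L3 \<longleftrightarrow> ?C")
proof -
  have pw: "packed_word w" using w by (simp add: cut3_def)
  have B: "drop (length s) (take (length s + length r) w) = take (length r) (drop (length s) w)"
    by (simp add: drop_take)
  have C: "drop (length r) (drop (length s) w) = drop (length s + length r) w"
    by (simp add: add.commute)
  have sub: "set (take (length r) (drop (length s) w)) \<subseteq> set (take (length s + length r) w)"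
    "set (take (length r) (drop (length s) w)) \<subseteq> set (drop (length s) w)"
    "set (drop (length s + length r) w) \<subseteq> set (drop (length s) w)"
    by (metis B set_drop_subset, metis set_take_subset, metis C set_drop_subset)
  show "?L1 \<longleftrightarrow> ?B"
    using max_pack_iff[OF pw set_take_subset _ sub(1)] sub(1)
    unfolding pack_rank drop_map B by blast
  show "?L2 \<longleftrightarrow> ?B"
    using max_pack_iff[OF pw set_drop_subset _ sub(2)] sub(2)
    unfolding pack_rank take_map by blast
  show "?L3 \<longleftrightarrow> ?C"
    using max_pack_iff[OF pw set_drop_subset _ sub(3)] sub(3)
    unfolding pack_rank drop_map C by blast
qed

text \<open>With the largest letter in the third block this is \<open>(id \<otimes> Delta_succ)
  Delta_succ = (Delta \<otimes> id) Delta_succ\<close>; the cut between the first two blocks is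
  unrestricted.\<close>

lemma coassoc_max_right:
  assumes p: "packed_word s" "packed_word r" "packed_word t" and ne: "s \<noteq> []" "r \<noteq> []"
  shows "(\<Sum>\<beta> | \<beta> \<in> bool_words (max_letter r) (max_letter t) \<and> max_right \<beta>. cop max_right x s (join \<beta> r t))
       = (\<Sum>\<beta> | \<beta> \<in> bool_words (max_letter s) (max_letter r) \<and> True. cop max_right x (join \<beta> s r) t)"
proof -
  let ?N = "\<lambda>k w. max_letter w \<in> set (drop k w)"
  have "(\<Sum>\<beta> | \<beta> \<in> bool_words (max_letter r) (max_letter t) \<and> max_right \<beta>. cop max_right x s (join \<beta> r t))
      = (\<Sum>u | u \<in> cut_words r t \<and> ?N (length r) u. cop max_right x s u)"
    by (rule cut_sum) (use p ne max_join_iff in auto)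
  also have "\<dots> = (\<Sum>u | u \<in> cut_words r t \<and> ?N (length r) u.
      \<Sum>w | w \<in> cut_words s u \<and> ?N (length s) w. cf x w)"
    using p ne by (intro sum.cong refl cop_cut) (auto dest: cut_words_packed)
  also have "\<dots> = (\<Sum>w | w \<in> cut3 s r t \<and> ?N (length s + length r) w. cf x w)"
    unfolding sum_cut3_right[OF p] using cut3_max(3) by (intro sum.cong) auto
  also have "\<dots> = (\<Sum>u | u \<in> cut_words s r \<and> True.
      \<Sum>w | w \<in> cut_words u t \<and> ?N (length s + length r) w. cf x w)"
    unfolding sum_cut3_left[OF p] by simp
  also have "\<dots> = (\<Sum>u | u \<in> cut_words s r \<and> True.
      \<Sum>w | w \<in> cut_words u t \<and> ?N (length u) w. cf x w)"
    by (intro sum.cong refl) (auto simp: cut_words_def)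
  also have "\<dots> = (\<Sum>u | u \<in> cut_words s r \<and> True. cop max_right x u t)"
    using p ne by (intro sum.cong refl cop_cut(3)[symmetric]) (auto dest: cut_words_packed)
  also have "\<dots> = (\<Sum>\<beta> | \<beta> \<in> bool_words (max_letter s) (max_letter r) \<and> True. cop max_right x (join \<beta> s r) t)"
    by (rule cut_sum[symmetric]) (use p in auto)
  finally show ?thesis .
qed

text \<open>With the largest letter in the second block this is \<open>(id \<otimes> Delta_prec)
  Delta_succ = (Delta_succ \<otimes> id) Delta_prec\<close>.\<close>

lemma coassoc_max_middle:
  assumes p: "packed_word s" "packed_word r" "packed_word t" and ne: "s \<noteq> []" "r \<noteq> []"
  shows "(\<Sum>\<beta> | \<beta> \<in> bool_words (max_letter r) (max_letter t) \<and> max_left \<beta>. cop max_right x s (join \<beta> r t))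
       = (\<Sum>\<beta> | \<beta> \<in> bool_words (max_letter s) (max_letter r) \<and> max_right \<beta>. cop max_left x (join \<beta> s r) t)"
proof -
  let ?N = "\<lambda>k w. max_letter w \<in> set (drop k w)" and ?M = "\<lambda>k w. max_letter w \<in> set (take k w)"
  have "(\<Sum>\<beta> | \<beta> \<in> bool_words (max_letter r) (max_letter t) \<and> max_left \<beta>. cop max_right x s (join \<beta> r t))
      = (\<Sum>u | u \<in> cut_words r t \<and> ?M (length r) u. cop max_right x s u)"
    by (rule cut_sum) (use p ne max_join_iff in auto)
  also have "\<dots> = (\<Sum>u | u \<in> cut_words r t \<and> ?M (length r) u.
      \<Sum>w | w \<in> cut_words s u \<and> ?N (length s) w. cf x w)"
    using p ne by (intro sum.cong refl cop_cut) (auto dest: cut_words_packed)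
  also have "\<dots> = (\<Sum>w | w \<in> cut3 s r t \<and> max_letter w \<in> set (take (length r) (drop (length s) w)). cf x w)"
    unfolding sum_cut3_right[OF p] using cut3_max(2) by (intro sum.cong) auto
  also have "\<dots> = (\<Sum>u | u \<in> cut_words s r \<and> ?N (length s) u.
      \<Sum>w | w \<in> cut_words u t \<and> ?M (length s + length r) w. cf x w)"
    unfolding sum_cut3_left[OF p] using cut3_max(1) by (intro sum.cong) auto
  also have "\<dots> = (\<Sum>u | u \<in> cut_words s r \<and> ?N (length s) u.
      \<Sum>w | w \<in> cut_words u t \<and> ?M (length u) w. cf x w)"
    by (intro sum.cong refl) (auto simp: cut_words_def)
  also have "\<dots> = (\<Sum>u | u \<in> cut_words s r \<and> ?N (length s) u. cop max_left x u t)"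
    using p ne by (intro sum.cong refl cop_cut(2)[symmetric]) (auto dest: cut_words_packed)
  also have "\<dots> = (\<Sum>\<beta> | \<beta> \<in> bool_words (max_letter s) (max_letter r) \<and> max_right \<beta>. cop max_left x (join \<beta> s r) t)"
    by (rule cut_sum[symmetric]) (use p ne max_join_iff in auto)
  finally show ?thesis .
qed


section \<open>Coproducts of iterated products of primitive elements\<close>

lemma Prim_plus: "x \<in> Prim \<Longrightarrow> x \<in> WQSym_plus"
  and TPrim_plus: "x \<in> TPrim \<Longrightarrow> x \<in> WQSym_plus"
  by (simp_all add: Prim_def TPrim_def)

lemma TPrim_Prim: "x \<in> TPrim \<Longrightarrow> x \<in> Prim"
  by (simp add: Prim_def TPrim_def)

lemma cop_Prim:
  assumes "x \<in> Prim" "packed_word s" "packed_word t"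
  shows "cop all_cuts x s t = (if s = [] then cf x t else if t = [] then cf x s else 0)"
  using assms by (simp add: cop_Nil_left cop_Nil_right Prim_iff)

lemma cop_max_right_TPrim:
  assumes "x \<in> TPrim" "packed_word s" "packed_word t" "t \<noteq> []"
  shows "cop max_right x s t = (if s = [] then cf x t else 0)"
  using assms by (simp add: cop_max_right_Nil_left TPrim_iff)

lemma lo_ne: "packed_word t \<Longrightarrow> t \<noteq> [] \<Longrightarrow> last t \<le> b \<Longrightarrow> lo b t \<noteq> []"
  and hi_ne: "packed_word t \<Longrightarrow> t \<noteq> [] \<Longrightarrow> b < last t \<Longrightarrow> hi b t \<noteq> []"
  using last_lo[of t b] last_hi[of t b] by auto

text \<open>Compatibility in Sweedler form: the left tensor factors are multiplied by
  \<open>mul\<close>, the right ones by the half-product. The cuts satisfy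
  \<open>last t \<le> b\<close>, so \<open>lo b t\<close> is non-empty and the coproduct of
  \<open>x\<close> is only evaluated at non-empty right words.\<close>

lemma cop_prec_tensor:
  assumes x: "x \<in> packed_span" and y: "y \<in> packed_span"
    and J: "finite J" "\<And>j. j \<in> J \<Longrightarrow> f j \<in> packed_span \<and> g j \<in> packed_span"
    and K: "finite K" "\<And>k. k \<in> K \<Longrightarrow> f' k \<in> packed_span \<and> g' k \<in> packed_span"
    and cx: "\<And>s t. packed_word s \<Longrightarrow> packed_word t \<Longrightarrow> t \<noteq> [] \<Longrightarrow>
        cop all_cuts x s t = (\<Sum>j\<in>J. cf (f j) s * cf (g j) t)"
    and cy: "\<And>s t. packed_word s \<Longrightarrow> packed_word t \<Longrightarrow>
        cop all_cuts y s t = (\<Sum>k\<in>K. cf (f' k) s * cf (g' k) t)"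
    and st: "packed_word s" "packed_word t" "t \<noteq> []"
  shows "cop all_cuts (x \<prec>\<prec> y) s t
       = (\<Sum>j\<in>J. \<Sum>k\<in>K. cf (mul (f j) (f' k)) s * cf (g j \<prec>\<prec> g' k) t)"
proof -
  let ?A = "{..max_letter s}" and ?B = "{b. b \<le> max_letter t \<and> last t \<le> b}"
  have "cop all_cuts (x \<prec>\<prec> y) s t = (\<Sum>a\<in>?A. \<Sum>b\<in>?B.
      cop all_cuts x (lo a s) (lo b t) * cop all_cuts y (hi a s) (hi b t))"
    by (rule cop_prec) (use x y st in auto)
  also have "\<dots> = (\<Sum>a\<in>?A. \<Sum>b\<in>?B. \<Sum>j\<in>J. \<Sum>k\<in>K.
      (cf (f j) (lo a s) * cf (f' k) (hi a s)) * (cf (g j) (lo b t) * cf (g' k) (hi b t)))"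
    using st by (intro sum.cong refl) (simp add: cx cy lo_ne sum_product mult_ac)
  also have "\<dots> = (\<Sum>a\<in>?A. \<Sum>j\<in>J. \<Sum>k\<in>K. \<Sum>b\<in>?B.
      (cf (f j) (lo a s) * cf (f' k) (hi a s)) * (cf (g j) (lo b t) * cf (g' k) (hi b t)))"
    by (intro sum.cong refl, subst sum.swap, intro sum.cong refl, rule sum.swap)
  also have "\<dots> = (\<Sum>j\<in>J. \<Sum>k\<in>K. \<Sum>a\<in>?A. \<Sum>b\<in>?B.
      (cf (f j) (lo a s) * cf (f' k) (hi a s)) * (cf (g j) (lo b t) * cf (g' k) (hi b t)))"
    by (subst sum.swap, intro sum.cong refl, rule sum.swap)
  also have "\<dots> = (\<Sum>j\<in>J. \<Sum>k\<in>K. cf (mul (f j) (f' k)) s * cf (g j \<prec>\<prec> g' k) t)"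
    using J K st by (intro sum.cong refl) (simp add: cf_mul cf_prec sum_product)
  finally show ?thesis .
qed

text \<open>A primitive \<open>x\<close> has coproduct \<open>x \<otimes> 1 + 1 \<otimes> x\<close>.
  Its right factor receives the last letter of \<open>t\<close> and so is non-empty. Hence only
  \<open>1 \<otimes> x\<close> contributes, and \<open>x\<close> stays on the right.\<close>

lemma cop_prim_prec:
  assumes x: "x \<in> Prim" and y: "y \<in> packed_span"
    and g: "\<And>j. j \<in> J \<Longrightarrow> g j \<in> packed_span"
    and cy: "\<And>s t. packed_word s \<Longrightarrow> packed_word t \<Longrightarrow>
        cop all_cuts y s t = (\<Sum>j\<in>J. f j s * cf (g j) t)"
    and st: "packed_word s" "packed_word t" "t \<noteq> []"
  shows "cop all_cuts (x \<prec>\<prec> y) s t = (\<Sum>j\<in>J. f j s * cf (x \<prec>\<prec> g j) t)"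
proof -
  let ?B = "{b. b \<le> max_letter t \<and> last t \<le> b}"
  have xP: "x \<in> packed_span" using x Prim_plus WQSym_plus_packed_span by blast
  have "cop all_cuts (x \<prec>\<prec> y) s t = (\<Sum>a\<le>max_letter s. \<Sum>b\<in>?B.
      cop all_cuts x (lo a s) (lo b t) * cop all_cuts y (hi a s) (hi b t))"
    by (rule cop_prec) (use xP y st in auto)
  also have "\<dots> = (\<Sum>a\<le>max_letter s. if a = 0 then
      (\<Sum>b\<in>?B. \<Sum>j\<in>J. f j s * (cf x (lo b t) * cf (g j) (hi b t))) else 0)"
  proof (intro sum.cong refl)
    fix a assume a: "a \<in> {..max_letter s}"
    show "(\<Sum>b\<in>?B. cop all_cuts x (lo a s) (lo b t) * cop all_cuts y (hi a s) (hi b t))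
      = (if a = 0 then (\<Sum>b\<in>?B. \<Sum>j\<in>J. f j s * (cf x (lo b t) * cf (g j) (hi b t))) else 0)"
    proof (cases "a = 0")
      case True
      then show ?thesis
        using st x by (simp add: cop_Prim lo_eq_Nil cy sum_distrib_left mult_ac)
    next
      case False
      have "cop all_cuts x (lo a s) (lo b t) = 0" if "b \<in> ?B" for b
        using False a st x that lo_ne[OF st(2,3), of b] by (simp add: cop_Prim lo_eq_Nil)
      then show ?thesis using False by simp
    qed
  qed
  also have "\<dots> = (\<Sum>b\<in>?B. \<Sum>j\<in>J. f j s * (cf x (lo b t) * cf (g j) (hi b t)))"
    by (simp add: sum.delta)
  also have "\<dots> = (\<Sum>j\<in>J. f j s * (\<Sum>b\<in>?B. cf x (lo b t) * cf (g j) (hi b t)))"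
    by (subst sum.swap) (simp add: sum_distrib_left)
  also have "\<dots> = (\<Sum>j\<in>J. f j s * cf (x \<prec>\<prec> g j) t)"
    using st xP g by (intro sum.cong refl) (simp add: cf_prec)
  finally show ?thesis .
qed

lemma cop_succ_prim:
  assumes x: "x \<in> Prim" and y: "y \<in> packed_span"
    and g: "\<And>j. j \<in> J \<Longrightarrow> g j \<in> packed_span"
    and cy: "\<And>s t. packed_word s \<Longrightarrow> packed_word t \<Longrightarrow>
        cop all_cuts y s t = (\<Sum>j\<in>J. f j s * cf (g j) t)"
    and st: "packed_word s" "packed_word t" "t \<noteq> []"
  shows "cop all_cuts (y \<succ>\<succ> x) s t = (\<Sum>j\<in>J. f j s * cf (g j \<succ>\<succ> x) t)"
proof -
  let ?B = "{b. b \<le> max_letter t \<and> b < last t}"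
  have xP: "x \<in> packed_span" using x Prim_plus WQSym_plus_packed_span by blast
  have "cop all_cuts (y \<succ>\<succ> x) s t = (\<Sum>a\<le>max_letter s. \<Sum>b\<in>?B.
      cop all_cuts y (lo a s) (lo b t) * cop all_cuts x (hi a s) (hi b t))"
    by (rule cop_succ) (use xP y st in auto)
  also have "\<dots> = (\<Sum>a\<le>max_letter s. if a = max_letter s then
      (\<Sum>b\<in>?B. \<Sum>j\<in>J. f j s * (cf (g j) (lo b t) * cf x (hi b t))) else 0)"
  proof (intro sum.cong refl)
    fix a assume a: "a \<in> {..max_letter s}"
    show "(\<Sum>b\<in>?B. cop all_cuts y (lo a s) (lo b t) * cop all_cuts x (hi a s) (hi b t))
      = (if a = max_letter s then
          (\<Sum>b\<in>?B. \<Sum>j\<in>J. f j s * (cf (g j) (lo b t) * cf x (hi b t))) else 0)"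
    proof (cases "a = max_letter s")
      case True
      then show ?thesis
        using st x by (simp add: cop_Prim hi_eq_Nil cy sum_distrib_left mult_ac)
    next
      case False
      have "cop all_cuts x (hi a s) (hi b t) = 0" if "b \<in> ?B" for b
        using False a st x that hi_ne[OF st(2,3), of b] by (simp add: cop_Prim hi_eq_Nil)
      then show ?thesis using False by simp
    qed
  qed
  also have "\<dots> = (\<Sum>b\<in>?B. \<Sum>j\<in>J. f j s * (cf (g j) (lo b t) * cf x (hi b t)))"
    by (simp add: sum.delta)
  also have "\<dots> = (\<Sum>j\<in>J. f j s * (\<Sum>b\<in>?B. cf (g j) (lo b t) * cf x (hi b t)))"
    by (subst sum.swap) (simp add: sum_distrib_left)
  also have "\<dots> = (\<Sum>j\<in>J. f j s * cf (g j \<succ>\<succ> x) t)"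
    using st xP g by (intro sum.cong refl) (simp add: cf_succ)
  finally show ?thesis .
qed

lemma cop_unit: "packed_word s \<Longrightarrow> packed_word t \<Longrightarrow> cop all_cuts (R []) s t = cf (R []) s * cf (R []) t"
proof -
  assume st: "packed_word s" "packed_word t"
  have "R [] \<in> WQSym 0" by (simp add: WQSym_def PW_def R_def)
  then show ?thesis
    using cop_hom[of "R []" 0 s t] st by (cases "s = []"; cases "t = []") (auto simp: cf_R cop_Nil_left)
qed

lemma set_take_subsetI: "set xs \<subseteq> A \<Longrightarrow> set (take i xs) \<subseteq> A"
  and set_drop_subsetI: "set xs \<subseteq> A \<Longrightarrow> set (drop i xs) \<subseteq> A"
  using set_take_subset set_drop_subset by fast+

text \<open>The first entry joins the right tensor factor whenever that factor is non-empty, so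
  prefixes of the list end up on the right and suffixes on the left; \<open>t = []\<close> accounts
  for the term \<open>j = 0\<close>. In \<open>cop_om'\<close> the last entry takes this role and
  the sides are exchanged.\<close>

lemma cop_om:
  "set xs \<subseteq> Prim \<Longrightarrow> packed_word s \<Longrightarrow> packed_word t \<Longrightarrow>
   cop all_cuts (om xs) s t = (\<Sum>j\<le>length xs. cf (om (drop j xs)) s * cf (om (take j xs)) t)"
proof (induction xs arbitrary: s t)
  case Nil
  then show ?case by (simp add: cop_unit)
next
  case (Cons x xs)
  have sub: "set (x # xs) \<subseteq> WQSym_plus" "set xs \<subseteq> WQSym_plus" using Cons.prems(1) Prim_plus by auto
  show ?case
  proof (cases "t = []")
    case True
    have "cf (om (take (Suc j) (x # xs))) [] = 0" for j
      by (rule WQSym_plus_Nil[OF om_WQSym_plus]) (use set_take_subsetI[OF sub(1), of "Suc j"] in auto)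
    then show ?thesis using True
      by (simp add: cop_Nil_right sum.atMost_Suc_shift cf_R del: sum.atMost_Suc)
  next
    case False
    have "cop all_cuts (om (x # xs)) s t
      = (\<Sum>j\<le>length xs. cf (om (drop j xs)) s * cf (x \<prec>\<prec> om (take j xs)) t)"
      unfolding om_Cons
      by (rule cop_prim_prec) (use Cons sub False in \<open>simp_all add: set_take_subsetI\<close>)
    then show ?thesis using False
      by (simp add: sum.atMost_Suc_shift cf_R del: sum.atMost_Suc)
  qed
qed

lemma cop_om':
  "set xs \<subseteq> Prim \<Longrightarrow> packed_word s \<Longrightarrow> packed_word t \<Longrightarrow>
   cop all_cuts (om' xs) s t = (\<Sum>j\<le>length xs. cf (om' (take j xs)) s * cf (om' (drop j xs)) t)"
proof (induction xs arbitrary: s t rule: rev_induct)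
  case Nil
  then show ?case by (simp add: cop_unit)
next
  case (snoc x xs)
  have sub: "set (xs @ [x]) \<subseteq> WQSym_plus" "set xs \<subseteq> WQSym_plus" using snoc.prems(1) Prim_plus by auto
  show ?case
  proof (cases "t = []")
    case True
    have "cf (om' (drop j xs) \<succ>\<succ> x) [] = 0" if "j \<le> length xs" for j
      using set_drop_subsetI[OF sub(2), of j] sub(1) by (simp add: WQSym_plus_packed_span)
    then show ?thesis using True by (simp add: cop_Nil_right cf_R)
  next
    case False
    have "cop all_cuts (om' (xs @ [x])) s t
      = (\<Sum>j\<le>length xs. cf (om' (take j xs)) s * cf (om' (drop j xs) \<succ>\<succ> x) t)"
      unfolding om'_snoc
      by (rule cop_succ_prim) (use snoc sub False in \<open>simp_all add: set_drop_subsetI\<close>)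
    then show ?thesis using False by (simp add: cf_R)
  qed
qed


section \<open>The brace bracket\<close>

definition brace_term :: "'k::field wqsym list \<Rightarrow> 'k wqsym \<Rightarrow> nat \<Rightarrow> 'k wqsym" where
  "brace_term xs z i = (om (take i xs) \<succ>\<succ> z) \<prec>\<prec> om' (drop i xs)"

lemma brace_eq:
  assumes xs: "set xs \<subseteq> WQSym_plus" "xs \<noteq> []" and z: "z \<in> WQSym_plus"
  shows "brace xs z = (\<Sum>i\<le>length xs. scale ((- 1) ^ (length xs - i)) (brace_term xs z i))"
  unfolding brace_def atLeast0AtMost
proof (intro sum.cong refl)
  fix i assume i: "i \<in> {..length xs}"
  let ?y = "if i = 0 then z else prec_iter (take i xs) \<succ>\<succ> z"
  have y: "?y = om (take i xs) \<succ>\<succ> z"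
    using xs z by (auto simp: succ_unit_left prec_iter_eq_om set_take_subsetI)
  have "om (take i xs) \<succ>\<succ> z \<in> WQSym_plus"
    using xs z by (simp add: WQSym_plus_iff set_take_subsetI)
  then have "(if i = length xs then ?y else ?y \<prec>\<prec> succ_iter (drop i xs)) = brace_term xs z i"
    using xs i unfolding y brace_term_def
    by (auto simp: prec_unit_right succ_iter_eq_om' set_drop_subsetI)
  then show "(let y = ?y in scale ((- 1) ^ (length xs - i))
      (if i = length xs then y else y \<prec>\<prec> succ_iter (drop i xs)))
    = scale ((- 1) ^ (length xs - i)) (brace_term xs z i)"
    by (simp only: Let_def)
qed

text \<open>As \<open>t\<close> is non-empty, \<open>z\<close> stays in the right tensor factor. The
  left one receives a contiguous segment of \<open>xs\<close> around the position \<open>i\<close>: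
  what lies before \<open>i\<close> enters through \<open>om\<close>, what lies after through
  \<open>om'\<close>.\<close>

lemma cop_brace_term:
  assumes xs: "set xs \<subseteq> Prim" and z: "z \<in> Prim" and i: "i \<le> length xs"
    and st: "packed_word s" "packed_word t" "t \<noteq> []"
  shows "cop all_cuts (brace_term xs z i) s t = (\<Sum>j\<le>i. \<Sum>k\<le>length xs - i.
     cf (mul (om (drop j (take i xs))) (om' (take k (drop i xs)))) s
     * cf ((om (take j (take i xs)) \<succ>\<succ> z) \<prec>\<prec> om' (drop k (drop i xs))) t)"
proof -
  have sub: "set (take k xs) \<subseteq> Prim" "set (drop k xs) \<subseteq> Prim" for k
    using xs by (simp_all add: set_take_subsetI set_drop_subsetI)
  have Pp: "Prim \<subseteq> (WQSym_plus :: 'a wqsym set)" using Prim_plus by blast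
  have pk: "om (take j (take i xs)) \<in> packed_span" "om (drop j (take i xs)) \<in> packed_span"
    "om' (take k (drop i xs)) \<in> packed_span" "om' (drop k (drop i xs)) \<in> packed_span" for j k
    using sub Pp by (intro om_packed_span om'_packed_span; metis order_trans set_take_subsetI set_drop_subsetI)+
  have zP: "z \<in> packed_span" using z Prim_plus WQSym_plus_packed_span by blast
  have pk': "om (take j xs) \<succ>\<succ> z \<in> packed_span" for j
    using sub(1) Pp zP by (intro succ_packed_span om_packed_span) auto
  have a: "om (take i xs) \<in> packed_span" "om' (drop i xs) \<in> packed_span"
    using sub Pp by (intro om_packed_span om'_packed_span; metis order_trans)+
  show ?thesis
    unfolding brace_term_def
  proof (rule cop_prec_tensor[where f = "\<lambda>j. om (drop j (take i xs))" and J = "{..i}"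
      and g = "\<lambda>j. om (take j (take i xs)) \<succ>\<succ> z" and K = "{..length xs - i}"
      and f' = "\<lambda>k. om' (take k (drop i xs))" and g' = "\<lambda>k. om' (drop k (drop i xs))"])
    fix s t :: "nat list" assume "packed_word s" "packed_word t" "t \<noteq> []"
    moreover have "cop all_cuts (om (take i xs)) s t
        = (\<Sum>j\<le>i. cf (om (drop j (take i xs))) s * cf (om (take j (take i xs))) t)"
      if "packed_word s" "packed_word t" for s t
      using cop_om[OF sub(1) that, of i] i by (simp add: min_absorb2)
    ultimately show "cop all_cuts (om (take i xs) \<succ>\<succ> z) s t
        = (\<Sum>j\<le>i. cf (om (drop j (take i xs))) s * cf (om (take j (take i xs)) \<succ>\<succ> z) t)"
      by (intro cop_succ_prim z a(1) pk(1))
  next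
    fix s t :: "nat list" assume "packed_word s" "packed_word t"
    then show "cop all_cuts (om' (drop i xs)) s t
        = (\<Sum>k\<le>length xs - i. cf (om' (take k (drop i xs))) s * cf (om' (drop k (drop i xs))) t)"
      using cop_om'[OF sub(2), of s t i] by simp
  qed (use st pk pk' a in \<open>simp_all add: min_absorb1\<close>)
qed

lemma sum_triangle_simple:
  "(\<Sum>m\<le>(M::nat). \<Sum>k\<le>m. f k m) = (\<Sum>k\<le>M. \<Sum>r\<le>M - k. f k (k + r))"
  using sum_triangle[of M "\<lambda>_. True" "\<lambda>_ _. True" "\<lambda>_. True" "\<lambda>_ _. True" f]
  by (simp add: atMost_def)

text \<open>For a fixed segment on the left, the right tensor factor does not depend on where the
  segment is split between \<open>om\<close> and \<open>om'\<close>. The alternating sum over the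
  split points is an \<open>antipode_sum\<close>, which is a multiple of \<open>R []\<close> and so
  has coefficient zero at the non-empty \<open>s\<close>.\<close>

lemma Prim_brace:
  assumes xs: "set xs \<subseteq> Prim" "xs \<noteq> []" and z: "z \<in> Prim"
  shows "brace xs z \<in> Prim"
  unfolding Prim_iff
proof (intro conjI allI impI)
  let ?g = "length xs"
  have xsp: "set xs \<subseteq> WQSym_plus" using xs Prim_plus by blast
  have zp: "z \<in> WQSym_plus" using z Prim_plus by blast
  have term_plus: "brace_term xs z i \<in> WQSym_plus" for i
    using xsp zp unfolding brace_term_def by (simp add: WQSym_plus_iff set_take_subsetI set_drop_subsetI)
  show "brace xs z \<in> WQSym_plus"
    using term_plus unfolding brace_eq[OF xsp xs(2) zp] WQSym_plus_iff
    by (simp add: packed_span_sum lookup_sum WQSym_plus_packed_span WQSym_plus_Nil)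
  fix s t :: "nat list" assume st: "packed_word s" "packed_word t" "s \<noteq> []" "t \<noteq> []"
  \<comment> \<open>The segment \<open>ys j l\<close> starts after \<open>j\<close> entries and has
    length \<open>l\<close>; \<open>T j l\<close> is the coefficient of the matching right tensor
    factor. In \<open>H j i k\<close> the first \<open>i\<close> entries of the segment go into
    \<open>om\<close> and the other \<open>k\<close> into \<open>om'\<close>.\<close>
  define ys where "ys j l = take l (drop j xs)" for j l
  define T where "T j l = cf ((om (take j xs) \<succ>\<succ> z) \<prec>\<prec> om' (drop (j + l) xs)) t" for j l
  define H where "H j i k = (- 1) ^ (?g - (j + i))
      * cf (mul (om (take i (drop j xs))) (om' (take k (drop (j + i) xs)))) s * T j (i + k)" for j i k
  have "cop all_cuts (brace xs z) s t
      = (\<Sum>i\<le>?g. \<Sum>j\<le>i. \<Sum>k\<le>?g - i. H j (i - j) k)"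
    unfolding brace_eq[OF xsp xs(2) zp] cop_sum cop_scale
  proof (intro sum.cong refl)
    fix i assume i: "i \<in> {..?g}"
    have "(- 1) ^ (?g - i) * cop all_cuts (brace_term xs z i) s t = (\<Sum>j\<le>i. \<Sum>k\<le>?g - i.
       (- 1) ^ (?g - i) * (cf (mul (om (drop j (take i xs))) (om' (take k (drop i xs)))) s
       * cf ((om (take j (take i xs)) \<succ>\<succ> z) \<prec>\<prec> om' (drop k (drop i xs))) t))"
      using i by (subst cop_brace_term[OF xs(1) z _ st(1,2,4)]) (simp_all add: sum_distrib_left)
    also have "\<dots> = (\<Sum>j\<le>i. \<Sum>k\<le>?g - i. H j (i - j) k)"
    proof (intro sum.cong refl)
      fix j k assume "j \<in> {..i}"
      then show "(- 1) ^ (?g - i) * (cf (mul (om (drop j (take i xs))) (om' (take k (drop i xs)))) s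
       * cf ((om (take j (take i xs)) \<succ>\<succ> z) \<prec>\<prec> om' (drop k (drop i xs))) t) = H j (i - j) k"
        by (simp add: H_def T_def drop_take min_absorb1 add.commute)
    qed
    finally show "(- 1) ^ (?g - i) * cop all_cuts (brace_term xs z i) s t
        = (\<Sum>j\<le>i. \<Sum>k\<le>?g - i. H j (i - j) k)" .
  qed
  \<comment> \<open>Two changes of summation order: first the start \<open>j\<close> of the segment
    moves outside, then its length \<open>l = i + k\<close>.\<close>
  also have "\<dots> = (\<Sum>j\<le>?g. \<Sum>i\<le>?g - j. \<Sum>k\<le>?g - j - i. H j i k)"
    by (subst sum_triangle_simple) simp
  also have "\<dots> = (\<Sum>j\<le>?g. \<Sum>l\<le>?g - j. \<Sum>i\<le>l. H j i (l - i))"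
    by (subst sum_triangle_simple) simp
  also have "\<dots> = 0"
  proof (rule sum.neutral, rule ballI, rule sum.neutral, rule ballI)
    fix j l assume j: "j \<in> {..?g}" and l: "l \<in> {..?g - j}"
    have len: "length (ys j l) = l" using j l by (simp add: ys_def)
    have sub: "set (ys j l) \<subseteq> WQSym_plus" using xsp by (simp add: ys_def set_take_subsetI set_drop_subsetI)
    have "H j i (l - i) = (- 1) ^ (?g - j) * T j l
        * cf (scale ((- 1) ^ i) (mul (om (take i (ys j l))) (om' (drop i (ys j l))))) s" if "i \<le> l" for i
    proof -
      have "(- 1 :: 'a) ^ (?g - (j + i)) = (- 1) ^ (?g - j) * (- 1) ^ i"
      proof -
        have "?g - j = (?g - (j + i)) + i" using that j l by simp
        then have "(- 1 :: 'a) ^ (?g - j) * (- 1) ^ i = (- 1) ^ (?g - (j + i)) * ((- 1) ^ i * (- 1) ^ i)"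
          by (simp only: power_add mult.assoc)
        then show ?thesis by (simp flip: power_mult_distrib)
      qed
      then show ?thesis
        using that by (simp add: H_def ys_def drop_take min_absorb1 add.commute mult_ac)
    qed
    then have "(\<Sum>i\<le>l. H j i (l - i)) = (- 1) ^ (?g - j) * T j l * cf (antipode_sum (ys j l)) s"
      by (simp add: antipode_sum_def len lookup_sum sum_distrib_left)
    also have "\<dots> = 0" using st(3) by (simp add: antipode_sum_eq[OF sub] cf_R)
    finally show "(\<Sum>i\<le>l. H j i (l - i)) = 0" .
  qed
  finally show "cop all_cuts (brace xs z) s t = 0" .
qed

text \<open>A nonzero term needs all of \<open>z\<close>, of degree \<open>d\<close>, inside the
  right word. As \<open>t\<close> has at most \<open>d\<close> letters, no letter of
  \<open>c\<close> is left there, so the largest letter cannot lie on the right.\<close>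

lemma cop_max_right_prec_low:
  assumes z: "z \<in> Prim" "z \<in> WQSym d" and c: "c \<in> WQSym_plus"
    and st: "packed_word s" "packed_word t" "t \<noteq> []" "length t \<le> d"
  shows "cop max_right (z \<prec>\<prec> c) s t = 0"
proof -
  have P: "z \<in> packed_span" "c \<in> packed_span" "cf c [] = 0" using z c WQSym_packed_span WQSym_plus_packed_span WQSym_plus_Nil by blast+
  show ?thesis
    unfolding cop_max_right_prec[OF P(1,2) st(1-3) P(3)]
  proof (intro sum.neutral ballI)
    fix a b assume a: "a \<in> {..max_letter s}" and b: "b \<in> {b. b \<le> max_letter t \<and> last t \<le> b}"
    have "cop all_cuts z (lo a s) (lo b t) = (if lo a s = [] then cf z (lo b t) else 0)"
      using a b st z by (simp add: cop_Prim lo_ne)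
    moreover have "cf z (lo b t) = 0 \<or> hi b t = []"
      using WQSymD[OF z(2), of "lo b t"] st(4) length_lo_hi[of b t] by (cases "hi b t") auto
    ultimately show "cop all_cuts z (lo a s) (lo b t) * cop max_right c (hi a s) (hi b t) = 0"
      by (auto simp: cop_max_right_Nil)
  qed
qed

text \<open>For \<open>i < length xs\<close> the largest letter comes from the factor
  \<open>om'\<close> after \<open>z\<close>; having it on the right together with \<open>z\<close>
  needs a right degree above \<open>d\<close>. What remains is
  \<open>om xs \<succ>\<succ> z\<close>, in which \<open>z\<close> fills \<open>t\<close>.\<close>

lemma cop_max_right_brace:
  assumes xs: "set xs \<subseteq> Prim" "xs \<noteq> []" and z: "z \<in> TPrim" "z \<in> WQSym d"
    and st: "packed_word s" "packed_word t" "t \<noteq> []" "length t \<le> d"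
  shows "cop max_right (brace xs z) s t = cf (om xs) s * cf z t"
proof -
  let ?g = "length xs"
  have xsp: "set xs \<subseteq> WQSym_plus" using xs Prim_plus by blast
  have zp: "z \<in> WQSym_plus" "z \<in> Prim" using z TPrim_plus TPrim_Prim by blast+
  have zP: "z \<in> packed_span" using zp WQSym_plus_packed_span by blast
  have low: "cop max_right (brace_term xs z i) s t = 0" if i: "i < ?g" for i
  proof -
    have c: "om' (drop i xs) \<in> WQSym_plus"
      using i xsp by (intro om'_WQSym_plus) (simp_all add: set_drop_subsetI)
    have a: "om (take i xs) \<in> packed_span" using xsp by (simp add: set_take_subsetI)
    \<comment> \<open>With this bracketing \<open>half_succ\<close> is the outer operation, so the
      side of the largest letter is decided in the inner product, to which
      \<open>cop_max_right_prec_low\<close> applies.\<close>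
    have eq: "brace_term xs z i = om (take i xs) \<succ>\<succ> (z \<prec>\<prec> om' (drop i xs))"
      unfolding brace_term_def by (rule succ_prec) (use a zP c WQSym_plus_packed_span in auto)
    have "z \<prec>\<prec> om' (drop i xs) \<in> packed_span" using zP WQSym_plus_packed_span[OF c] by simp
    note cop = cop_max_right_succ[OF a this st(1-3)]
    show ?thesis unfolding eq cop
    proof (intro sum.neutral ballI)
      fix k b assume k: "k \<in> {..max_letter s}" and b: "b \<in> {b. b \<le> max_letter t \<and> b < last t}"
      have "cop max_right (z \<prec>\<prec> om' (drop i xs)) (hi k s) (hi b t) = 0"
        by (rule cop_max_right_prec_low[OF zp(2) z(2) c])
          (use k b st length_lo_hi[of b t] in \<open>auto simp: hi_ne\<close>)
      then show "cop all_cuts (om (take i xs)) (lo k s) (lo b t)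
          * cop max_right (z \<prec>\<prec> om' (drop i xs)) (hi k s) (hi b t) = 0" by simp
    qed
  qed
  have "om xs \<succ>\<succ> z \<in> WQSym_plus" using xsp zP by (simp add: WQSym_plus_iff)
  then have top: "brace_term xs z ?g = om xs \<succ>\<succ> z"
    by (simp add: brace_term_def prec_unit_right)
  have "cop max_right (brace xs z) s t
      = (\<Sum>i\<le>?g. (- 1) ^ (?g - i) * cop max_right (brace_term xs z i) s t)"
    unfolding brace_eq[OF xsp xs(2) zp(1)] cop_sum cop_scale ..
  also have "\<dots> = (\<Sum>i\<le>?g. if i = ?g then cop max_right (om xs \<succ>\<succ> z) s t else 0)"
    by (intro sum.cong refl) (auto simp: low top)
  also have "\<dots> = cop max_right (om xs \<succ>\<succ> z) s t" by simp
  also have "\<dots> = (\<Sum>a\<le>max_letter s. \<Sum>b | b \<le> max_letter t \<and> b < last t.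
      cop all_cuts (om xs) (lo a s) (lo b t) * cop max_right z (hi a s) (hi b t))"
    by (rule cop_max_right_succ) (use xsp zP st in auto)
  \<comment> \<open>The degree bound on \<open>t\<close> forces \<open>b = 0\<close>, and total
    primitivity of \<open>z\<close> forces \<open>a = max_letter s\<close>.\<close>
  also have "\<dots> = (\<Sum>a\<le>max_letter s. \<Sum>b | b \<le> max_letter t \<and> b < last t.
      if b = 0 then (if a = max_letter s then cf (om xs) s * cf z t else 0) else 0)"
  proof (intro sum.cong refl)
    fix a b assume a: "a \<in> {..max_letter s}" and b: "b \<in> {b. b \<le> max_letter t \<and> b < last t}"
    have r: "cop max_right z (hi a s) (hi b t) = (if a = max_letter s then cf z (hi b t) else 0)"
      using a b st z by (simp add: cop_max_right_TPrim hi_ne hi_eq_Nil)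
    have "cf z (hi b t) = 0" if "b \<noteq> 0"
    proof -
      have "lo b t \<noteq> []" using that b st by (simp add: lo_eq_Nil)
      then have "length (hi b t) \<noteq> d" using length_lo_hi[of b t] st(4) by (cases "lo b t") auto
      then show ?thesis using WQSymD[OF z(2)] by blast
    qed
    moreover have "lo 0 t = []" using st by (simp add: lo_eq_Nil)
    ultimately show "cop all_cuts (om xs) (lo a s) (lo b t) * cop max_right z (hi a s) (hi b t)
      = (if b = 0 then (if a = max_letter s then cf (om xs) s * cf z t else 0) else 0)"
      using st by (auto simp: r cop_Nil_right)
  qed
  also have "\<dots> = cf (om xs) s * cf z t"
    using last_letter_bounds[OF st(2,3)] by (simp add: sum.delta)
  finally show ?thesis .
qed


section \<open>Bases indexed by finite sets\<close>

lemma is_basis_indep: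
  assumes "is_basis b I V" "finite I" "(\<Sum>i\<in>I. scale (c i) (b i)) = 0" "i \<in> I"
  shows "c i = 0"
proof -
  have inj: "inj_on b I" and ind: "free.independent (b ` I)" using assms(1) by (auto simp: is_basis_def)
  have "(\<Sum>v\<in>b ` I. scale (c (the_inv_into I b v)) v) = 0"
    using assms(3) by (simp add: sum.reindex[OF inj] the_inv_into_f_f[OF inj] cong: sum.cong_simp)
  then have "free.dependent (b ` I)" if "c i \<noteq> 0"
    unfolding free.dependent_finite[OF finite_imageI[OF assms(2)]]
    by (intro exI[of _ "\<lambda>v. c (the_inv_into I b v)"] conjI bexI[of _ "b i"])
      (simp_all only: the_inv_into_f_f[OF inj assms(4)] that imageI[OF assms(4)] not_False_eq_True)
  then show ?thesis using ind by blast
qed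

lemma is_basis_repr:
  assumes "is_basis b I V" "finite I" "x \<in> V"
  shows "\<exists>c. x = (\<Sum>i\<in>I. scale (c i) (b i))"
proof -
  have inj: "inj_on b I" and "x \<in> free.span (b ` I)" using assms by (auto simp: is_basis_def)
  then obtain u where "x = (\<Sum>v\<in>b ` I. scale (u v) v)"
    using free.span_finite[of "b ` I"] assms(2) by auto
  then have "x = (\<Sum>i\<in>I. scale (u (b i)) (b i))" by (simp add: sum.reindex[OF inj])
  then show ?thesis by (rule exI[of _ "\<lambda>i. u (b i)"])
qed

lemma is_basis_mem: "is_basis b I V \<Longrightarrow> i \<in> I \<Longrightarrow> b i \<in> V"
  by (auto simp: is_basis_def intro: free.span_base)

lemma is_basis_subspace: "is_basis b I V \<Longrightarrow> free.subspace V"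
  by (auto simp: is_basis_def)

lemma is_basisI:
  assumes fin: "finite I" and V: "free.subspace V" "\<And>i. i \<in> I \<Longrightarrow> b i \<in> V"
    and ind: "\<And>c i. (\<Sum>i\<in>I. scale (c i) (b i)) = 0 \<Longrightarrow> i \<in> I \<Longrightarrow> c i = 0"
    and repr: "\<And>x. x \<in> V \<Longrightarrow> \<exists>c. x = (\<Sum>i\<in>I. scale (c i) (b i))"
  shows "is_basis b I V"
proof -
  have inj: "inj_on b I"
  proof (rule inj_onI, rule ccontr)
    fix i j assume ij: "i \<in> I" "j \<in> I" "b i = b j" "i \<noteq> j"
    let ?c = "\<lambda>k. if k = i then 1 else if k = j then - 1 else 0"
    have "(\<Sum>k\<in>I. scale (?c k) (b k)) = (\<Sum>k\<in>{i, j}. scale (?c k) (b k))"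
      using fin ij by (intro sum.mono_neutral_right) auto
    also have "\<dots> = 0" using ij by simp
    finally show False using ind[OF _ ij(1)] by fastforce
  qed
  moreover have "free.independent (b ` I)"
  proof
    assume "free.dependent (b ` I)"
    then obtain u v where u: "v \<in> b ` I" "u v \<noteq> 0" "(\<Sum>v\<in>b ` I. scale (u v) v) = 0"
      using free.dependent_finite[of "b ` I"] fin by auto
    then have "(\<Sum>i\<in>I. scale (u (b i)) (b i)) = 0" by (simp add: sum.reindex[OF inj])
    then show False using ind[of "\<lambda>i. u (b i)"] u by auto
  qed
  moreover have "free.span (b ` I) = V"
  proof
    show "free.span (b ` I) \<subseteq> V" using V by (intro free.span_minimal) auto
    show "V \<subseteq> free.span (b ` I)"
    proof
      fix x assume "x \<in> V"
      then obtain c where "x = (\<Sum>i\<in>I. scale (c i) (b i))" using repr by blast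
      then show "x \<in> free.span (b ` I)"
        by (simp only:) (rule free.span_sum, rule free.span_scale, rule free.span_base, rule imageI)
    qed
  qed
  ultimately show ?thesis by (simp add: is_basis_def)
qed

lemma is_basis_reindex:
  assumes "is_basis b I V" "bij_betw h J I" "\<And>j. j \<in> J \<Longrightarrow> b' j = b (h j)"
  shows "is_basis b' J V"
proof -
  have im: "b' ` J = b ` I" using assms(2,3) by (auto simp: bij_betw_def image_iff)
  have "inj_on b' J"
    using assms comp_inj_on[of h J b]
    by (auto simp: bij_betw_def is_basis_def inj_on_def)
  then show ?thesis using assms(1) im by (simp add: is_basis_def)
qed

text \<open>Independence of the tensors \<open>b i \<otimes> b' j\<close>: at each fixed
  \<open>t\<close> the independence of \<open>b\<close> applies, and then that of
  \<open>b'\<close>.\<close>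

lemma bilinear_indep:
  assumes b: "is_basis b I V" "finite I" and b': "is_basis b' J W" "finite J"
    and zero: "\<And>s t. (\<Sum>i\<in>I. \<Sum>j\<in>J. c i j * (cf (b i) s * cf (b' j) t)) = 0"
    and ij: "i \<in> I" "j \<in> J"
  shows "c i j = (0::'k::field)"
proof -
  have "(\<Sum>j\<in>J. c i j * cf (b' j) t) = 0" for t
  proof (rule is_basis_indep[OF b _ ij(1)])
    show "(\<Sum>i\<in>I. scale (\<Sum>j\<in>J. c i j * cf (b' j) t) (b i)) = 0"
    proof (rule poly_mapping_eqI)
      fix s
      have "(\<Sum>i\<in>I. (\<Sum>j\<in>J. c i j * cf (b' j) t) * cf (b i) s) = 0"
        using zero[of s t] by (simp add: sum_distrib_left sum_distrib_right mult_ac)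
      then show "cf (\<Sum>i\<in>I. scale (\<Sum>j\<in>J. c i j * cf (b' j) t) (b i)) s = cf 0 s"
        by (simp add: lookup_sum)
    qed
  qed
  then have "(\<Sum>j\<in>J. scale (c i j) (b' j)) = 0"
    by (intro poly_mapping_eqI) (simp add: lookup_sum)
  then show ?thesis by (rule is_basis_indep[OF b' _ ij(2)])
qed

lemma finite_PW [simp]: "finite (PW n)"
proof (rule finite_subset)
  show "PW n \<subseteq> {w. set w \<subseteq> {..n} \<and> length w = n}"
  proof
    fix w assume w: "w \<in> PW n"
    then have "card {1..max_letter w} \<le> n"
      using packed_word_set[of w] card_length[of w] by (auto simp: PW_def)
    then show "w \<in> {w. set w \<subseteq> {..n} \<and> length w = n}"
      using w packed_word_set[of w] by (auto simp: PW_def)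
  qed
qed (simp add: finite_lists_length_eq)

definition of_fun :: "nat \<Rightarrow> (nat list \<Rightarrow> 'k) \<Rightarrow> 'k::field wqsym" where
  "of_fun n f = (\<Sum>w\<in>PW n. scale (f w) (R w))"

lemma cf_of_fun: "cf (of_fun n f) w = (if w \<in> PW n then f w else 0)"
  by (simp add: of_fun_def lookup_sum cf_R if_distrib[of "\<lambda>x. _ * x"] sum.delta' cong: if_cong)

lemma of_fun_WQSym: "of_fun n f \<in> WQSym n"
  by (auto simp: WQSym_def in_keys_iff cf_of_fun split: if_splits)

text \<open>Every column \<open>D _ t\<close> is expanded in \<open>b\<close>. By independence the
  coefficients vanish for \<open>t\<close> outside \<open>PW m\<close>, so as functions of
  \<open>t\<close> they are elements of \<open>WQSym m\<close> and can be expanded in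
  \<open>b'\<close>.\<close>

lemma tensor_repr:
  fixes D :: "nat list \<Rightarrow> nat list \<Rightarrow> 'k::field"
  assumes b: "is_basis b I V" "finite I" and b': "is_basis b' J (WQSym m)" "finite J"
    and D: "\<And>t. \<exists>v\<in>V. \<forall>s. cf v s = D s t" "\<And>s t. t \<notin> PW m \<Longrightarrow> D s t = 0"
  shows "\<exists>c. \<forall>s t. D s t = (\<Sum>i\<in>I. \<Sum>j\<in>J. c i j * (cf (b i) s * cf (b' j) t))"
proof -
  have "\<exists>a. \<forall>s. D s t = (\<Sum>i\<in>I. a i * cf (b i) s)" for t
  proof -
    obtain v where v: "v \<in> V" "\<forall>s. cf v s = D s t" using D(1)[of t] by blast
    obtain a where "v = (\<Sum>i\<in>I. scale (a i) (b i))" using is_basis_repr[OF b v(1)] by blast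
    then have "\<forall>s. D s t = (\<Sum>i\<in>I. a i * cf (b i) s)" using v(2) by (simp add: lookup_sum)
    then show ?thesis by (rule exI[of _ a])
  qed
  then obtain a where a: "D s t = (\<Sum>i\<in>I. a t i * cf (b i) s)" for s t by metis
  have a0: "a t i = 0" if "t \<notin> PW m" "i \<in> I" for t i
  proof (rule is_basis_indep[OF b _ that(2)])
    show "(\<Sum>i\<in>I. scale (a t i) (b i)) = 0"
      by (rule poly_mapping_eqI) (simp add: lookup_sum a[symmetric] D(2) that)
  qed
  have "\<exists>c. \<forall>t. a t i = (\<Sum>j\<in>J. c j * cf (b' j) t)" if "i \<in> I" for i
  proof -
    obtain c where "of_fun m (\<lambda>t. a t i) = (\<Sum>j\<in>J. scale (c j) (b' j))"
      using is_basis_repr[OF b' of_fun_WQSym] by blast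
    then have "cf (of_fun m (\<lambda>t. a t i)) t = (\<Sum>j\<in>J. c j * cf (b' j) t)" for t
      by (simp add: lookup_sum)
    then show ?thesis using a0[OF _ that] unfolding cf_of_fun by metis
  qed
  then obtain c where c: "a t i = (\<Sum>j\<in>J. c i j * cf (b' j) t)" if "i \<in> I" for i t by metis
  have "D s t = (\<Sum>i\<in>I. \<Sum>j\<in>J. c i j * (cf (b i) s * cf (b' j) t))" for s t
    unfolding a by (intro sum.cong refl) (simp add: c sum_distrib_left sum_distrib_right mult_ac)
  then show ?thesis by blast
qed

text \<open>\<open>D x s t\<close> is the coefficient at \<open>R s \<otimes> R t\<close> of a linear map from \<open>U\<close> to \<open>V \<otimes> WQSym m\<close>.\<close>

lemma basis_step:
  fixes D :: "'k::field wqsym \<Rightarrow> nat list \<Rightarrow> nat list \<Rightarrow> 'k" and P :: "'i \<Rightarrow> 'k wqsym"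
  assumes ker: "is_basis P S {x \<in> U. \<forall>s t. D x s t = 0}" "finite S"
    and b: "is_basis b I V" "finite I" and b': "is_basis b' J (WQSym m)" "finite J"
    and U: "free.subspace U"
    and lin: "\<And>x y s t. D (x + y) s t = D x s t + D y s t"
      "\<And>a x s t. D (scale a x) s t = a * D x s t"
    and D: "\<And>x t. x \<in> U \<Longrightarrow> \<exists>v\<in>V. \<forall>s. cf v s = D x s t"
      "\<And>x s t. x \<in> U \<Longrightarrow> t \<notin> PW m \<Longrightarrow> D x s t = 0"
    and \<iota>: "bij_betw \<iota> (I \<times> J) E" "S \<inter> E = {}"
    and P: "\<And>i j. i \<in> I \<Longrightarrow> j \<in> J \<Longrightarrow> P (\<iota> (i, j)) \<in> U"
      "\<And>i j s t. i \<in> I \<Longrightarrow> j \<in> J \<Longrightarrow> D (P (\<iota> (i, j))) s t = cf (b i) s * cf (b' j) t"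
  shows "is_basis P (S \<union> E) U"
proof (rule is_basisI)
  have finE: "finite E" using bij_betw_finite[OF \<iota>(1)] b(2) b'(2) by simp
  have sum_E: "(\<Sum>e\<in>E. f e) = (\<Sum>i\<in>I. \<Sum>j\<in>J. f (\<iota> (i, j)))" for f :: "'i \<Rightarrow> 'k"
    using sum.reindex_bij_betw[OF \<iota>(1), of f] by (simp add: sum.cartesian_product case_prod_beta)
  have D0: "D 0 s t = 0" for s t using lin(2)[of 0 0 s t] by simp
  have D_sum: "D (\<Sum>a\<in>A. f a) s t = (\<Sum>a\<in>A. D (f a) s t)" for f :: "'i \<Rightarrow> _" and A s t
    by (induction A rule: infinite_finite_induct) (simp_all add: D0 lin)
  have PE: "P e \<in> U" if "e \<in> E" for e
    using that \<iota>(1) P(1) by (auto simp: bij_betw_def)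
  show "finite (S \<union> E)" using ker(2) finE by simp
  show "free.subspace U" by (rule U)
  show "P k \<in> U" if "k \<in> S \<union> E" for k
    using that is_basis_mem[OF ker(1)] PE by auto
  show "c k = 0" if c: "(\<Sum>k\<in>S \<union> E. scale (c k) (P k)) = 0" and k: "k \<in> S \<union> E" for c k
  proof -
    have split: "(\<Sum>k\<in>S. scale (c k) (P k)) + (\<Sum>k\<in>E. scale (c k) (P k)) = 0"
      using c sum.union_disjoint[OF ker(2) finE \<iota>(2), of "\<lambda>k. scale (c k) (P k)"] by simp
    \<comment> \<open>Applying \<open>D\<close> kills the part in the kernel and maps the elements
      indexed by \<open>E\<close> to independent tensors.\<close>
    have E0: "c (\<iota> (i, j)) = 0" if ij: "i \<in> I" "j \<in> J" for i j
    proof (rule bilinear_indep[OF b b' _ ij, of "\<lambda>i j. c (\<iota> (i, j))"])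
      fix s t
      have "D (\<Sum>k\<in>S. scale (c k) (P k)) s t = 0"
        using is_basis_mem[OF ker(1)] by (simp add: D_sum lin)
      then have "D (\<Sum>k\<in>E. scale (c k) (P k)) s t = 0"
        using arg_cong[OF split, of "\<lambda>x. D x s t"] by (simp add: lin D0)
      then show "(\<Sum>i\<in>I. \<Sum>j\<in>J. c (\<iota> (i, j)) * (cf (b i) s * cf (b' j) t)) = 0"
        by (simp add: sum_E D_sum lin P(2))
    qed
    then have E0': "c e = 0" if "e \<in> E" for e
      using that \<iota>(1) by (auto simp: bij_betw_def)
    then have "(\<Sum>k\<in>S. scale (c k) (P k)) = 0" using split by simp
    then show "c k = 0" using is_basis_indep[OF ker, of c k] E0' k by blast
  qed
  show "\<exists>c. x = (\<Sum>k\<in>S \<union> E. scale (c k) (P k))" if x: "x \<in> U" for x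
  proof -
    have "\<exists>c. \<forall>s t. D x s t = (\<Sum>i\<in>I. \<Sum>j\<in>J. c i j * (cf (b i) s * cf (b' j) t))"
      by (rule tensor_repr[OF b b' D(1)[OF x]]) (rule D(2)[OF x])
    then obtain c where c: "\<forall>s t. D x s t = (\<Sum>i\<in>I. \<Sum>j\<in>J. c i j * (cf (b i) s * cf (b' j) t))" ..
    define c' where "c' e = case_prod c (the_inv_into (I \<times> J) \<iota> e)" for e
    have c': "c' (\<iota> (i, j)) = c i j" if "i \<in> I" "j \<in> J" for i j
      using that \<iota>(1) by (simp add: c'_def bij_betw_def the_inv_into_f_f)
    \<comment> \<open>\<open>y\<close> has the same image under \<open>D\<close> as
      \<open>x\<close>, so \<open>x - y\<close> lies in the kernel and is expanded over
      \<open>S\<close>.\<close>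
    define y where "y = (\<Sum>e\<in>E. scale (c' e) (P e))"
    have yU: "y \<in> U" unfolding y_def
      by (intro free.subspace_sum[OF U] free.subspace_scale[OF U] PE)
    have "D y s t = D x s t" for s t
      unfolding y_def c[rule_format] D_sum lin sum_E by (intro sum.cong refl) (simp add: c' P(2))
    moreover have "D (x - y) s t = D x s t - D y s t" for s t
      using lin(1)[of "x - y" y s t] by simp
    ultimately have "x - y \<in> {x \<in> U. \<forall>s t. D x s t = 0}"
      using free.subspace_diff[OF U x yU] by simp
    then obtain a where a: "x - y = (\<Sum>k\<in>S. scale (a k) (P k))"
      using is_basis_repr[OF ker] by blast
    have "(\<Sum>k\<in>S \<union> E. scale (if k \<in> S then a k else c' k) (P k))
        = (\<Sum>k\<in>S. scale (a k) (P k)) + (\<Sum>k\<in>E. scale (c' k) (P k))"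
      unfolding sum.union_disjoint[OF ker(2) finE \<iota>(2)]
      using \<iota>(2) by (intro arg_cong2[of _ _ _ _ "(+)"] sum.cong refl) auto
    also have "\<dots> = x" using a by (simp add: y_def algebra_simps)
    finally show ?thesis by (intro exI[of _ "\<lambda>k. if k \<in> S then a k else c' k"]) simp
  qed
qed

lemma subspace_WQSym: "free.subspace (WQSym n)"
proof -
  have "WQSym n = {x :: 'a wqsym. \<forall>w. w \<notin> PW n \<longrightarrow> cf x w = 0}"
    by (auto simp: WQSym_def in_keys_iff)
  then show ?thesis by (simp add: free.subspace_def lookup_add)
qed

lemma subspace_Prim_hom: "free.subspace (Prim_hom n)"
  using free.subspace_0[OF subspace_WQSym[of n]] free.subspace_add[OF subspace_WQSym[of n]]
    free.subspace_scale[OF subspace_WQSym[of n]]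
  unfolding free.subspace_def
  by (auto simp: Prim_hom_def Prim_iff WQSym_plus_iff cop_add cop_scale lookup_add)

lemma subspace_TPrim_hom: "free.subspace (TPrim_hom n)"
  using free.subspace_0[OF subspace_WQSym[of n]] free.subspace_add[OF subspace_WQSym[of n]]
    free.subspace_scale[OF subspace_WQSym[of n]]
  unfolding free.subspace_def
  by (auto simp: TPrim_hom_def TPrim_iff WQSym_plus_iff cop_add cop_scale lookup_add)

lemma WQSym_plusI: "x \<in> WQSym n \<Longrightarrow> n > 0 \<Longrightarrow> x \<in> WQSym_plus"
  using WQSymD[of x n "[]"] by (simp add: WQSym_plus_iff WQSym_packed_span)


section \<open>Inserting maximal letters\<close>

definition max_positions :: "nat list \<Rightarrow> nat set" where
  "max_positions v = {i \<in> {1..length v}. v ! (i - 1) = max_letter v}"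

definition del_max :: "nat list \<Rightarrow> nat list" where
  "del_max v = filter (\<lambda>c. c \<noteq> max_letter v) v"

lemma filter_nth_length:
  "k < length v \<Longrightarrow> P (v ! k) \<Longrightarrow> filter P v ! length (filter P (take k v)) = v ! k"
  by (induction v arbitrary: k) (auto simp: nth_Cons' take_Cons')

lemma length_filter_take:
  "k \<le> length v \<Longrightarrow> length (filter (\<lambda>c. c \<noteq> M) (take k v)) = k - card {i \<in> {1..k}. v ! (i - 1) = M}"
proof (induction k)
  case (Suc k)
  have "{i \<in> {1..Suc k}. v ! (i - 1) = M} = {i \<in> {1..k}. v ! (i - 1) = M} \<union> (if v ! k = M then {Suc k} else {})"
    by (auto simp: le_Suc_eq)
  moreover have "card {i \<in> {1..k}. v ! (i - 1) = M} \<le> card {1..k}" by (rule card_mono) auto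
  ultimately show ?case using Suc by (auto simp: take_Suc_conv_app_nth card_insert_if)
qed simp

lemma set_del_max: "packed_word v \<Longrightarrow> v \<noteq> [] \<Longrightarrow> set (del_max v) = {1..max_letter v - 1}"
  using packed_word_set[of v] packed_max_letter_0[of v] by (auto simp: del_max_def)

lemma packed_del_max: "packed_word v \<Longrightarrow> v \<noteq> [] \<Longrightarrow> packed_word (del_max v)"
  and max_letter_del_max: "packed_word v \<Longrightarrow> v \<noteq> [] \<Longrightarrow> max_letter (del_max v) = max_letter v - 1"
  using set_del_max packed_wordI max_letter_eqI by blast+

lemma length_del_max: "length (del_max v) = length v - card (max_positions v)"
  using length_filter_take[of "length v" v "max_letter v"] by (simp add: del_max_def max_positions_def)

lemma card_max_positions_le: "card (max_positions v) \<le> length v"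
proof -
  have "max_positions v \<subseteq> {1..length v}" by (auto simp: max_positions_def)
  from card_mono[OF _ this] show ?thesis by simp
qed

lemma length_del_max_add: "length (del_max v) + card (max_positions v) = length v"
  using length_del_max card_max_positions_le by simp

lemma max_letter_pos: "packed_word v \<Longrightarrow> v \<noteq> [] \<Longrightarrow> max_letter v \<in> set v"
  using packed_max_letter_0[of v] by (auto simp: packed_word_set)

lemma max_positions_nonempty: "packed_word v \<Longrightarrow> v \<noteq> [] \<Longrightarrow> max_positions v \<noteq> {}"
proof -
  assume "packed_word v" "v \<noteq> []"
  then obtain k where "k < length v" "v ! k = max_letter v"
    using max_letter_pos by (metis in_set_conv_nth)
  then have "Suc k \<in> max_positions v" by (simp add: max_positions_def)
  then show ?thesis by blast
qed

lemma valid_label_facts: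
  assumes "valid_label I"
  shows "I \<noteq> []" "sorted_wrt (<) I" "distinct I" "card (set I) = length I"
    "i \<in> set I \<Longrightarrow> 1 \<le> i" "i \<in> set I \<Longrightarrow> hd I \<le> i" "i \<in> set I \<Longrightarrow> i \<le> last I"
    "hd I \<in> set I" "last I \<in> set I"
proof -
  show ne: "I \<noteq> []" and so: "sorted_wrt (<) I" using assms by (auto simp: valid_label_def)
  then show d: "distinct I" by (simp add: strict_sorted_iff)
  then show "card (set I) = length I" by (rule distinct_card)
  show "i \<in> set I \<Longrightarrow> 1 \<le> i" using assms by (metis Suc_leI neq0_conv One_nat_def valid_label_def)
  show "i \<in> set I \<Longrightarrow> hd I \<le> i" using so ne by (cases I) auto
  show "i \<in> set I \<Longrightarrow> i \<le> last I"
    using so ne by (cases I rule: rev_cases) (auto simp: sorted_wrt_append less_imp_le)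
  show "hd I \<in> set I" "last I \<in> set I" using ne by simp_all
qed

lemma valid_label_eqI: "valid_label I \<Longrightarrow> valid_label J \<Longrightarrow> set I = set J \<Longrightarrow> I = J"
  using strict_sorted_equal by (auto simp: valid_label_def)

text \<open>Together with \<open>phi_del_max\<close> this identifies the pairs \<open>(I, w)\<close>
  with the non-empty packed words: \<open>I\<close> lists the positions of the largest letter and
  \<open>w\<close> is the rest. The bound on \<open>last I\<close> ensures that all inserted
  positions exist.\<close>

lemma phi_facts:
  assumes w: "packed_word w" and I: "valid_label I" and bd: "last I \<le> length w + length I"
  shows "packed_word (phi I w)" "length (phi I w) = length w + length I"
    "max_positions (phi I w) = set I" "del_max (phi I w) = w"
proof -
  let ?n = "length w + length I" and ?M = "max_letter w + 1"
  let ?idx = "\<lambda>i. i - card {j \<in> set I. j < i} - 1"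
  let ?g = "\<lambda>i. if i \<in> set I then ?M else w ! ?idx i"
  have phi: "phi I w = map ?g [1..<Suc ?n]" by (simp add: phi_def)
  note I' = valid_label_facts[OF I]
  have sub: "set I \<subseteq> {1..?n}" using I'(5,7) bd by fastforce
  \<comment> \<open>The positions outside \<open>I\<close> number \<open>length w\<close> in total,
    which keeps the index formula of \<open>phi\<close> in range.\<close>
  have cnt: "r - card {j \<in> set I. j \<le> r} \<le> length w" if "r \<le> ?n" for r
  proof -
    have "{j \<in> set I. j \<le> r} = {1..r} \<inter> set I" using sub by auto
    then have "r - card {j \<in> set I. j \<le> r} = card ({1..r} - set I)"
      by (simp add: card_Diff_subset_Int)
    also have "\<dots> \<le> card ({1..?n} - set I)" using that by (intro card_mono) auto
    also have "\<dots> = length w" using sub by (simp add: card_Diff_subset I'(4))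
    finally show ?thesis .
  qed
  have card_le: "card {j \<in> set I. j \<le> r} \<le> r" for r
  proof -
    have "card {j \<in> set I. j \<le> r} \<le> card {1..r}" by (rule card_mono) (use I'(5) in auto)
    then show ?thesis by simp
  qed
  have step: "card {j \<in> set I. j \<le> Suc r} = card {j \<in> set I. j \<le> r} + (if Suc r \<in> set I then 1 else 0)" for r
  proof -
    have "{j \<in> set I. j \<le> Suc r} = {j \<in> set I. j \<le> r} \<union> (if Suc r \<in> set I then {Suc r} else {})"
      by (auto simp: le_Suc_eq)
    then show ?thesis by (simp add: card_insert_if)
  qed
  have idx: "?idx (Suc r) = r - card {j \<in> set I. j \<le> r}" for r
    by (simp add: less_Suc_eq_le)
  have idx_lt: "r - card {j \<in> set I. j \<le> r} < length w" if "Suc r \<le> ?n" "Suc r \<notin> set I" for r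
    using cnt[OF that(1)] step[of r] that(2) card_le[of r] by simp
  have lt: "?g i < ?M" if i: "i \<in> {1..?n}" "i \<notin> set I" for i
  proof -
    obtain r where r: "i = Suc r" using i(1) by (cases i) auto
    have "w ! ?idx i \<in> set w" using idx_lt[of r] i unfolding r idx by simp
    then show ?thesis using i packed_word_set[OF w] by auto
  qed
  \<comment> \<open>Stated for all prefixes to allow induction on their length; the full length
    shows that deleting the inserted letters gives back \<open>w\<close>.\<close>
  have filt: "filter (\<lambda>c. c \<noteq> ?M) (map ?g [1..<Suc r]) = take (r - card {j \<in> set I. j \<le> r}) w"
    if "r \<le> ?n" for r
    using that
  proof (induction r)
    case (Suc r)
    have IH: "filter (\<lambda>c. c \<noteq> ?M) (map ?g [1..<Suc r]) = take (r - card {j \<in> set I. j \<le> r}) w"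
      using Suc by simp
    have eq: "filter (\<lambda>c. c \<noteq> ?M) (map ?g [1..<Suc (Suc r)])
        = filter (\<lambda>c. c \<noteq> ?M) (map ?g [1..<Suc r]) @ (if ?g (Suc r) \<noteq> ?M then [?g (Suc r)] else [])"
      by simp
    show ?case
    proof (cases "Suc r \<in> set I")
      case True
      then show ?thesis unfolding eq IH step by simp
    next
      case False
      have k: "r - card {j \<in> set I. j \<le> r} < length w" using idx_lt Suc.prems False by blast
      have "?g (Suc r) \<noteq> ?M" using lt[of "Suc r"] False Suc.prems by simp
      moreover have "?g (Suc r) = w ! (r - card {j \<in> set I. j \<le> r})" using False idx by simp
      moreover have "Suc r - card {j \<in> set I. j \<le> Suc r} = Suc (r - card {j \<in> set I. j \<le> r})"
        using False step[of r] card_le[of r] by simp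
      ultimately show ?thesis unfolding eq IH
        using k by (simp add: take_Suc_conv_app_nth)
    qed
  qed simp
  have "{j \<in> set I. j \<le> ?n} = set I" using sub by auto
  then have fw: "filter (\<lambda>c. c \<noteq> ?M) (phi I w) = w"
    using filt[of ?n] by (simp only: phi order_refl I'(4)) simp
  have M: "?M \<in> set (phi I w)"
    unfolding phi set_map
  proof (rule image_eqI)
    show "?M = ?g (hd I)" using I'(8) by simp
    show "hd I \<in> set [1..<Suc ?n]" using sub I'(8) by (auto simp del: upt_Suc)
  qed
  have "set (phi I w) = insert ?M (set (filter (\<lambda>c. c \<noteq> ?M) (phi I w)))" using M by auto
  also have "\<dots> = {1..?M}" unfolding fw packed_word_set[OF w] by auto
  finally have s: "set (phi I w) = {1..?M}" .
  show "packed_word (phi I w)" using s by (rule packed_wordI)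
  have mx: "max_letter (phi I w) = ?M" using s by (rule max_letter_eqI)
  show len: "length (phi I w) = length w + length I" by (simp add: phi_def del: upt_Suc)
  show "del_max (phi I w) = w" using fw by (simp add: del_max_def mx)
  show "max_positions (phi I w) = set I"
  proof -
    have "phi I w ! (i - 1) = ?g i" if "i \<in> {1..?n}" for i
      using that unfolding phi by (subst nth_map) (auto simp del: upt_Suc)
    then have "max_positions (phi I w) = {i \<in> {1..?n}. ?g i = ?M}"
      unfolding max_positions_def mx len by auto
    also have "\<dots> = set I" using sub lt by fastforce
    finally show ?thesis .
  qed
qed

lemma phi_del_max:
  assumes v: "packed_word v" "v \<noteq> []" and I: "valid_label I" "set I = max_positions v"
  shows "phi I (del_max v) = v"
proof (rule nth_equalityI)
  have len: "length (del_max v) + length I = length v"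
    using length_del_max_add[of v] valid_label_facts(4)[OF I(1)] I(2) by simp
  then show "length (phi I (del_max v)) = length v" by (simp add: phi_def del: upt_Suc)
  fix k assume "k < length (phi I (del_max v))"
  then have k: "k < length v" using len by (simp add: phi_def del: upt_Suc)
  have M: "max_letter (del_max v) + 1 = max_letter v"
    using max_letter_del_max[OF v] packed_max_letter_0[OF v(1)] v(2) by simp
  have nth: "phi I (del_max v) ! k = (if Suc k \<in> max_positions v then max_letter v
      else del_max v ! (Suc k - card {j \<in> max_positions v. j < Suc k} - 1))"
    using k len unfolding phi_def I(2) M by (subst nth_map) (auto simp del: upt_Suc)
  show "phi I (del_max v) ! k = v ! k"
  proof (cases "Suc k \<in> max_positions v")
    case True
    then show ?thesis unfolding nth by (simp add: max_positions_def)
  next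
    case False
    then have ne: "v ! k \<noteq> max_letter v" using k by (simp add: max_positions_def)
    have "{j \<in> max_positions v. j < Suc k} = {i \<in> {1..k}. v ! (i - 1) = max_letter v}"
      using k by (auto simp: max_positions_def)
    then have "Suc k - card {j \<in> max_positions v. j < Suc k} - 1 = length (filter (\<lambda>c. c \<noteq> max_letter v) (take k v))"
      using length_filter_take[of k v "max_letter v"] k by simp
    then show ?thesis
      using nth False filter_nth_length[of k v "\<lambda>c. c \<noteq> max_letter v"] k ne by (simp add: del_max_def)
  qed
qed

lemma cf_Phi:
  assumes y: "y \<in> WQSym m" and I: "valid_label I" "last I \<le> m + length I"
  shows "cf (Phi I y) v = (if packed_word v \<and> v \<noteq> [] \<and> max_positions v = set I then cf y (del_max v) else 0)"
proof -
  let ?C = "packed_word v \<and> v \<noteq> [] \<and> max_positions v = set I"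
  have iff: "phi I w = v \<longleftrightarrow> ?C \<and> w = del_max v" if "w \<in> PW m" for w
  proof
    assume "phi I w = v"
    then show "?C \<and> w = del_max v"
      using phi_facts[of w I] that I valid_label_facts(8)[OF I(1)] by (auto simp: PW_def)
  next
    assume "?C \<and> w = del_max v"
    then show "phi I w = v" using phi_del_max I by simp
  qed
  have "cf (Phi I y) v = (\<Sum>w\<in>PW m. cf y w * cf (if last I \<le> length w + length I then R (phi I w) else 0) v)"
    unfolding Phi_def by (rule cf_linear_ext) (use y in \<open>auto simp: WQSym_def\<close>)
  also have "\<dots> = (\<Sum>w\<in>PW m. if w = del_max v then (if ?C then cf y w else 0) else 0)"
  proof (intro sum.cong refl)
    fix w assume w: "w \<in> PW m"
    then have "last I \<le> length w + length I" using I by (simp add: PW_def)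
    then show "cf y w * cf (if last I \<le> length w + length I then R (phi I w) else 0) v
        = (if w = del_max v then (if ?C then cf y w else 0) else 0)"
      using iff[OF w] by (auto simp: cf_R)
  qed
  also have "\<dots> = (if ?C then cf y (del_max v) else 0)"
    using y by (auto simp: sum.delta' WQSym_def in_keys_iff)
  finally show ?thesis .
qed

lemma Phi_WQSym:
  assumes y: "y \<in> WQSym m" and I: "valid_label I" "last I \<le> m + length I"
  shows "Phi I y \<in> WQSym (m + length I)"
proof (rule WQSymI)
  show "Phi I y \<in> packed_span" by (rule packed_spanI) (simp add: cf_Phi[OF assms])
  fix w :: "nat list" assume "length w \<noteq> m + length I"
  then have "max_positions w = set I \<Longrightarrow> length (del_max w) \<noteq> m"
    using length_del_max_add[of w] valid_label_facts(4)[OF I(1)] by auto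
  then show "cf (Phi I y) w = 0"
    using WQSymD[OF y] by (simp add: cf_Phi[OF assms])
qed


section \<open>Totally primitive elements\<close>

definition labels :: "nat \<Rightarrow> nat list set" where
  "labels n = {I. valid_label I \<and> last I \<le> n}"

lemma finite_labels: "finite (labels n)"
proof (rule finite_subset)
  show "labels n \<subseteq> sorted_list_of_set ` Pow {..n}"
  proof
    fix I assume "I \<in> labels n"
    then have I: "valid_label I" "set I \<subseteq> {..n}"
      using valid_label_facts(7)[of I] by (auto simp: labels_def intro: order_trans)
    have "I = sorted_list_of_set (set I)"
      by (rule strict_sorted_equal) (use I in \<open>auto simp: valid_label_def\<close>)
    then show "I \<in> sorted_list_of_set ` Pow {..n}" using I(2) by blast
  qed
qed simp

lemma labels_length: "I \<in> labels n \<Longrightarrow> length I \<le> n"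
proof -
  assume "I \<in> labels n"
  then have I: "valid_label I" "last I \<le> n" by (auto simp: labels_def)
  have "set I \<subseteq> {1..n}" using valid_label_facts(5,7)[OF I(1)] I(2) by fastforce
  then show ?thesis
    using card_mono[of "{1..n}" "set I"] valid_label_facts(4)[OF I(1)] by simp
qed

lemma label_of_set:
  assumes "finite A" "A \<noteq> {}" "\<And>i. i \<in> A \<Longrightarrow> 1 \<le> i"
  shows "valid_label (sorted_list_of_set A)" "set (sorted_list_of_set A) = A"
proof -
  have "0 \<notin> A" using assms(3) by fastforce
  then show "valid_label (sorted_list_of_set A)" "set (sorted_list_of_set A) = A"
    using assms(1,2) by (auto simp: valid_label_def)
qed

lemma ex_label:
  assumes "packed_word v" "v \<noteq> []"
  obtains I where "I \<in> labels (length v)" "set I = max_positions v"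
proof -
  let ?I = "sorted_list_of_set (max_positions v)"
  have fin: "finite (max_positions v)" by (simp add: max_positions_def)
  have I: "valid_label ?I" "set ?I = max_positions v"
    using label_of_set[OF fin max_positions_nonempty[OF assms]] by (auto simp: max_positions_def)
  moreover have "last ?I \<le> length v"
    using valid_label_facts(9)[OF I(1)] I(2) by (auto simp: max_positions_def)
  ultimately show thesis using that by (simp add: labels_def)
qed

text \<open>The summands \<open>y I\<close> in the decomposition of \<open>x\<close> into terms
  \<open>Phi I (y I)\<close>; they exist by \<open>Phi_component_sum\<close> and are unique by
  \<open>component_Phi_sum\<close>.\<close>

definition component :: "nat \<Rightarrow> 'k::field wqsym \<Rightarrow> nat list \<Rightarrow> 'k wqsym" where
  "component n x I = of_fun (n - length I) (\<lambda>w. cf x (phi I w))"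

lemma cf_component_del_max:
  assumes "packed_word v" "v \<noteq> []" "length v = n" "valid_label I" "set I = max_positions v"
  shows "cf (component n x I) (del_max v) = cf x v"
proof -
  have "del_max v \<in> PW (n - length I)"
    using assms packed_del_max length_del_max[of v] valid_label_facts(4)[OF assms(4)] by (simp add: PW_def)
  then show ?thesis using assms by (simp add: component_def cf_of_fun phi_del_max)
qed

lemma Phi_component_sum:
  assumes x: "x \<in> WQSym n" and n: "n > 0"
  shows "x = (\<Sum>I\<in>labels n. Phi I (component n x I))"
proof (rule packed_span_eqI)
  have mem: "Phi I (component n x I) \<in> WQSym n" if "I \<in> labels n" for I
  proof -
    have "Phi I (component n x I) \<in> WQSym (n - length I + length I)"
      by (rule Phi_WQSym)
        (use that labels_length[OF that] in \<open>auto simp: component_def of_fun_WQSym labels_def\<close>)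
    then show ?thesis using labels_length[OF that] by simp
  qed
  show "x \<in> packed_span" using x by (rule WQSym_packed_span)
  show "(\<Sum>I\<in>labels n. Phi I (component n x I)) \<in> packed_span"
    using mem by (intro packed_span_sum WQSym_packed_span)
  fix v assume v: "packed_word v"
  show "cf x v = cf (\<Sum>I\<in>labels n. Phi I (component n x I)) v"
  proof (cases "length v = n")
    case False
    then have "cf (Phi I (component n x I)) v = 0" if "I \<in> labels n" for I
      using WQSymD[OF mem[OF that]] by simp
    then show ?thesis using WQSymD[OF x False] by (simp add: lookup_sum)
  next
    case True
    then have ne: "v \<noteq> []" using n by auto
    obtain J where J: "J \<in> labels n" "set J = max_positions v" using ex_label[OF v ne] True by metis
    have "cf (Phi I (component n x I)) v = (if I = J then cf x v else 0)" if I: "I \<in> labels n" for I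
    proof -
      have "cf (Phi I (component n x I)) v = (if max_positions v = set I then cf (component n x I) (del_max v) else 0)"
        using I labels_length[OF I] v ne
        by (subst cf_Phi[of _ "n - length I"]) (auto simp: labels_def component_def of_fun_WQSym)
      moreover have "max_positions v = set I \<longleftrightarrow> I = J"
        using I J valid_label_eqI[of I J] by (auto simp: labels_def)
      ultimately show ?thesis
        using cf_component_del_max[OF v ne True] J by (auto simp: labels_def)
    qed
    then show ?thesis using J(1) finite_labels by (simp add: lookup_sum sum.delta cong: sum.cong_simp)
  qed
qed

lemma component_Phi_sum:
  assumes z: "\<And>I. I \<in> labels n \<Longrightarrow> z I \<in> WQSym (n - length I)" and J: "J \<in> labels n"
  shows "component n (\<Sum>I\<in>labels n. Phi I (z I)) J = z J"
proof (rule packed_span_eqI)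
  show "component n (\<Sum>I\<in>labels n. Phi I (z I)) J \<in> packed_span"
    unfolding component_def using of_fun_WQSym by (rule WQSym_packed_span)
  show "z J \<in> packed_span" using z[OF J] by (rule WQSym_packed_span)
  fix w assume w: "packed_word w"
  show "cf (component n (\<Sum>I\<in>labels n. Phi I (z I)) J) w = cf (z J) w"
  proof (cases "length w = n - length J")
    case False
    then show ?thesis using WQSymD[OF z[OF J]] by (simp add: component_def cf_of_fun PW_def)
  next
    case True
    have Jv: "valid_label J" "last J \<le> length w + length J"
      using J labels_length[OF J] True by (auto simp: labels_def)
    note f = phi_facts[OF w Jv]
    have ne: "phi J w \<noteq> []" using f(2) valid_label_facts(1)[OF Jv(1)] by auto
    have "cf (Phi I (z I)) (phi J w) = (if I = J then cf (z J) w else 0)" if I: "I \<in> labels n" for I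
    proof -
      have "cf (Phi I (z I)) (phi J w) = (if set J = set I then cf (z I) w else 0)"
        using I labels_length[OF I] f ne z[OF I]
        by (subst cf_Phi[of _ "n - length I"]) (auto simp: labels_def)
      moreover have "set J = set I \<longleftrightarrow> I = J"
        using I J valid_label_eqI[of I J] by (auto simp: labels_def)
      ultimately show ?thesis by auto
    qed
    then have "cf (\<Sum>I\<in>labels n. Phi I (z I)) (phi J w) = cf (z J) w"
      using J finite_labels by (simp add: lookup_sum sum.delta cong: sum.cong_simp)
    then show ?thesis using True w by (simp add: component_def cf_of_fun PW_def)
  qed
qed

section \<open>Splitting off the last entry of a code\<close>

lemma occ_snoc_same: "i \<le> Suc (count_list \<beta> c) \<Longrightarrow>
    occ (\<beta> @ [c]) c i = (if i = Suc (count_list \<beta> c) then Suc (length \<beta>) else occ \<beta> c i)"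
  by (auto simp: occ_append)

lemma filter_map_occ_snoc:
  assumes "\<And>i. i \<in> set u \<Longrightarrow> i \<le> Suc (count_list \<beta> c)"
  shows "filter (\<lambda>k. k \<noteq> Suc (length \<beta>)) (map (occ (\<beta> @ [c]) c) u)
       = map (occ \<beta> c) (filter (\<lambda>k. k \<noteq> Suc (count_list \<beta> c)) u)"
  using assms
proof (induction u)
  case (Cons i u)
  have "i \<le> count_list \<beta> c \<or> i = Suc (count_list \<beta> c)" using Cons.prems by (auto simp: le_Suc_eq)
  moreover have "occ \<beta> c i \<noteq> Suc (length \<beta>)" if "i \<le> count_list \<beta> c"
    using occ_le_length[OF that] by simp
  ultimately show ?case using Cons by (auto simp: occ_snoc_same)
qed simp

lemma map_occ_snoc_other:
  assumes "\<And>i. i \<in> set u \<Longrightarrow> i \<le> count_list \<beta> c" "c \<noteq> d"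
  shows "map (occ (\<beta> @ [d]) c) u = map (occ \<beta> c) u"
    "filter (\<lambda>k. k \<noteq> Suc (length \<beta>)) (map (occ \<beta> c) u) = map (occ \<beta> c) u"
  using assms occ_le_length[of _ \<beta> c] by (auto simp: occ_append filter_id_conv Suc_le_eq)
    (metis not_less_eq_eq occ_le_length order_refl)+

lemma nth_map_occ_snoc:
  assumes "\<And>i. i \<in> set u \<Longrightarrow> i \<le> Suc (count_list \<beta> c)" "k < length u"
  shows "map (occ (\<beta> @ [c]) c) u ! k = Suc (length \<beta>) \<longleftrightarrow> u ! k = Suc (count_list \<beta> c)"
proof -
  have "u ! k \<le> Suc (count_list \<beta> c)" using assms by simp
  moreover have "occ \<beta> c i \<noteq> Suc (length \<beta>)" if "i \<le> count_list \<beta> c" for i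
    using occ_le_length[OF that] by simp
  ultimately show ?thesis using assms(2) by (auto simp: occ_snoc_same)
qed

text \<open>The final \<open>False\<close> gives the largest value to \<open>t\<close>. Deleting
  that value removes the last entry of the code and the maximal letters of \<open>t\<close>, whose
  positions in the join are shifted by \<open>length s\<close>. In \<open>join_snoc_True\<close> the
  value goes to \<open>s\<close>, and there is no shift.\<close>

lemma join_snoc_False:
  assumes st: "packed_word s" "packed_word t" "t \<noteq> []"
    and \<beta>: "\<beta> \<in> bool_words (max_letter s) (max_letter t - 1)"
  shows "packed_word (join (\<beta> @ [False]) s t)"
    "max_positions (join (\<beta> @ [False]) s t) = (+) (length s) ` max_positions t"
    "del_max (join (\<beta> @ [False]) s t) = join \<beta> s (del_max t)"
proof -
  let ?v = "join (\<beta> @ [False]) s t"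
  have q: "Suc (count_list \<beta> False) = max_letter t" and p: "count_list \<beta> True = max_letter s"
    using \<beta> packed_max_letter_0[OF st(2)] st(3) by (auto simp: bool_words_def)
  have B: "\<beta> @ [False] \<in> bool_words (max_letter s) (max_letter t)" using p q by (simp add: bool_words_def)
  show "packed_word ?v" using packed_join(1)[OF st(1,2) B] .
  have mx: "max_letter ?v = Suc (length \<beta>)" using packed_join(2)[OF st(1,2) B] by simp
  have S: "i \<le> count_list \<beta> True" if "i \<in> set s" for i using that p packed_word_set[OF st(1)] by simp
  have T: "i \<le> Suc (count_list \<beta> False)" if "i \<in> set t" for i using that q packed_word_set[OF st(2)] by simp
  have v: "?v = map (occ \<beta> True) s @ map (occ (\<beta> @ [False]) False) t"
    using map_occ_snoc_other(1)[of s \<beta> True False] S by (simp add: join_def)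
  show "del_max ?v = join \<beta> s (del_max t)"
    unfolding del_max_def mx unfolding v
    using map_occ_snoc_other(2)[of s \<beta> True False] S filter_map_occ_snoc[of t \<beta> False] T
    by (simp add: join_def q)
  have Sn: "map (occ \<beta> True) s ! k \<noteq> Suc (length \<beta>)" if "k < length s" for k
    using occ_le_length[of "s ! k" \<beta> True] S[of "s ! k"] that by simp
  show "max_positions ?v = (+) (length s) ` max_positions t"
  proof (intro equalityI subsetI)
    fix i assume "i \<in> max_positions ?v"
    then have i: "1 \<le> i" "i \<le> length s + length t" "?v ! (i - 1) = Suc (length \<beta>)"
      by (auto simp: max_positions_def mx)
    have ns: "\<not> i - 1 < length s" using i(3) Sn[of "i - 1"] unfolding v by (auto simp: nth_append)
    then have k: "length s < i" "i - 1 - length s < length t" using i by auto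
    have "map (occ (\<beta> @ [False]) False) t ! (i - 1 - length s) = Suc (length \<beta>)"
      using i(3) ns unfolding v nth_append length_map by (simp only: if_False)
    then have "t ! (i - 1 - length s) = max_letter t"
      using nth_map_occ_snoc[of t \<beta> False "i - 1 - length s"] T k q by simp
    then have "i - length s \<in> max_positions t" using k by (auto simp: max_positions_def)
    then show "i \<in> (+) (length s) ` max_positions t" using k by (intro image_eqI[of _ _ "i - length s"]) auto
  next
    fix i assume "i \<in> (+) (length s) ` max_positions t"
    then obtain j where j: "i = length s + j" "1 \<le> j" "j \<le> length t" "t ! (j - 1) = max_letter t"
      by (auto simp: max_positions_def)
    have "map (occ (\<beta> @ [False]) False) t ! (j - 1) = Suc (length \<beta>)"
      using nth_map_occ_snoc[of t \<beta> False "j - 1"] T j q by simp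
    moreover have "\<not> i - 1 < length s" "i - 1 - length s = j - 1" using j by auto
    ultimately have "?v ! (i - 1) = Suc (length \<beta>)"
      unfolding v nth_append length_map by (simp only: if_False)
    then show "i \<in> max_positions ?v" using j by (simp add: max_positions_def mx)
  qed
qed

lemma join_snoc_True:
  assumes st: "packed_word s" "packed_word t" "s \<noteq> []"
    and \<beta>: "\<beta> \<in> bool_words (max_letter s - 1) (max_letter t)"
  shows "packed_word (join (\<beta> @ [True]) s t)"
    "max_positions (join (\<beta> @ [True]) s t) = max_positions s"
    "del_max (join (\<beta> @ [True]) s t) = join \<beta> (del_max s) t"
proof -
  let ?v = "join (\<beta> @ [True]) s t"
  have q: "count_list \<beta> False = max_letter t" and p: "Suc (count_list \<beta> True) = max_letter s"
    using \<beta> packed_max_letter_0[OF st(1)] st(3) by (auto simp: bool_words_def)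
  have B: "\<beta> @ [True] \<in> bool_words (max_letter s) (max_letter t)" using p q by (simp add: bool_words_def)
  show "packed_word ?v" using packed_join(1)[OF st(1,2) B] .
  have mx: "max_letter ?v = Suc (length \<beta>)" using packed_join(2)[OF st(1,2) B] by simp
  have S: "i \<le> Suc (count_list \<beta> True)" if "i \<in> set s" for i using that p packed_word_set[OF st(1)] by simp
  have T: "i \<le> count_list \<beta> False" if "i \<in> set t" for i using that q packed_word_set[OF st(2)] by simp
  have v: "?v = map (occ (\<beta> @ [True]) True) s @ map (occ \<beta> False) t"
    using map_occ_snoc_other(1)[of t \<beta> False True] T by (simp add: join_def)
  show "del_max ?v = join \<beta> (del_max s) t"
    unfolding del_max_def mx unfolding v
    using map_occ_snoc_other(2)[of t \<beta> False True] T filter_map_occ_snoc[of s \<beta> True] S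
    by (simp add: join_def p)
  have Tn: "map (occ \<beta> False) t ! k \<noteq> Suc (length \<beta>)" if "k < length t" for k
    using occ_le_length[of "t ! k" \<beta> False] T[of "t ! k"] that by simp
  show "max_positions ?v = max_positions s"
  proof (intro equalityI subsetI)
    fix i assume "i \<in> max_positions ?v"
    then have i: "1 \<le> i" "i \<le> length s + length t" "?v ! (i - 1) = Suc (length \<beta>)"
      by (auto simp: max_positions_def mx)
    have k: "i - 1 < length s"
    proof (rule ccontr)
      assume ns: "\<not> i - 1 < length s"
      then have "map (occ \<beta> False) t ! (i - 1 - length s) = Suc (length \<beta>)"
        using i(3) unfolding v nth_append length_map by (simp only: if_False)
      moreover have "i - 1 - length s < length t" using ns i by linarith
      ultimately show False using Tn by blast
    qed
    then have "map (occ (\<beta> @ [True]) True) s ! (i - 1) = Suc (length \<beta>)"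
      using i(3) unfolding v by (simp add: nth_append)
    then have "s ! (i - 1) = max_letter s"
      using nth_map_occ_snoc[of s \<beta> True "i - 1"] S k p by simp
    then show "i \<in> max_positions s" using k i by (auto simp: max_positions_def)
  next
    fix i assume "i \<in> max_positions s"
    then have i: "1 \<le> i" "i \<le> length s" "s ! (i - 1) = max_letter s"
      by (auto simp: max_positions_def)
    have "map (occ (\<beta> @ [True]) True) s ! (i - 1) = Suc (length \<beta>)"
      using nth_map_occ_snoc[of s \<beta> True "i - 1"] S i p by simp
    moreover have "i - 1 < length s" using i by linarith
    ultimately have "?v ! (i - 1) = Suc (length \<beta>)"
      unfolding v nth_append length_map by (simp only: if_True)
    then show "i \<in> max_positions ?v" using i by (simp add: max_positions_def mx)
  qed
qed

text \<open>Fixing the owner of the largest letter fixes the last entry of the code. After deletion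
  of the maximal letters the remaining code is arbitrary, so a half-coproduct of \<open>x\<close>
  becomes a full coproduct of one component.\<close>

lemma cop_max_right_component:
  assumes st: "packed_word s" "packed_word t" "t \<noteq> []" and n: "length s + length t = n"
    and I: "valid_label I" "set I = (+) (length s) ` max_positions t"
  shows "cop max_right x s t = cop all_cuts (component n x I) s (del_max t)"
proof -
  have q: "max_letter t \<noteq> 0" using st by (simp add: packed_max_letter_0)
  have "cop max_right x s t
      = (\<Sum>\<beta> | \<beta> \<in> bool_words (max_letter s) (max_letter t - 1) \<and> True. cf x (join (\<beta> @ [False]) s t))"
    unfolding cop_def
  proof (rule sum.reindex_bij_witness[where j = butlast and i = "\<lambda>\<beta>. \<beta> @ [False]"])
    fix \<beta> assume "\<beta> \<in> {\<beta>. \<beta> \<in> bool_words (max_letter s) (max_letter t) \<and> max_right \<beta>}"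
    then show "butlast \<beta> @ [False] = \<beta>"
      "butlast \<beta> \<in> {\<beta>. \<beta> \<in> bool_words (max_letter s) (max_letter t - 1) \<and> True}"
      "cf x (join (butlast \<beta> @ [False]) s t) = cf x (join \<beta> s t)"
      by (cases \<beta> rule: rev_cases; auto simp: bool_words_def)+
  qed (use q in \<open>auto simp: bool_words_def\<close>)
  also have "\<dots> = (\<Sum>\<beta> | \<beta> \<in> bool_words (max_letter s) (max_letter (del_max t)) \<and> True. cf (component n x I) (join \<beta> s (del_max t)))"
    unfolding max_letter_del_max[OF st(2,3)]
  proof (intro sum.cong refl)
    fix \<beta> assume "\<beta> \<in> {\<beta>. \<beta> \<in> bool_words (max_letter s) (max_letter t - 1) \<and> True}"
    then have \<beta>: "\<beta> \<in> bool_words (max_letter s) (max_letter t - 1)" by simp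
    note j = join_snoc_False[OF st \<beta>]
    have "join (\<beta> @ [False]) s t \<noteq> []" using st(3) by (simp add: join_def)
    then have "cf (component n x I) (del_max (join (\<beta> @ [False]) s t)) = cf x (join (\<beta> @ [False]) s t)"
      by (intro cf_component_del_max j(1) I(1)) (simp_all add: n j(2) I(2))
    then show "cf x (join (\<beta> @ [False]) s t) = cf (component n x I) (join \<beta> s (del_max t))"
      by (simp add: j(3))
  qed
  finally show ?thesis by (simp add: cop_def)
qed

lemma cop_max_left_component:
  assumes st: "packed_word s" "packed_word t" "s \<noteq> []" and n: "length s + length t = n"
    and I: "valid_label I" "set I = max_positions s"
  shows "cop max_left x s t = cop all_cuts (component n x I) (del_max s) t"
proof -
  have p: "max_letter s \<noteq> 0" using st by (simp add: packed_max_letter_0)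
  have "cop max_left x s t
      = (\<Sum>\<beta> | \<beta> \<in> bool_words (max_letter s - 1) (max_letter t) \<and> True. cf x (join (\<beta> @ [True]) s t))"
    unfolding cop_def
  proof (rule sum.reindex_bij_witness[where j = butlast and i = "\<lambda>\<beta>. \<beta> @ [True]"])
    fix \<beta> assume "\<beta> \<in> {\<beta>. \<beta> \<in> bool_words (max_letter s) (max_letter t) \<and> max_left \<beta>}"
    then show "butlast \<beta> @ [True] = \<beta>"
      "butlast \<beta> \<in> {\<beta>. \<beta> \<in> bool_words (max_letter s - 1) (max_letter t) \<and> True}"
      "cf x (join (butlast \<beta> @ [True]) s t) = cf x (join \<beta> s t)"
      by (cases \<beta> rule: rev_cases; auto simp: bool_words_def)+
  qed (use p in \<open>auto simp: bool_words_def\<close>)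
  also have "\<dots> = (\<Sum>\<beta> | \<beta> \<in> bool_words (max_letter (del_max s)) (max_letter t) \<and> True. cf (component n x I) (join \<beta> (del_max s) t))"
    unfolding max_letter_del_max[OF st(1,3)]
  proof (intro sum.cong refl)
    fix \<beta> assume "\<beta> \<in> {\<beta>. \<beta> \<in> bool_words (max_letter s - 1) (max_letter t) \<and> True}"
    then have \<beta>: "\<beta> \<in> bool_words (max_letter s - 1) (max_letter t)" by simp
    note j = join_snoc_True[OF st \<beta>]
    have "join (\<beta> @ [True]) s t \<noteq> []" using st(3) by (simp add: join_def)
    then have "cf (component n x I) (del_max (join (\<beta> @ [True]) s t)) = cf x (join (\<beta> @ [True]) s t)"
      by (intro cf_component_del_max j(1) I(1)) (simp_all add: n j(2) I(2))
    then show "cf x (join (\<beta> @ [True]) s t) = cf (component n x I) (join \<beta> (del_max s) t)"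
      by (simp add: j(3))
  qed
  finally show ?thesis by (simp add: cop_def)
qed

text \<open>The deconcatenations of \<open>phi I w\<close> before the first and after the last inserted letter are those
  of \<open>w\<close> of left degree below \<open>hd I\<close> and of right degree at most \<open>n - last I\<close>.\<close>

definition component_space :: "nat \<Rightarrow> nat list \<Rightarrow> 'k::field wqsym set" where
  "component_space n I = {y \<in> WQSym (n - length I). \<forall>s t. packed_word s \<longrightarrow> packed_word t \<longrightarrow>
     length s + length t = n - length I \<longrightarrow>
     (1 \<le> length s \<and> length s < hd I) \<or> (1 \<le> length t \<and> length t \<le> n - last I) \<longrightarrow>
     cop all_cuts y s t = 0}"

text \<open>The conditions on the components are exactly the coefficients of the two half-coproducts
  of \<open>x\<close>: the maximal letters are reinserted into, or deleted from, the factor that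
  holds them.\<close>

lemma TPrim_hom_iff:
  assumes x: "x \<in> WQSym n" and n: "n > 0"
  shows "x \<in> TPrim_hom n \<longleftrightarrow> (\<forall>I\<in>labels n. component n x I \<in> component_space n I)"
proof
  assume "x \<in> TPrim_hom n"
  then have tp: "x \<in> TPrim" by (simp add: TPrim_hom_def)
  show "\<forall>I\<in>labels n. component n x I \<in> component_space n I"
    unfolding component_space_def
  proof (intro ballI CollectI conjI allI impI)
    fix I assume I: "I \<in> labels n"
    show "component n x I \<in> WQSym (n - length I)" by (simp add: component_def of_fun_WQSym)
    fix s t :: "nat list"
    assume st: "packed_word s" "packed_word t" "length s + length t = n - length I"
    have Iv: "valid_label I" "last I \<le> n" "length I \<le> n"
      using I labels_length by (auto simp: labels_def)
    note If = valid_label_facts[OF Iv(1)]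
    assume "(1 \<le> length s \<and> length s < hd I) \<or> (1 \<le> length t \<and> length t \<le> n - last I)"
    then show "cop all_cuts (component n x I) s t = 0"
    proof
      assume s: "1 \<le> length s \<and> length s < hd I"
      \<comment> \<open>The labels as positions within the right factor; they stay positive because
        \<open>length s < hd I\<close>.\<close>
      let ?J = "map (\<lambda>j. j - length s) I"
      have gt: "length s < i" if "i \<in> set I" for i using s If(6)[OF that] by simp
      have J: "valid_label ?J"
      proof -
        have "sorted_wrt (\<lambda>a b. a - length s < b - length s) I"
          by (rule sorted_wrt_mono_rel[OF _ If(2)]) (use gt in \<open>simp add: diff_less_mono less_imp_le\<close>)
        moreover have "0 \<notin> set ?J" using gt by fastforce
        ultimately show ?thesis using If(1) by (simp add: valid_label_def sorted_wrt_map)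
      qed
      have "last ?J = last I - length s" using If(1) by (simp add: last_map)
      then have bd: "last ?J \<le> length t + length ?J" using Iv st(3) by simp
      note f = phi_facts[OF st(2) J bd]
      have ne: "phi ?J t \<noteq> []" "s \<noteq> []" using f(2) If(1) s by auto
      have "set I = (+) (length s) ` max_positions (phi ?J t)"
        unfolding f(3) using gt by (force simp: image_iff)
      then have "cop max_right x s (phi ?J t) = cop all_cuts (component n x I) s t"
        using cop_max_right_component[OF st(1) f(1) ne(1) _ Iv(1), of n x] f(2,4) st(3) Iv(3) by simp
      then show ?thesis using tp st f(1) ne by (simp add: TPrim_iff)
    next
      assume t: "1 \<le> length t \<and> length t \<le> n - last I"
      have bd: "last I \<le> length s + length I" using t Iv st(3) by linarith
      note f = phi_facts[OF st(1) Iv(1) bd]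
      have ne: "phi I s \<noteq> []" "t \<noteq> []" using f(2) If(1) t by auto
      have "cop max_left x (phi I s) t = cop all_cuts (component n x I) s t"
        using cop_max_left_component[OF f(1) st(2) ne(1) _ Iv(1), of n x] f(2,3,4) st(3) Iv(3) by simp
      then show ?thesis using tp st f(1) ne by (simp add: TPrim_iff)
    qed
  qed
next
  assume Y: "\<forall>I\<in>labels n. component n x I \<in> component_space n I"
  have "cop max_left x s t = 0 \<and> cop max_right x s t = 0"
    if st: "packed_word s" "packed_word t" "s \<noteq> []" "t \<noteq> []" for s t
  proof (cases "length s + length t = n")
    case False
    then show ?thesis using cop_hom[OF x] by blast
  next
    case True
    have l: "1 \<le> length s" "1 \<le> length t" using st by (simp_all add: Suc_le_eq)
    have "cop max_left x s t = 0"
    proof -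
      obtain I where I: "I \<in> labels (length s)" "set I = max_positions s" using ex_label[OF st(1,3)] by blast
      then have Iv: "valid_label I" "last I \<le> length s" by (auto simp: labels_def)
      then have "I \<in> labels n" using True by (simp add: labels_def)
      then have "component n x I \<in> component_space n I" using Y by blast
      moreover have "length (del_max s) + length t = n - length I"
        using length_del_max_add[of s] valid_label_facts(4)[OF Iv(1)] I(2) True by simp
      ultimately have "cop all_cuts (component n x I) (del_max s) t = 0"
        unfolding component_space_def using packed_del_max[OF st(1,3)] st(2) l(2) Iv(2) True by simp
      then show ?thesis using cop_max_left_component[OF st(1-3) True Iv(1) I(2), of x] by simp
    qed
    moreover have "cop max_right x s t = 0"
    proof -
      \<comment> \<open>The positions of the maximal letters of \<open>t\<close> counted in the
        whole word. All of them exceed \<open>length s\<close>, which becomes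
        \<open>length s < hd I\<close>.\<close>
      let ?A = "(+) (length s) ` max_positions t"
      have A: "finite ?A" "?A \<noteq> {}" "\<And>i. i \<in> ?A \<Longrightarrow> 1 \<le> i \<and> length s < i \<and> i \<le> n"
        using max_positions_nonempty[OF st(2,4)] True by (auto simp: max_positions_def)
      obtain I where I: "valid_label I" "set I = ?A" using label_of_set[OF A(1,2)] A(3) by blast
      have hl: "last I \<le> n" "length s < hd I"
        using valid_label_facts(8,9)[OF I(1)] A(3) unfolding I(2) by blast+
      have "card ?A = card (max_positions t)" by (rule card_image) simp
      then have len: "length s + length (del_max t) = n - length I"
        using length_del_max_add[of t] valid_label_facts(4)[OF I(1)] True unfolding I(2) by simp
      have "I \<in> labels n" using I(1) hl(1) by (simp add: labels_def)
      then have "component n x I \<in> component_space n I" using Y by blast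
      then have "cop all_cuts (component n x I) s (del_max t) = 0"
        unfolding component_space_def using packed_del_max[OF st(2,4)] st(1) l(1) len hl(2) by simp
      then show ?thesis using cop_max_right_component[OF st(1,2,4) True I, of x] by simp
    qed
    ultimately show ?thesis by blast
  qed
  then show "x \<in> TPrim_hom n"
    using x WQSym_plusI[OF x n] by (simp add: TPrim_hom_def TPrim_iff)
qed

section \<open>From bases of the component spaces to totally primitive elements\<close>

lemma Phi_scale: "Phi I (scale c x) = scale c (Phi I x)"
  by (simp add: Phi_def linear_ext_scale)

lemma Phi_sum: "Phi I (\<Sum>a\<in>A. f a) = (\<Sum>a\<in>A. Phi I (f a))"
proof -
  have "Phi I 0 = 0" by (simp add: Phi_def linear_ext_def)
  then show ?thesis
    by (induction A rule: infinite_finite_induct) (simp_all add: Phi_def linear_ext_add)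
qed

text \<open>Taking components is an isomorphism from \<open>TPrim_hom n\<close> onto the product of
  the spaces \<open>component_space n I\<close>, and its inverse adds up the images under
  \<open>Phi I\<close>; so bases of the factors combine.\<close>

lemma TPrim_basis:
  assumes n: "n > 0"
    and B: "\<And>I. I \<in> labels n \<Longrightarrow> is_basis B (G I) (component_space n I)"
    and fin: "\<And>I. I \<in> labels n \<Longrightarrow> finite (G I)"
  shows "is_basis (\<lambda>(I, f). Phi I (B f)) (Sigma (labels n) G) (TPrim_hom n)"
proof (rule is_basisI)
  show "finite (Sigma (labels n) G)" using finite_labels fin by blast
  show "free.subspace (TPrim_hom n)" by (rule subspace_TPrim_hom)
  define z where "z c I = (\<Sum>f\<in>G I. scale (c (I, f)) (B f))" for c I
  have z: "z c I \<in> component_space n I" if "I \<in> labels n" for c I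
    unfolding z_def using is_basis_subspace[OF B[OF that]] is_basis_mem[OF B[OF that]]
    by (intro free.subspace_sum free.subspace_scale)
  have zW: "z c I \<in> WQSym (n - length I)" if "I \<in> labels n" for c I
    using z[OF that] by (simp add: component_space_def)
  have sum: "(\<Sum>k\<in>Sigma (labels n) G. scale (c k) (case k of (I, f) \<Rightarrow> Phi I (B f)))
      = (\<Sum>I\<in>labels n. Phi I (z c I))" for c
    unfolding z_def Phi_sum Phi_scale
    by (subst sum.Sigma) (use finite_labels fin in \<open>auto simp: case_prod_beta\<close>)
  have in_TPrim: "(\<Sum>I\<in>labels n. Phi I (z c I)) \<in> TPrim_hom n" for c
  proof (subst TPrim_hom_iff[OF _ n])
    show "(\<Sum>I\<in>labels n. Phi I (z c I)) \<in> WQSym n"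
    proof (rule free.subspace_sum[OF subspace_WQSym])
      fix I assume I: "I \<in> labels n"
      have "Phi I (z c I) \<in> WQSym (n - length I + length I)"
        by (rule Phi_WQSym[OF zW[OF I]]) (use I labels_length[OF I] in \<open>auto simp: labels_def\<close>)
      then show "Phi I (z c I) \<in> WQSym n" using labels_length[OF I] by simp
    qed
    show "\<forall>J\<in>labels n. component n (\<Sum>I\<in>labels n. Phi I (z c I)) J \<in> component_space n J"
      using component_Phi_sum[of n "z c"] zW z by simp
  qed
  show "(case k of (I, f) \<Rightarrow> Phi I (B f)) \<in> TPrim_hom n" if k: "k \<in> Sigma (labels n) G" for k
  proof -
    \<comment> \<open>A single basis element is the sum for a unit coefficient vector, so that
      \<open>in_TPrim\<close> covers it too.\<close>
    have "(\<Sum>k'\<in>Sigma (labels n) G. scale (if k' = k then 1 else 0) (case k' of (I, f) \<Rightarrow> Phi I (B f)))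
       = (\<Sum>k'\<in>Sigma (labels n) G. if k' = k then (case k of (I, f) \<Rightarrow> Phi I (B f)) else 0)"
      by (intro sum.cong refl) auto
    also have "\<dots> = (case k of (I, f) \<Rightarrow> Phi I (B f))"
      using k finite_labels fin by (simp add: sum.delta')
    finally have "(case k of (I, f) \<Rightarrow> Phi I (B f))
        = (\<Sum>I\<in>labels n. Phi I (z (\<lambda>k'. if k' = k then 1 else 0) I))"
      unfolding sum by (rule sym)
    then show ?thesis using in_TPrim by (simp only:)
  qed
  show "c k = 0" if c: "(\<Sum>k\<in>Sigma (labels n) G. scale (c k) (case k of (I, f) \<Rightarrow> Phi I (B f))) = 0"
    and k: "k \<in> Sigma (labels n) G" for c k
  proof -
    obtain I f where kk: "k = (I, f)" "I \<in> labels n" "f \<in> G I" using k by blast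
    have "z c I = component n 0 I"
      using component_Phi_sum[of n "z c" I, OF zW kk(2)] c unfolding sum by simp
    also have "\<dots> = 0" by (simp add: component_def of_fun_def)
    finally show ?thesis
      using is_basis_indep[OF B[OF kk(2)] fin[OF kk(2)], of "\<lambda>f. c (I, f)" f] kk by (simp add: z_def)
  qed
  show "\<exists>c. x = (\<Sum>k\<in>Sigma (labels n) G. scale (c k) (case k of (I, f) \<Rightarrow> Phi I (B f)))"
    if x: "x \<in> TPrim_hom n" for x
  proof -
    have xW: "x \<in> WQSym n" using x by (simp add: TPrim_hom_def)
    have "\<exists>a. component n x I = (\<Sum>f\<in>G I. scale (a f) (B f))" if "I \<in> labels n" for I
      using TPrim_hom_iff[OF xW n] x is_basis_repr[OF B[OF that] fin[OF that]] that by blast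
    then obtain a where a: "\<And>I. I \<in> labels n \<Longrightarrow> component n x I = (\<Sum>f\<in>G I. scale (a I f) (B f))"
      by metis
    have "x = (\<Sum>I\<in>labels n. Phi I (z (case_prod a) I))"
      by (subst Phi_component_sum[OF xW n]) (intro sum.cong refl, simp add: a z_def)
    then show ?thesis using sum by metis
  qed
qed


section \<open>Packed trees and forests\<close>

lemma packed_tree_left_iff:
  "packed_tree (Node I fl fr) \<longleftrightarrow> packed_tree (Node I [] fr) \<and> (\<forall>t\<in>set fl. packed_tree t)"
  by auto

text \<open>Brings packedness into the form of \<open>component_space\<close>, with \<open>n\<close>
  the right-weight. For an empty right forest, \<open>last I \<le> length I\<close> already forces
  \<open>I\<close> to be an initial interval; otherwise
  \<open>n + 1 - last I \<le> weight (last fr)\<close> becomes a strict inequality.\<close>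

lemma packed_tree_right_iff:
  assumes n: "length I + sum_list (map weight fr) = n"
  shows "packed_tree (Node I [] fr) \<longleftrightarrow> I \<in> labels n \<and> (\<forall>t\<in>set fr. packed_tree t)
     \<and> (fr \<noteq> [] \<longrightarrow> hd I \<le> weight (hd fr) \<and> n - last I < weight (last fr))"
proof (cases "valid_label I")
  case False
  then show ?thesis by (simp add: labels_def)
next
  case True
  note If = valid_label_facts[OF True]
  show ?thesis
  proof (cases "fr = []")
    case fr: True
    have "I = [1..<length I + 1] \<longleftrightarrow> last I \<le> length I"
    proof
      assume I: "I = [1..<length I + 1]"
      have "last [1..<length I + 1] = length I" using If(1) by (subst last_upt) auto
      then show "last I \<le> length I" using I by simp
    next
      assume l: "last I \<le> length I"
      have "set I \<subseteq> {1..length I}" using If(5,7) l by fastforce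
      then have S: "set I = {1..length I}" using If(4) by (intro card_subset_eq) auto
      show "I = [1..<length I + 1]"
        by (rule strict_sorted_equal[OF sorted_wrt_upt If(2)])
          (simp add: S atLeastLessThanSuc_atLeastAtMost del: upt_Suc)
    qed
    then show ?thesis using fr n True by (simp add: labels_def del: upt_Suc)
  next
    case False
    have "1 \<le> hd I" using If(5,8) by blast
    then show ?thesis using False n True by (auto simp: labels_def)
  qed
qed

lemma weight_pos:
  assumes "packed_tree t"
  shows "1 \<le> right_weight t" "right_weight t \<le> weight t"
  using assms by (cases t; auto simp: valid_label_def Suc_le_eq)+

lemma sum_weight_ge: "t \<in> set f \<Longrightarrow> weight t \<le> sum_list (map weight f)"
  by (induction f) auto

lemma length_le_sum_weight: "\<forall>t\<in>set f. packed_tree t \<Longrightarrow> length f \<le> sum_list (map weight f)"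
proof (induction f)
  case (Cons t f)
  then show ?case using weight_pos[of t] by simp
qed simp

lemma packed_weight_0:
  assumes "\<forall>t\<in>set f. packed_tree t" "sum_list (map weight f) = 0"
  shows "f = []"
  using length_le_sum_weight[OF assms(1)] unfolding assms(2) by simp

lemma packed_forests_Nil [simp]: "[] \<in> packed_forests n \<longleftrightarrow> n = 0"
  by (auto simp: packed_forests_def)

lemma packed_forests_0: "packed_forests 0 = {[]}"
proof -
  have "f = []" if "f \<in> packed_forests 0" for f
    using that packed_weight_0[of f] unfolding packed_forests_def by blast
  then show ?thesis by auto
qed

lemma packed_forests_append:
  "g \<in> packed_forests i \<Longrightarrow> h \<in> packed_forests j \<Longrightarrow> g @ h \<in> packed_forests (i + j)"
  by (auto simp: packed_forests_def)

lemma packed_forests_split: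
  "f \<in> packed_forests n \<Longrightarrow> sum_list (map weight (take j f)) = i \<Longrightarrow>
   take j f \<in> packed_forests i \<and> drop j f \<in> packed_forests (n - i)"
proof -
  assume f: "f \<in> packed_forests n" and i: "sum_list (map weight (take j f)) = i"
  have "sum_list (map weight (take j f)) + sum_list (map weight (drop j f)) = n"
    using f by (metis (mono_tags, lifting) append_take_drop_id map_append mem_Collect_eq packed_forests_def sum_list_append)
  then show ?thesis
    using f i by (auto simp: packed_forests_def dest: in_set_takeD in_set_dropD)
qed

lemma packed_forests_tree_weight: "f \<in> packed_forests n \<Longrightarrow> t \<in> set f \<Longrightarrow> packed_tree t \<and> weight t \<le> n"
  using sum_weight_ge by (auto simp: packed_forests_def)

text \<open>Labels are non-empty, so both forests consist of lighter trees; their lengths are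
  bounded since every packed tree has positive weight.\<close>

lemma finite_packed_trees: "finite (packed_trees n)"
proof (induction n rule: less_induct)
  case (less n)
  let ?T = "\<Union>m\<in>{..<n}. packed_trees m"
  let ?L = "{f. set f \<subseteq> ?T \<and> length f \<le> n}"
  have fin: "finite ?L" using less by (intro finite_lists_length_le) auto
  have "packed_trees n \<subseteq> (\<lambda>(I, fl, fr). Node I fl fr) ` (labels n \<times> ?L \<times> ?L)"
  proof
    fix t assume t: "t \<in> packed_trees n"
    obtain I fl fr where tt: "t = Node I fl fr" by (cases t)
    have p: "packed_tree (Node I [] fr)" "\<forall>t\<in>set fl. packed_tree t" and w: "weight t = n"
      using t packed_tree_left_iff[of I fl fr] by (auto simp: packed_trees_def tt)
    have I: "I \<in> labels (length I + sum_list (map weight fr))" and fr: "\<forall>t\<in>set fr. packed_tree t"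
      using p(1) packed_tree_right_iff[OF refl] by blast+
    have "I \<noteq> []" using I valid_label_facts(1) by (auto simp: labels_def)
    then have lt: "sum_list (map weight fl) < n" "sum_list (map weight fr) < n"
      using w by (cases I; simp add: tt)+
    have "f \<in> ?L" if "\<forall>t\<in>set f. packed_tree t" "sum_list (map weight f) < n" for f
      using that length_le_sum_weight[of f] sum_weight_ge[of _ f]
      by (fastforce simp: packed_trees_def)
    moreover have "I \<in> labels n" using I w by (auto simp: labels_def tt)
    ultimately show "t \<in> (\<lambda>(I, fl, fr). Node I fl fr) ` (labels n \<times> ?L \<times> ?L)"
      using p(2) fr lt unfolding tt by (intro image_eqI[of _ _ "(I, fl, fr)"]) auto
  qed
  then show ?case using finite_labels fin by (meson finite_SigmaI finite_imageI finite_subset)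
qed

lemma finite_packed_forests: "finite (packed_forests n)"
proof (rule finite_subset)
  show "packed_forests n \<subseteq> {f. set f \<subseteq> (\<Union>m\<in>{..n}. packed_trees m) \<and> length f \<le> n}"
    using length_le_sum_weight sum_weight_ge by (fastforce simp: packed_forests_def packed_trees_def)
  show "finite {f. set f \<subseteq> (\<Union>m\<in>{..n}. packed_trees m) \<and> length f \<le> n}"
    using finite_packed_trees by (intro finite_lists_length_le) auto
qed


section \<open>Coproducts of forests\<close>

text \<open>The first argument only fixes the field.\<close>

definition prim_trees :: "'k::field itself \<Rightarrow> nat \<Rightarrow> bool" where
  "prim_trees _ n \<longleftrightarrow> (\<forall>t. packed_tree t \<longrightarrow> weight t \<le> n \<longrightarrow> (P_tree t :: 'k wqsym) \<in> Prim_hom (weight t))"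

lemma om_WQSym:
  "(\<And>t. t \<in> set ts \<Longrightarrow> F t \<in> WQSym (w t)) \<Longrightarrow> om (map F ts) \<in> WQSym (sum_list (map w ts))"
proof (induction ts)
  case Nil
  then show ?case by (simp add: WQSym_def PW_def R_def)
next
  case (Cons t ts)
  then show ?case using prec_WQSym[of "F t" "w t" "om (map F ts)"] by simp
qed

lemma om'_WQSym:
  "(\<And>t. t \<in> set ts \<Longrightarrow> F t \<in> WQSym (w t)) \<Longrightarrow> om' (map F ts) \<in> WQSym (sum_list (map w ts))"
proof (induction ts rule: rev_induct)
  case Nil
  then show ?case by (simp add: WQSym_def PW_def R_def)
next
  case (snoc t ts)
  then show ?case using succ_WQSym[of "om' (map F ts)" _ "F t" "w t"] by simp
qed

context
  fixes n :: nat
  assumes prim: "prim_trees TYPE('k::field) n"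
begin

lemma trees_Prim:
  assumes "\<forall>t\<in>set f. packed_tree t \<and> weight t \<le> n"
  shows "set (map P_tree f) \<subseteq> (Prim :: 'k wqsym set)"
    "\<And>t. t \<in> set f \<Longrightarrow> (P_tree t :: 'k wqsym) \<in> WQSym (weight t)"
  using assms prim by (auto simp: prim_trees_def Prim_hom_def)

lemma P_forest_om:
  assumes "\<forall>t\<in>set f. packed_tree t \<and> weight t \<le> n"
  shows "(P_forest f :: 'k wqsym) = om (map P_tree (rev f))"
proof -
  have "set (map P_tree (rev f)) \<subseteq> (WQSym_plus :: 'k wqsym set)"
    using trees_Prim(1)[OF assms] Prim_plus by auto
  then show ?thesis
    by (auto simp: P_forest_def forest_prod_def prec_iter_eq_om rev_map)
qed

lemma P_forest_WQSym:
  assumes "f \<in> packed_forests m" "m \<le> n"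
  shows "(P_forest f :: 'k wqsym) \<in> WQSym m"
proof -
  have f: "\<forall>t\<in>set f. packed_tree t \<and> weight t \<le> n"
    using packed_forests_tree_weight[OF assms(1)] assms(2) by fastforce
  have "(om (map P_tree (rev f)) :: 'k wqsym) \<in> WQSym (sum_list (map weight (rev f)))"
    by (rule om_WQSym) (use trees_Prim(2)[OF f] in auto)
  then show ?thesis using assms(1)
    by (simp add: P_forest_om[OF f] packed_forests_def rev_map[symmetric])
qed

text \<open>\<open>cop_om\<close> puts prefixes on the right; the reversal in
  \<open>forest_prod\<close> turns this into deconcatenation of the forest with prefixes on the
  left.\<close>

lemma cop_P_forest:
  assumes f: "f \<in> packed_forests m" "m \<le> n" and st: "packed_word s" "packed_word t"
  shows "cop all_cuts (P_forest f :: 'k wqsym) s t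
       = (\<Sum>j\<le>length f. cf (P_forest (take j f)) s * cf (P_forest (drop j f)) t)"
proof -
  have ft: "\<forall>t\<in>set f. packed_tree t \<and> weight t \<le> n"
    using packed_forests_tree_weight[OF f(1)] f(2) by fastforce
  have sub: "\<forall>t\<in>set (take j f). packed_tree t \<and> weight t \<le> n"
    "\<forall>t\<in>set (drop j f). packed_tree t \<and> weight t \<le> n" for j
    using ft by (auto dest: in_set_takeD in_set_dropD)
  let ?xs = "map P_tree (rev f) :: 'k wqsym list"
  have "cop all_cuts (P_forest f :: 'k wqsym) s t
      = (\<Sum>j\<le>length f. cf (om (drop j ?xs)) s * cf (om (take j ?xs)) t)"
    using cop_om[of ?xs s t] trees_Prim(1)[OF ft] st by (simp add: P_forest_om[OF ft] rev_map[symmetric])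
  also have "\<dots> = (\<Sum>j\<le>length f. cf (P_forest (take (length f - j) f)) s * cf (P_forest (drop (length f - j) f)) t)"
    by (intro sum.cong refl) (simp add: P_forest_om[OF sub(1)] P_forest_om[OF sub(2)] take_map drop_map take_rev drop_rev)
  also have "\<dots> = (\<Sum>j\<le>length f. cf (P_forest (take j f)) s * cf (P_forest (drop j f)) t)"
    by (rule sum.reindex_bij_witness[where i = "\<lambda>j. length f - j" and j = "\<lambda>j. length f - j"]) auto
  finally show ?thesis .
qed

text \<open>In bidegree \<open>(i, m - i)\<close> a forest contributes only through its prefixes of
  weight \<open>i\<close>, and a forest with such a cut is a pair \<open>(g, h)\<close>. So the
  tensor of \<open>P_forest g\<close> and \<open>P_forest h\<close> has exactly
  \<open>c (g @ h)\<close> as its coefficient.\<close>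

lemma cop_forest_sum:
  assumes m: "m \<le> n" and i: "i \<le> m"
    and st: "packed_word s" "packed_word t" "length s = i"
  shows "cop all_cuts (\<Sum>f\<in>packed_forests m. scale (c f) (P_forest f :: 'k wqsym)) s t
       = (\<Sum>g\<in>packed_forests i. \<Sum>h\<in>packed_forests (m - i).
            c (g @ h) * (cf (P_forest g) s * cf (P_forest h) t))"
proof -
  let ?X = "\<lambda>f j. c f * (cf (P_forest (take j f) :: 'k wqsym) s * cf (P_forest (drop j f)) t)"
  let ?S = "SIGMA f:packed_forests m. {..length f}"
  let ?S' = "{(f, j). f \<in> packed_forests m \<and> j \<le> length f \<and> sum_list (map weight (take j f)) = i}"
  have "cop all_cuts (\<Sum>f\<in>packed_forests m. scale (c f) (P_forest f :: 'k wqsym)) s t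
      = (\<Sum>f\<in>packed_forests m. \<Sum>j\<le>length f. ?X f j)"
    using m st(1,2) by (simp add: cop_sum cop_scale cop_P_forest sum_distrib_left)
  also have "\<dots> = (\<Sum>(f, j)\<in>?S. ?X f j)"
    using finite_packed_forests by (intro sum.Sigma) auto
  also have "\<dots> = (\<Sum>(f, j)\<in>?S'. ?X f j)"
  proof (rule sum.mono_neutral_right)
    show "finite ?S" using finite_packed_forests by auto
    show "\<forall>z\<in>?S - ?S'. (case z of (f, j) \<Rightarrow> ?X f j) = 0"
    proof
      fix z assume z: "z \<in> ?S - ?S'"
      obtain f j where zz: "z = (f, j)" by (cases z)
      have f: "f \<in> packed_forests m" and ne: "sum_list (map weight (take j f)) \<noteq> i"
        using z by (auto simp: zz)
      have "take j f \<in> packed_forests (sum_list (map weight (take j f)))"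
        using packed_forests_split[OF f refl] by blast
      moreover have "sum_list (map weight (take j f)) \<le> m"
        using f unfolding packed_forests_def mem_Collect_eq
        by (metis (no_types, lifting) append_take_drop_id le_add1 map_append sum_list_append)
      ultimately have "(P_forest (take j f) :: 'k wqsym) \<in> WQSym (sum_list (map weight (take j f)))"
        using P_forest_WQSym m by fastforce
      from WQSymD[OF this, of s] have "cf (P_forest (take j f) :: 'k wqsym) s = 0"
        using ne st(3) by simp
      then show "(case z of (f, j) \<Rightarrow> ?X f j) = 0" by (simp add: zz)
    qed
  qed auto
  also have "\<dots> = (\<Sum>(g, h)\<in>packed_forests i \<times> packed_forests (m - i).
      c (g @ h) * (cf (P_forest g) s * cf (P_forest h) t))"
  proof (rule sum.reindex_bij_witness[where i = "\<lambda>(g, h). (g @ h, length g)" and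
        j = "\<lambda>(f, j). (take j f, drop j f)"])
    fix z assume "z \<in> packed_forests i \<times> packed_forests (m - i)"
    then show "(case z of (g, h) \<Rightarrow> (g @ h, length g)) \<in> ?S'"
      using packed_forests_append[of "fst z" i "snd z" "m - i"] i
      by (auto simp: packed_forests_def)
  qed (auto dest: packed_forests_split)
  finally show ?thesis by (simp add: sum.cartesian_product case_prod_beta)
qed

end

section \<open>Forest bases of the component spaces, and totally primitive elements\<close>

lemma subspace_restrict:
  assumes "free.subspace V" "Q 0" "\<And>x y. Q x \<Longrightarrow> Q y \<Longrightarrow> Q (x + y)" "\<And>c x. Q x \<Longrightarrow> Q (scale c x)"
  shows "free.subspace {x \<in> V. Q x}"
  using assms unfolding free.subspace_def by blast

lemma subspace_component_space: "free.subspace (component_space n I)"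
  unfolding component_space_def
  by (rule subspace_restrict[OF subspace_WQSym]) (simp_all add: cop_add cop_scale)

text \<open>For \<open>I \<in> labels n\<close>, the right forests that a packed tree of
  right-weight \<open>n\<close> may carry below the root label \<open>I\<close>, by
  \<open>packed_tree_right_iff\<close>.\<close>

definition label_forests :: "nat \<Rightarrow> nat list \<Rightarrow> biplane_tree list set" where
  "label_forests n I = {f \<in> packed_forests (n - length I).
     f \<noteq> [] \<longrightarrow> hd I \<le> weight (hd f) \<and> n - last I < weight (last f)}"

lemma weight_take_ge: "j \<noteq> 0 \<Longrightarrow> f \<noteq> [] \<Longrightarrow> weight (hd f) \<le> sum_list (map weight (take j f))"
  by (cases f; cases j) auto

lemma weight_drop_ge: "j < length f \<Longrightarrow> weight (last f) \<le> sum_list (map weight (drop j f))"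
  by (rule sum_weight_ge) (metis drop_eq_Nil last_drop last_in_set not_less)

text \<open>A non-empty prefix of a forest weighs at least as much as the first tree, a non-empty
  suffix at least as much as the last, so the coproducts of the chosen forests vanish in the
  required degrees. Conversely, a coproduct that vanishes in bidegree \<open>(i, m - i)\<close>
  kills every coefficient \<open>c (g @ h)\<close>, and any other forest splits off a first or last
  tree that is light enough for this.\<close>

lemma component_space_basis:
  assumes prim: "prim_trees TYPE('k::field) m" and m: "m = n - length I"
    and W1: "\<And>i. i \<le> m \<Longrightarrow> is_basis P_forest (packed_forests i) (WQSym i :: 'k wqsym set)"
  shows "is_basis P_forest (label_forests n I) (component_space n I :: 'k wqsym set)"
proof (rule is_basisI)
  have sub: "label_forests n I \<subseteq> packed_forests m" by (auto simp: label_forests_def m)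
  show "finite (label_forests n I)" using sub finite_packed_forests finite_subset by blast
  show "free.subspace (component_space n I :: 'k wqsym set)" by (rule subspace_component_space)
  show "(P_forest f :: 'k wqsym) \<in> component_space n I" if f: "f \<in> label_forests n I" for f
    unfolding component_space_def
  proof (intro CollectI conjI allI impI)
    have fm: "f \<in> packed_forests m" using f sub by blast
    show "(P_forest f :: 'k wqsym) \<in> WQSym (n - length I)"
      using P_forest_WQSym[OF prim fm] by (simp add: m)
    fix s t :: "nat list" assume st: "packed_word s" "packed_word t" "length s + length t = n - length I"
      and c: "(1 \<le> length s \<and> length s < hd I) \<or> (1 \<le> length t \<and> length t \<le> n - last I)"
    have "cf (P_forest (take j f) :: 'k wqsym) s * cf (P_forest (drop j f)) t = 0" if j: "j \<le> length f" for j
    proof (rule ccontr)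
      assume nz: "\<not> ?thesis"
      let ?i = "sum_list (map weight (take j f))" and ?k = "sum_list (map weight (drop j f))"
      have ik: "?i + ?k = m"
        using fm by (metis (mono_tags, lifting) append_take_drop_id map_append mem_Collect_eq packed_forests_def sum_list_append)
      have tk: "take j f \<in> packed_forests ?i" and dr: "drop j f \<in> packed_forests ?k"
        using packed_forests_split[OF fm refl, of j] ik by auto
      have "length s = ?i" "length t = ?k"
        using nz WQSymD[OF P_forest_WQSym[OF prim tk], of s] WQSymD[OF P_forest_WQSym[OF prim dr], of t] ik
        by fastforce+
      moreover have "f \<noteq> []" using c calculation by auto
      moreover have "hd I \<le> weight (hd f)" "n - last I < weight (last f)"
        using f calculation(3) by (auto simp: label_forests_def)
      moreover have "j \<noteq> 0" if "1 \<le> length s" using that calculation(1) by (cases j) auto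
      moreover have "j < length f" if "1 \<le> length t" using that calculation(2) by (cases "j < length f") auto
      ultimately show False
        using c weight_take_ge[of j f] weight_drop_ge[of j f] by fastforce
    qed
    then show "cop all_cuts (P_forest f :: 'k wqsym) s t = 0"
      unfolding cop_P_forest[OF prim fm order_refl st(1,2)] by (intro sum.neutral) auto
  qed
  \<comment> \<open>Extending coefficients by zero reduces everything to the basis of all forests of
    weight \<open>m\<close>.\<close>
  have ext: "(\<Sum>f\<in>label_forests n I. scale (c f) (P_forest f :: 'k wqsym))
      = (\<Sum>f\<in>packed_forests m. scale (if f \<in> label_forests n I then c f else 0) (P_forest f))" for c
  proof -
    have "(\<Sum>f\<in>packed_forests m. scale (if f \<in> label_forests n I then c f else 0) (P_forest f :: 'k wqsym))
        = (\<Sum>f\<in>label_forests n I. scale (if f \<in> label_forests n I then c f else 0) (P_forest f))"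
      using finite_packed_forests sub by (intro sum.mono_neutral_right) auto
    then show ?thesis by simp
  qed
  show "c f = 0" if "(\<Sum>f\<in>label_forests n I. scale (c f) (P_forest f :: 'k wqsym)) = 0"
    and f: "f \<in> label_forests n I" for c f
  proof -
    have "(if f \<in> label_forests n I then c f else 0) = 0"
      by (rule is_basis_indep[OF W1[OF order_refl] finite_packed_forests])
        (use that sub in \<open>auto simp: ext\<close>)
    then show ?thesis using f by simp
  qed
  show "\<exists>c. y = (\<Sum>f\<in>label_forests n I. scale (c f) (P_forest f))"
    if y: "y \<in> component_space n I" for y :: "'k wqsym"
  proof -
    have "y \<in> WQSym m" using y by (simp add: component_space_def m)
    then obtain c where c: "y = (\<Sum>f\<in>packed_forests m. scale (c f) (P_forest f))"
      using is_basis_repr[OF W1[OF order_refl] finite_packed_forests] by blast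
    have split0: "c (g @ h) = 0"
      if gh: "g \<in> packed_forests i" "h \<in> packed_forests (m - i)" and i: "i \<le> m"
        and van: "(1 \<le> i \<and> i < hd I) \<or> (1 \<le> m - i \<and> m - i \<le> n - last I)" for g h i
    proof (rule bilinear_indep[OF W1[OF i] finite_packed_forests W1 finite_packed_forests _ gh,
          of "\<lambda>g h. c (g @ h)"])
      fix s t
      show "(\<Sum>g\<in>packed_forests i. \<Sum>h\<in>packed_forests (m - i).
          c (g @ h) * (cf (P_forest g :: 'k wqsym) s * cf (P_forest h) t)) = 0"
      proof (cases "s \<in> PW i \<and> t \<in> PW (m - i)")
        case True
        then have "cop all_cuts y s t = 0"
          using y van i by (auto simp: component_space_def m PW_def)
        then show ?thesis
          using True cop_forest_sum[OF prim order_refl i, of s t c] by (simp add: c PW_def)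
      next
        case False
        have z: "cf (P_forest g :: 'k wqsym) s * cf (P_forest h) t = 0"
          if "g \<in> packed_forests i" "h \<in> packed_forests (m - i)" for g h
          using False P_forest_WQSym[OF prim that(1) i] P_forest_WQSym[OF prim that(2)]
          by (auto simp: WQSym_def in_keys_iff)
        show ?thesis by (intro sum.neutral ballI) (simp only: z mult_zero_right)
      qed
    qed simp
    have c0: "c f = 0" if f: "f \<in> packed_forests m" "f \<notin> label_forests n I" for f
    proof -
      have ne: "f \<noteq> []" using f by (auto simp: label_forests_def m)
      have pf: "\<forall>t\<in>set f. packed_tree t" and w: "sum_list (map weight f) = m"
        using f by (auto simp: packed_forests_def)
      consider "weight (hd f) < hd I" | "weight (last f) \<le> n - last I"
        using f ne by (force simp: label_forests_def m)
      then show ?thesis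
      proof cases
        case 1
        have f': "f = [hd f] @ tl f" using ne by simp
        have w': "weight (hd f) + sum_list (map weight (tl f)) = m"
          using w ne by (cases f) auto
        have "c ([hd f] @ tl f) = 0"
        proof (rule split0[of _ "weight (hd f)"])
          show "[hd f] \<in> packed_forests (weight (hd f))" "tl f \<in> packed_forests (m - weight (hd f))"
            using pf ne w' by (cases f; auto simp: packed_forests_def)+
          show "(1 \<le> weight (hd f) \<and> weight (hd f) < hd I) \<or>
            (1 \<le> m - weight (hd f) \<and> m - weight (hd f) \<le> n - last I)"
            using 1 weight_pos[of "hd f"] pf ne by auto
        qed (use w' in simp)
        then show ?thesis using f' by simp
      next
        case 2
        have f': "f = butlast f @ [last f]" using ne by simp
        have w': "sum_list (map weight (butlast f)) + weight (last f) = m"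
          using w ne by (cases f rule: rev_cases) auto
        have pb: "\<forall>t\<in>set (butlast f). packed_tree t" and pl: "packed_tree (last f)"
          using pf ne by (auto dest: in_set_butlastD)
        have "c (butlast f @ [last f]) = 0"
        proof (rule split0[of _ "m - weight (last f)"])
          show "butlast f \<in> packed_forests (m - weight (last f))"
            using pb w' by (auto simp: packed_forests_def)
          show "[last f] \<in> packed_forests (m - (m - weight (last f)))"
            using pl w' by (auto simp: packed_forests_def)
          show "(1 \<le> m - weight (last f) \<and> m - weight (last f) < hd I) \<or>
            (1 \<le> m - (m - weight (last f)) \<and> m - (m - weight (last f)) \<le> n - last I)"
            using 2 weight_pos[OF pl] w' by auto
        qed simp
        then show ?thesis using f' by simp
      qed
    qed
    have "y = (\<Sum>f\<in>packed_forests m. scale (if f \<in> label_forests n I then c f else 0) (P_forest f))"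
      unfolding c by (intro sum.cong refl) (auto simp: c0)
    then show ?thesis unfolding ext[symmetric] by blast
  qed
qed

text \<open>Labels are non-empty, so the right forests weigh less than \<open>n\<close> and the
  hypotheses in smaller degrees apply to them.\<close>

lemma TPrim_basis_step:
  assumes n: "n > 0" and prim: "\<And>m. m < n \<Longrightarrow> prim_trees TYPE('k::field) m"
    and W1: "\<And>i. i < n \<Longrightarrow> is_basis P_forest (packed_forests i) (WQSym i :: 'k wqsym set)"
  shows "is_basis P_tree (packed_trees_left_empty n) (TPrim_hom n :: 'k wqsym set)"
proof -
  have lt: "n - length I < n" if "I \<in> labels n" for I
    using that n valid_label_facts(1)[of I] by (auto simp: labels_def)
  have basis: "is_basis (\<lambda>(I, f). Phi I (P_forest f)) (Sigma (labels n) (label_forests n))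
      (TPrim_hom n :: 'k wqsym set)"
  proof (rule TPrim_basis[OF n])
    fix I assume I: "I \<in> labels n"
    show "is_basis P_forest (label_forests n I) (component_space n I :: 'k wqsym set)"
      by (rule component_space_basis[OF prim refl W1]) (use lt[OF I] in auto)
    show "finite (label_forests n I)"
      using finite_packed_forests finite_subset by (fastforce simp: label_forests_def)
  qed
  let ?h = "\<lambda>t. case t of Node I fl fr \<Rightarrow> (I, fr)"
  have bij: "bij_betw ?h (packed_trees_left_empty n) (Sigma (labels n) (label_forests n))"
  proof (rule bij_betw_byWitness[where f' = "\<lambda>(I, fr). Node I [] fr"])
    show "\<forall>t\<in>packed_trees_left_empty n. (case ?h t of (I, fr) \<Rightarrow> Node I [] fr) = t"
      by (auto simp: packed_trees_left_empty_def)
    show "\<forall>z\<in>Sigma (labels n) (label_forests n). ?h (case z of (I, fr) \<Rightarrow> Node I [] fr) = z"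
      by auto
    show "?h ` packed_trees_left_empty n \<subseteq> Sigma (labels n) (label_forests n)"
    proof
      fix z assume "z \<in> ?h ` packed_trees_left_empty n"
      then obtain I fr where z: "z = (I, fr)" and p: "packed_tree (Node I [] fr)"
        and w: "length I + sum_list (map weight fr) = n"
        by (auto simp: packed_trees_left_empty_def packed_trees_def simp del: packed_tree.simps)
      then show "z \<in> Sigma (labels n) (label_forests n)"
        using packed_tree_right_iff[OF w] by (auto simp: label_forests_def packed_forests_def)
    qed
    show "(\<lambda>(I, fr). Node I [] fr) ` Sigma (labels n) (label_forests n) \<subseteq> packed_trees_left_empty n"
    proof
      fix t assume "t \<in> (\<lambda>(I, fr). Node I [] fr) ` Sigma (labels n) (label_forests n)"
      then obtain I fr where t: "t = Node I [] fr" and I: "I \<in> labels n" and fr: "fr \<in> label_forests n I"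
        by auto
      have w: "length I + sum_list (map weight fr) = n"
        using fr labels_length[OF I] by (auto simp: label_forests_def packed_forests_def)
      then show "t \<in> packed_trees_left_empty n"
        using packed_tree_right_iff[OF w] I fr
        by (simp add: t packed_trees_left_empty_def packed_trees_def label_forests_def
            packed_forests_def del: packed_tree.simps)
    qed
  qed
  show ?thesis
    by (rule is_basis_reindex[OF basis bij])
      (auto simp: packed_trees_left_empty_def P_forest_def)
qed

lemma forest_basis_0: "is_basis P_forest (packed_forests 0) (WQSym 0 :: 'k::field wqsym set)"
proof (rule is_basisI)
  have P: "(P_forest [] :: 'k wqsym) = R []" by (simp add: P_forest_def forest_prod_def)
  show "finite (packed_forests 0)" by (rule finite_packed_forests)
  show "free.subspace (WQSym 0 :: 'k wqsym set)" by (rule subspace_WQSym)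
  show "(P_forest f :: 'k wqsym) \<in> WQSym 0" if "f \<in> packed_forests 0" for f
    using that by (simp add: packed_forests_0 P WQSym_def PW_def R_def)
  show "c f = 0" if "(\<Sum>f\<in>packed_forests 0. scale (c f) (P_forest f :: 'k wqsym)) = 0"
    "f \<in> packed_forests 0" for c f
  proof -
    have "cf (\<Sum>f\<in>packed_forests 0. scale (c f) (P_forest f :: 'k wqsym)) [] = 0"
      using that(1) by (simp only: lookup_zero)
    then show ?thesis using that(2) by (simp add: packed_forests_0 P cf_R)
  qed
  show "\<exists>c. x = (\<Sum>f\<in>packed_forests 0. scale (c f) (P_forest f))" if x: "x \<in> WQSym 0" for x :: "'k wqsym"
  proof
    show "x = (\<Sum>f\<in>packed_forests 0. scale (cf x []) (P_forest f))"
      using WQSymD[OF x] by (intro poly_mapping_eqI) (simp add: packed_forests_0 P cf_R)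
  qed
qed

section \<open>Primitive elements, by right degree\<close>

lemma brace_WQSym:
  assumes xs: "\<And>t. t \<in> set ts \<Longrightarrow> F t \<in> WQSym (w t) \<inter> WQSym_plus" "ts \<noteq> []"
    and z: "z \<in> WQSym d" "z \<in> WQSym_plus"
  shows "brace (map F ts) z \<in> WQSym (sum_list (map w ts) + d)"
proof -
  have sub: "set (map F ts) \<subseteq> WQSym_plus" using xs by auto
  have "brace_term (map F ts) z i \<in> WQSym (sum_list (map w ts) + d)" for i
  proof -
    have "om (map F (take i ts)) \<in> WQSym (sum_list (map w (take i ts)))"
      by (rule om_WQSym) (use xs(1) in \<open>auto dest: in_set_takeD\<close>)
    moreover have "om' (map F (drop i ts)) \<in> WQSym (sum_list (map w (drop i ts)))"
      by (rule om'_WQSym) (use xs(1) in \<open>auto dest: in_set_dropD\<close>)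
    ultimately have "brace_term (map F ts) z i
        \<in> WQSym ((sum_list (map w (take i ts)) + d) + sum_list (map w (drop i ts)))"
      unfolding brace_term_def take_map drop_map by (intro prec_WQSym succ_WQSym z)
    moreover have "sum_list (map w (take i ts)) + sum_list (map w (drop i ts)) = sum_list (map w ts)"
      by (metis append_take_drop_id map_append sum_list_append)
    ultimately show ?thesis by (simp add: ac_simps)
  qed
  then show ?thesis
    using brace_eq[OF sub _ z(2)] xs(2)
    by (auto intro!: free.subspace_sum[OF subspace_WQSym] free.subspace_scale[OF subspace_WQSym])
qed

text \<open>Braces whose last argument has degree \<open>d\<close> span \<open>low_right n d\<close> modulo \<open>low_right n (Suc d)\<close>.\<close>

definition low_right :: "nat \<Rightarrow> nat \<Rightarrow> 'k::field wqsym set" where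
  "low_right n d = {x \<in> Prim_hom n. \<forall>s t. packed_word s \<longrightarrow> packed_word t \<longrightarrow> s \<noteq> [] \<longrightarrow> t \<noteq> [] \<longrightarrow>
     length t < d \<longrightarrow> cop max_right x s t = 0}"

lemma subspace_low_right: "free.subspace (low_right n d)"
  unfolding low_right_def
  by (rule subspace_restrict[OF subspace_Prim_hom]) (simp_all add: cop_add cop_scale)

lemma Prim_max_left: "x \<in> Prim \<Longrightarrow> packed_word s \<Longrightarrow> packed_word t \<Longrightarrow> s \<noteq> [] \<Longrightarrow> t \<noteq> [] \<Longrightarrow>
    cop max_left x s t = - cop max_right x s t"
  using cop_left_right[of s x t] by (simp add: Prim_iff eq_neg_iff_add_eq_0)

text \<open>Here \<open>t\<close> is the left tensor factor, kept fixed, and the claim concerns the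
  right factors of degree \<open>d\<close>. By coassociativity, cutting such a factor into
  \<open>r\<close> and \<open>u\<close> becomes a cut of \<open>x\<close> with right word
  \<open>u\<close>, shorter than \<open>d\<close>, where \<open>Delta_succ x\<close> vanishes.
  \<open>Delta_prec x\<close> vanishes there too, being its negative for the primitive
  \<open>x\<close>.\<close>

lemma low_right_component:
  assumes x: "x \<in> low_right n d" and d: "d > 0" and t: "packed_word t" "t \<noteq> []"
  shows "of_fun d (\<lambda>s. cop max_right x t s) \<in> TPrim_hom d"
proof -
  let ?v = "of_fun d (\<lambda>s. cop max_right x t s)"
  have v: "?v \<in> WQSym d" by (rule of_fun_WQSym)
  have xP: "x \<in> Prim" using x by (auto simp: low_right_def Prim_hom_def)
  have "cop max_left ?v r u = 0 \<and> cop max_right ?v r u = 0"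
    if p: "packed_word r" "packed_word u" "r \<noteq> []" "u \<noteq> []" for r u
  proof (cases "length r + length u = d")
    case False
    then show ?thesis using cop_hom[OF v] by blast
  next
    case True
    have lt: "length u < d" using True p(3) by (cases r) auto
    have c: "cop Q ?v r u = (\<Sum>\<beta> | \<beta> \<in> bool_words (max_letter r) (max_letter u) \<and> Q \<beta>. cop max_right x t (join \<beta> r u))" for Q
      unfolding cop_def[of Q]
      by (intro sum.cong refl) (auto simp: cf_of_fun PW_def True packed_join(1)[OF p(1,2)])
    have zero: "cop max_right x (join \<beta> t r) u = 0"
      if "\<beta> \<in> bool_words (max_letter t) (max_letter r)" for \<beta>
      using x lt p packed_join(1)[OF t(1) p(1) that] t(2) by (auto simp: low_right_def join_def)
    have "cop max_left x (join \<beta> t r) u = 0"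
      if "\<beta> \<in> bool_words (max_letter t) (max_letter r)" for \<beta>
    proof -
      have "join \<beta> t r \<noteq> []" using t(2) by (simp add: join_def)
      then show ?thesis
        using Prim_max_left[OF xP packed_join(1)[OF t(1) p(1) that] p(2)] p(4) zero[OF that] by simp
    qed
    then have "cop max_left ?v r u = 0"
      unfolding c coassoc_max_middle[OF t(1) p(1,2) t(2) p(3)] by (intro sum.neutral) auto
    moreover have "cop max_right ?v r u = 0"
      unfolding c coassoc_max_right[OF t(1) p(1,2) t(2) p(3)] by (intro sum.neutral) (auto simp: zero)
    ultimately show ?thesis by blast
  qed
  then show ?thesis using v WQSym_plusI[OF v d] by (simp add: TPrim_hom_def TPrim_iff)
qed

text \<open>Descending induction on \<open>d\<close> along the spaces \<open>low_right n d\<close>.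
  A tree of right-weight \<open>d\<close> is a tree of weight \<open>d\<close> with empty left
  forest together with a left forest of weight \<open>n - d\<close>, and the leading terms of the
  braces are the tensors of the two corresponding bases.\<close>

lemma Prim_basis_step:
  assumes n: "n > 0" and prim: "\<And>m. m < n \<Longrightarrow> prim_trees TYPE('k::field) m"
    and W1: "\<And>i. i < n \<Longrightarrow> is_basis P_forest (packed_forests i) (WQSym i :: 'k wqsym set)"
    and W3: "\<And>i. 0 < i \<Longrightarrow> i \<le> n \<Longrightarrow>
      is_basis P_tree (packed_trees_left_empty i) (TPrim_hom i :: 'k wqsym set)"
  shows "is_basis P_tree (packed_trees n) (Prim_hom n :: 'k wqsym set)"
proof -
  let ?S = "\<lambda>d. {t \<in> packed_trees n. d \<le> right_weight t}"
  have finS: "finite (?S d)" for d using finite_packed_trees by simp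
  have finL: "finite (packed_trees_left_empty d)" for d
    using finite_packed_trees by (simp add: packed_trees_left_empty_def)
  have top: "is_basis P_tree (?S n) (low_right n n :: 'k wqsym set)"
  proof -
    \<comment> \<open>Right-weight \<open>n\<close> leaves no weight for the left forest.\<close>
    have "?S n = packed_trees_left_empty n"
    proof (intro equalityI subsetI)
      fix t assume t: "t \<in> ?S n"
      obtain I fl fr where tt: "t = Node I fl fr" by (cases t)
      have "\<forall>t\<in>set fl. packed_tree t" "sum_list (map weight fl) = 0"
        using t by (auto simp: tt packed_trees_def)
      then have "fl = []" by (rule packed_weight_0)
      then show "t \<in> packed_trees_left_empty n" using t by (auto simp: packed_trees_left_empty_def tt)
    qed (auto simp: packed_trees_left_empty_def packed_trees_def)
    \<comment> \<open>Two non-empty words of total length \<open>n\<close> have a right word shorter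
      than \<open>n\<close>, so no condition is missing.\<close>
    moreover have "low_right n n = (TPrim_hom n :: 'k wqsym set)"
    proof (intro equalityI subsetI)
      fix x :: "'k wqsym" assume x: "x \<in> low_right n n"
      then have xP: "x \<in> Prim" and xW: "x \<in> WQSym n" by (auto simp: low_right_def Prim_hom_def)
      have r: "cop max_right x s t = 0" if p: "packed_word s" "packed_word t" "s \<noteq> []" "t \<noteq> []" for s t
      proof (cases "length s + length t = n")
        case True
        then have "length t < n" using p(3) by (cases s) auto
        then show ?thesis using x p by (simp add: low_right_def)
      qed (use cop_hom[OF xW] in blast)
      then have "cop max_left x s t = 0" if "packed_word s" "packed_word t" "s \<noteq> []" "t \<noteq> []" for s t
        using Prim_max_left[OF xP that] that by simp
      then show "x \<in> TPrim_hom n" using r xW Prim_plus[OF xP] by (simp add: TPrim_hom_def TPrim_iff)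
    next
      fix x :: "'k wqsym" assume "x \<in> TPrim_hom n"
      then show "x \<in> low_right n n"
        using TPrim_Prim by (auto simp: low_right_def TPrim_hom_def Prim_hom_def TPrim_iff)
    qed
    ultimately show ?thesis using W3[OF n order_refl] by simp
  qed
  have step: "is_basis P_tree (?S d) (low_right n d :: 'k wqsym set)"
    if IH: "is_basis P_tree (?S (Suc d)) (low_right n (Suc d) :: 'k wqsym set)"
      and d: "1 \<le> d" "d < n" for d
  proof -
    \<comment> \<open>The right tensor factor comes first: it lies in the subspace
      \<open>TPrim_hom d\<close>, and \<open>basis_step\<close> allows a proper subspace only in the
      first place.\<close>
    let ?D = "\<lambda>(x :: 'k wqsym) s t. if s \<in> PW d \<and> t \<in> PW (n - d) then cop max_right x t s else 0"
    let ?E = "{t \<in> packed_trees n. right_weight t = d}"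
    let ?\<iota> = "\<lambda>(z, f). case z of Node I fl fr \<Rightarrow> Node I f fr"
    have primn: "prim_trees TYPE('k) (n - d)" using prim d by simp
    have ne_forest: "f \<noteq> []" if "f \<in> packed_forests (n - d)" for f using that d by auto
    \<comment> \<open>\<open>om\<close> takes the left forest of a brace in list order,
      \<open>P_forest\<close> in reverse order; reversal permutes the forests of a given
      weight.\<close>
    have left: "is_basis (\<lambda>f. om (map P_tree f)) (packed_forests (n - d)) (WQSym (n - d) :: 'k wqsym set)"
    proof (rule is_basis_reindex[OF W1])
      show "bij_betw rev (packed_forests (n - d)) (packed_forests (n - d))"
        by (rule bij_betw_byWitness[where f' = rev]) (auto simp: packed_forests_def rev_map[symmetric])
      fix f assume f: "f \<in> packed_forests (n - d)"
      then have "\<forall>t\<in>set (rev f). packed_tree t \<and> weight t \<le> n - d"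
        using packed_forests_tree_weight by auto
      then show "om (map P_tree f) = (P_forest (rev f) :: 'k wqsym)"
        using P_forest_om[OF primn] by simp
    qed (use d in simp)
    have bij: "bij_betw ?\<iota> (packed_trees_left_empty d \<times> packed_forests (n - d)) ?E"
    proof (rule bij_betw_byWitness[where f' = "\<lambda>t. case t of Node I fl fr \<Rightarrow> (Node I [] fr, fl)"])
      show "\<forall>a\<in>packed_trees_left_empty d \<times> packed_forests (n - d).
          (case ?\<iota> a of Node I fl fr \<Rightarrow> (Node I [] fr, fl)) = a"
        by (auto simp: packed_trees_left_empty_def)
      show "\<forall>t\<in>?E. ?\<iota> (case t of Node I fl fr \<Rightarrow> (Node I [] fr, fl)) = t"
        by (auto split: biplane_tree.splits)
      show "?\<iota> ` (packed_trees_left_empty d \<times> packed_forests (n - d)) \<subseteq> ?E"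
      proof
        fix t assume "t \<in> ?\<iota> ` (packed_trees_left_empty d \<times> packed_forests (n - d))"
        then obtain I fr f where t: "t = Node I f fr" and p: "packed_tree (Node I [] fr)"
          and w: "right_weight (Node I [] fr) = d" and f: "f \<in> packed_forests (n - d)"
          by (auto simp: packed_trees_left_empty_def packed_trees_def simp del: packed_tree.simps)
        show "t \<in> ?E"
          using p f w d packed_tree_left_iff[of I f fr] unfolding t
          by (auto simp: packed_trees_def packed_forests_def simp del: packed_tree.simps)
      qed
      show "(\<lambda>t. case t of Node I fl fr \<Rightarrow> (Node I [] fr, fl)) ` ?E
          \<subseteq> packed_trees_left_empty d \<times> packed_forests (n - d)"
      proof
        fix z assume "z \<in> (\<lambda>t. case t of Node I fl fr \<Rightarrow> (Node I [] fr, fl)) ` ?E"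
        then obtain t where t: "t \<in> ?E" "z = (case t of Node I fl fr \<Rightarrow> (Node I [] fr, fl))" by blast
        obtain I fl fr where tt: "t = Node I fl fr" by (cases t)
        show "z \<in> packed_trees_left_empty d \<times> packed_forests (n - d)"
          using t packed_tree_left_iff[of I fl fr] unfolding tt
          by (auto simp: packed_trees_left_empty_def packed_trees_def packed_forests_def
              simp del: packed_tree.simps)
      qed
    qed
    have P: "(P_tree (?\<iota> (z, f)) :: 'k wqsym) \<in> low_right n d"
      "?D (P_tree (?\<iota> (z, f))) s t = cf (P_tree z) s * cf (om (map P_tree f)) t"
      if z: "z \<in> packed_trees_left_empty d" and f: "f \<in> packed_forests (n - d)" for z f s t
    proof -
      obtain I fr where zz: "z = Node I [] fr" using z by (auto simp: packed_trees_left_empty_def)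
      let ?x = "map P_tree f :: 'k wqsym list" and ?z = "P_tree z :: 'k wqsym"
      have eq: "P_tree (?\<iota> (z, f)) = brace ?x ?z" using ne_forest[OF f] by (simp add: zz)
      have ft: "\<forall>t\<in>set f. packed_tree t \<and> weight t \<le> n - d"
        using packed_forests_tree_weight[OF f] by blast
      note xP = trees_Prim[OF primn ft]
      have xne: "?x \<noteq> []" using ne_forest[OF f] by simp
      have zT: "?z \<in> TPrim" "?z \<in> WQSym d"
        using is_basis_mem[OF W3 z] d by (auto simp: TPrim_hom_def)
      have "om ?x \<in> WQSym (sum_list (map weight f))"
        by (rule om_WQSym) (rule xP(2))
      then have omW: "om ?x \<in> WQSym (n - d)"
        using f by (simp add: packed_forests_def)
      have "brace ?x ?z \<in> WQSym (sum_list (map weight f) + d)"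
        using xP Prim_plus by (intro brace_WQSym zT TPrim_plus) (use ne_forest[OF f] in auto)
      then have W: "brace ?x ?z \<in> WQSym n" using f d by (simp add: packed_forests_def)
      note cop = cop_max_right_brace[OF xP(1) xne zT]
      have "brace ?x ?z \<in> Prim" using Prim_brace[OF xP(1) xne TPrim_Prim[OF zT(1)]] .
      then show "(P_tree (?\<iota> (z, f)) :: 'k wqsym) \<in> low_right n d"
        unfolding eq using W cop WQSymD[OF zT(2)] by (simp add: low_right_def Prim_hom_def)
      show "?D (P_tree (?\<iota> (z, f))) s t = cf ?z s * cf (om ?x) t"
      proof (cases "s \<in> PW d \<and> t \<in> PW (n - d)")
        case True
        then have "s \<noteq> []" "length s \<le> d" "packed_word s" "packed_word t" using d by (auto simp: PW_def)
        then show ?thesis using True cop[of t s] unfolding eq by simp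
      next
        case False
        then have "cf ?z s * cf (om ?x) t = 0"
          using zT(2) omW by (auto simp: WQSym_def in_keys_iff)
        then show ?thesis using False by (simp only: if_False)
      qed
    qed
    \<comment> \<open>Passing from \<open>d\<close> to \<open>Suc d\<close> adds the conditions for
      right words of length \<open>d\<close>; by homogeneity only left words of length
      \<open>n - d\<close> matter there.\<close>
    have ker: "{x \<in> low_right n d. \<forall>s t. ?D x s t = 0} = (low_right n (Suc d) :: 'k wqsym set)"
    proof (intro equalityI subsetI)
      fix x :: "'k wqsym" assume x: "x \<in> {x \<in> low_right n d. \<forall>s t. ?D x s t = 0}"
      have xW: "x \<in> WQSym n" using x by (auto simp: low_right_def Prim_hom_def)
      have "cop max_right x s t = 0" if p: "packed_word s" "packed_word t" "s \<noteq> []" "t \<noteq> []" "length t < Suc d" for s t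
      proof (cases "length t = d \<and> length s + length t = n")
        case True
        then have "t \<in> PW d" "s \<in> PW (n - d)" using p by (auto simp: PW_def)
        moreover have "?D x t s = 0" using x by blast
        ultimately show ?thesis by simp
      next
        case False
        then show ?thesis using x p cop_hom[OF xW, of s t] by (auto simp: low_right_def less_Suc_eq)
      qed
      then show "x \<in> low_right n (Suc d)" using x by (auto simp: low_right_def)
    next
      fix x :: "'k wqsym" assume x: "x \<in> low_right n (Suc d)"
      have "cop max_right x t s = 0" if "s \<in> PW d" "t \<in> PW (n - d)" for s t
      proof -
        have "packed_word s" "packed_word t" "s \<noteq> []" "t \<noteq> []" "length s < Suc d"
          using that d by (auto simp: PW_def)
        then show ?thesis using x unfolding low_right_def by blast
      qed
      then show "x \<in> {x \<in> low_right n d. \<forall>s t. ?D x s t = 0}"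
        using x by (auto simp: low_right_def)
    qed
    have "is_basis P_tree (?S (Suc d) \<union> ?E) (low_right n d :: 'k wqsym set)"
    proof (rule basis_step[where D = ?D and V = "TPrim_hom d" and m = "n - d" and b = P_tree and
          b' = "\<lambda>f. om (map P_tree f)"
          and I = "packed_trees_left_empty d" and J = "packed_forests (n - d)" and \<iota> = ?\<iota>])
      show "is_basis P_tree (?S (Suc d)) {x \<in> low_right n d. \<forall>s t. ?D x s t = 0}"
        unfolding ker by (rule IH)
      show "is_basis P_tree (packed_trees_left_empty d) (TPrim_hom d :: 'k wqsym set)"
        using W3 d by simp
      show "is_basis (\<lambda>f. om (map P_tree f)) (packed_forests (n - d)) (WQSym (n - d) :: 'k wqsym set)"
        by (rule left)
      show "bij_betw ?\<iota> (packed_trees_left_empty d \<times> packed_forests (n - d)) ?E" by (rule bij)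
      show "\<exists>v\<in>TPrim_hom d. \<forall>s. cf v s = ?D x s t" if x: "x \<in> low_right n d" for x :: "'k wqsym" and t
      proof (cases "t \<in> PW (n - d)")
        case True
        then have t: "packed_word t" "t \<noteq> []" using d by (auto simp: PW_def)
        show ?thesis
          using low_right_component[OF x _ t] d True by (intro bexI[of _ "of_fun d (\<lambda>s. cop max_right x t s)"])
            (simp_all add: cf_of_fun)
      next
        case False
        then show ?thesis
          using free.subspace_0[OF subspace_TPrim_hom] by (intro bexI[of _ 0]) simp_all
      qed
    qed (use P finS finL finite_packed_forests subspace_low_right in \<open>simp_all add: cop_add cop_scale, auto\<close>)
    moreover have "?S (Suc d) \<union> ?E = ?S d" by auto
    ultimately show ?thesis by simp
  qed
  have "is_basis P_tree (?S 1) (low_right n 1 :: 'k wqsym set)"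
  \<comment> \<open>Downward from \<open>d = n\<close> to \<open>d = 1\<close>, where
    \<open>low_right\<close> imposes no condition and every packed tree qualifies.\<close>
  proof (rule inc_induct[of 1 n "\<lambda>d. is_basis P_tree (?S d) (low_right n d :: 'k wqsym set)"])
    show "1 \<le> n" using n by simp
  qed (use top step in auto)
  moreover have "?S 1 = packed_trees n" using weight_pos by (auto simp: packed_trees_def)
  moreover have "low_right n 1 = (Prim_hom n :: 'k wqsym set)" by (auto simp: low_right_def)
  ultimately show ?thesis by simp
qed

section \<open>All elements, by left degree\<close>

definition low_left :: "nat \<Rightarrow> nat \<Rightarrow> 'k::field wqsym set" where
  "low_left n i = {x \<in> WQSym n. \<forall>s t. packed_word s \<longrightarrow> packed_word t \<longrightarrow> s \<noteq> [] \<longrightarrow> t \<noteq> [] \<longrightarrow>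
     length s < i \<longrightarrow> cop all_cuts x s t = 0}"

lemma subspace_low_left: "free.subspace (low_left n i)"
  unfolding low_left_def
  by (rule subspace_restrict[OF subspace_WQSym]) (simp_all add: cop_add cop_scale)

text \<open>By \<open>coassoc_all\<close>, cutting a left factor of degree \<open>i\<close> into
  \<open>r\<close> and \<open>u\<close> becomes a cut of \<open>x\<close> with left word
  \<open>r\<close>, shorter than \<open>i\<close>, where the coproduct vanishes.\<close>

lemma low_left_component:
  assumes x: "x \<in> low_left n i" and i: "i > 0" and t: "packed_word t" "t \<noteq> []"
  shows "of_fun i (\<lambda>s. cop all_cuts x s t) \<in> Prim_hom i"
proof -
  let ?v = "of_fun i (\<lambda>s. cop all_cuts x s t)"
  have v: "?v \<in> WQSym i" by (rule of_fun_WQSym)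
  have "cop all_cuts ?v r u = 0"
    if p: "packed_word r" "packed_word u" "r \<noteq> []" "u \<noteq> []" for r u
  proof (cases "length r + length u = i")
    case False
    then show ?thesis using cop_hom[OF v] by blast
  next
    case True
    have lt: "length r < i" using True p(4) by (cases u) auto
    have c: "cop all_cuts ?v r u = (\<Sum>\<beta> | \<beta> \<in> bool_words (max_letter r) (max_letter u) \<and> True. cop all_cuts x (join \<beta> r u) t)"
      unfolding cop_def[of _ ?v]
      by (intro sum.cong refl) (auto simp: cf_of_fun PW_def True packed_join(1)[OF p(1,2)])
    have "cop all_cuts x r (join \<beta> u t) = 0"
      if "\<beta> \<in> bool_words (max_letter u) (max_letter t)" for \<beta>
      using x lt p packed_join(1)[OF p(2) t(1) that] t(2) by (auto simp: low_left_def join_def)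
    then show ?thesis
      unfolding c coassoc_all[OF p(1,2) t(1) p(3,4)] by (intro sum.neutral) auto
  qed
  then show ?thesis using v WQSym_plusI[OF v i] by (simp add: Prim_hom_def Prim_iff)
qed

text \<open>The first tree supplies the leading factor: for \<open>i < n\<close>, a forest
  \<open>t # f\<close> with \<open>weight t = i\<close> has
  \<open>P_tree t \<otimes> P_forest f\<close> as its term of left degree \<open>i\<close>. For
  \<open>i = n\<close> the forest is a single tree and the space is
  \<open>Prim_hom n\<close>.\<close>

lemma forest_basis_step:
  assumes n: "n > 0" and prim: "prim_trees TYPE('k::field) n"
    and W1: "\<And>i. i < n \<Longrightarrow> is_basis P_forest (packed_forests i) (WQSym i :: 'k wqsym set)"
    and W2: "\<And>i. 0 < i \<Longrightarrow> i \<le> n \<Longrightarrow> is_basis P_tree (packed_trees i) (Prim_hom i :: 'k wqsym set)"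
  shows "is_basis P_forest (packed_forests n) (WQSym n :: 'k wqsym set)"
proof -
  let ?S = "\<lambda>i. {f \<in> packed_forests n. i \<le> weight (hd f)}"
  have finS: "finite (?S i)" for i using finite_packed_forests by simp
  have ne: "f \<noteq> []" if "f \<in> packed_forests n" for f using that n by auto
  have single: "P_forest [t] = (P_tree t :: 'k wqsym)" for t
    by (simp add: P_forest_def forest_prod_def)
  have top: "is_basis P_forest (?S n) (low_left n n :: 'k wqsym set)"
  proof -
    have bij: "bij_betw hd (?S n) (packed_trees n)"
    proof (rule bij_betw_byWitness[where f' = "\<lambda>t. [t]"])
      have "f = [hd f]" if f: "f \<in> ?S n" for f
      proof -
        have "f \<noteq> []" using ne f by blast
        then obtain t g where fg: "f = t # g" by (cases f) simp_all
        then have "\<forall>t\<in>set g. packed_tree t" "sum_list (map weight g) = 0"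
          using f by (auto simp: packed_forests_def)
        then have "g = []" by (rule packed_weight_0)
        then show ?thesis using fg by simp
      qed
      then show "\<forall>f\<in>?S n. [hd f] = f" by metis
      then have "hd f \<in> packed_trees n" if "f \<in> ?S n" for f
      proof -
        have "[hd f] \<in> packed_forests n" using \<open>\<forall>f\<in>?S n. [hd f] = f\<close> that by auto
        then show ?thesis by (simp add: packed_forests_def packed_trees_def)
      qed
      then show "hd ` ?S n \<subseteq> packed_trees n" by blast
    qed (auto simp: packed_forests_def packed_trees_def)
    have eq: "P_forest f = (P_tree (hd f) :: 'k wqsym)" if f: "f \<in> ?S n" for f
    proof -
      have "f \<noteq> []" using ne f by blast
        then obtain t g where fg: "f = t # g" by (cases f) simp_all
      then have "\<forall>t\<in>set g. packed_tree t" "sum_list (map weight g) = 0"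
        using f by (auto simp: packed_forests_def)
      then have "g = []" by (rule packed_weight_0)
      then show ?thesis using fg single by simp
    qed
    have "low_left n n = (Prim_hom n :: 'k wqsym set)"
    proof (intro equalityI subsetI)
      fix x :: "'k wqsym" assume x: "x \<in> low_left n n"
      then have xW: "x \<in> WQSym n" by (simp add: low_left_def)
      have "cop all_cuts x s t = 0" if p: "packed_word s" "packed_word t" "s \<noteq> []" "t \<noteq> []" for s t
      proof (cases "length s + length t = n")
        case True
        then have "length s < n" using p(4) by (cases t) auto
        then show ?thesis using x p by (simp add: low_left_def)
      qed (use cop_hom[OF xW] in blast)
      then show "x \<in> Prim_hom n" using xW WQSym_plusI[OF xW n] by (simp add: Prim_hom_def Prim_iff)
    next
      fix x :: "'k wqsym" assume "x \<in> Prim_hom n"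
      then show "x \<in> low_left n n" by (auto simp: low_left_def Prim_hom_def Prim_iff)
    qed
    then show ?thesis using is_basis_reindex[OF W2[OF n order_refl] bij eq] by simp
  qed
  have step: "is_basis P_forest (?S i) (low_left n i :: 'k wqsym set)"
    if IH: "is_basis P_forest (?S (Suc i)) (low_left n (Suc i) :: 'k wqsym set)"
      and i: "1 \<le> i" "i < n" for i
  proof -
    let ?D = "\<lambda>(x :: 'k wqsym) s t. if s \<in> PW i \<and> t \<in> PW (n - i) then cop all_cuts x s t else 0"
    let ?E = "{f \<in> packed_forests n. weight (hd f) = i}"
    let ?\<iota> = "\<lambda>(t, f). t # f"
    have bij: "bij_betw ?\<iota> (packed_trees i \<times> packed_forests (n - i)) ?E"
    proof (rule bij_betw_byWitness[where f' = "\<lambda>f. (hd f, tl f)"])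
      show "\<forall>f\<in>?E. ?\<iota> (hd f, tl f) = f" using ne by auto
      show "(\<lambda>f. (hd f, tl f)) ` ?E \<subseteq> packed_trees i \<times> packed_forests (n - i)"
      proof
        fix z assume "z \<in> (\<lambda>f. (hd f, tl f)) ` ?E"
        then obtain f where f: "f \<in> ?E" "z = (hd f, tl f)" by blast
        have "f \<noteq> []" using ne f(1) by blast
        then obtain t g where fg: "f = t # g" by (cases f) simp_all
        show "z \<in> packed_trees i \<times> packed_forests (n - i)"
          using f by (auto simp: fg packed_trees_def packed_forests_def)
      qed
    qed (use i in \<open>auto simp: packed_trees_def packed_forests_def\<close>)
    have P: "(P_forest (t # f) :: 'k wqsym) \<in> low_left n i"
      "?D (P_forest (t # f)) s u = cf (P_tree t) s * cf (P_forest f) u"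
      if t: "t \<in> packed_trees i" and f: "f \<in> packed_forests (n - i)" for t f s u
    proof -
      have tf: "t # f \<in> packed_forests n" using bij t f by (auto simp: bij_betw_def)
      have W: "(P_forest (t # f) :: 'k wqsym) \<in> WQSym n"
        by (rule P_forest_WQSym[OF prim tf order_refl])
      have take0: "cf (P_forest (take j (t # f)) :: 'k wqsym) s = 0"
        if "sum_list (map weight (take j (t # f))) \<noteq> length s" for j s
      proof -
        have "take j (t # f) \<in> packed_forests (sum_list (map weight (take j (t # f))))"
          using packed_forests_split[OF tf refl] by blast
        moreover have "sum_list (map weight (take j (t # f))) \<le> n"
          using tf unfolding packed_forests_def mem_Collect_eq
          by (metis (no_types, lifting) append_take_drop_id le_add1 map_append sum_list_append)
        ultimately have "(P_forest (take j (t # f)) :: 'k wqsym) \<in> WQSym (sum_list (map weight (take j (t # f))))"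
          by (rule P_forest_WQSym[OF prim])
        from WQSymD[OF this, of s] show ?thesis using that by simp
      qed
      have wt: "weight t = i" using t by (simp add: packed_trees_def)
      have low: "cop all_cuts (P_forest (t # f) :: 'k wqsym) s u = 0"
        if "packed_word s" "packed_word u" "s \<noteq> []" "length s < i" for s u
        unfolding cop_P_forest[OF prim tf order_refl that(1,2)]
      proof (intro sum.neutral ballI)
        fix j
        \<comment> \<open>A prefix is empty or weighs at least \<open>i\<close>, whereas
          \<open>s\<close> is non-empty and shorter than \<open>i\<close>.\<close>
        have "sum_list (map weight (take j (t # f))) \<noteq> length s"
          using that(3,4) wt by (cases j) auto
        then show "cf (P_forest (take j (t # f)) :: 'k wqsym) s * cf (P_forest (drop j (t # f))) u = 0"
          using take0 by simp
      qed
      then show "(P_forest (t # f) :: 'k wqsym) \<in> low_left n i" using W by (simp add: low_left_def)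
      show "?D (P_forest (t # f)) s u = cf (P_tree t) s * cf (P_forest f) u"
      proof (cases "s \<in> PW i \<and> u \<in> PW (n - i)")
        case True
        then have su: "packed_word s" "packed_word u" "length s = i" by (auto simp: PW_def)
        \<comment> \<open>All trees have positive weight, so \<open>j = 1\<close> gives the only
          prefix of weight \<open>i\<close>.\<close>
        have "cop all_cuts (P_forest (t # f) :: 'k wqsym) s u
          = (\<Sum>j\<le>length (t # f). if j = 1 then cf (P_tree t) s * cf (P_forest f) u else 0)"
          unfolding cop_P_forest[OF prim tf order_refl su(1,2)]
        proof (intro sum.cong refl)
          fix j assume j: "j \<in> {..length (t # f)}"
          show "cf (P_forest (take j (t # f)) :: 'k wqsym) s * cf (P_forest (drop j (t # f))) u
            = (if j = 1 then cf (P_tree t) s * cf (P_forest f) u else 0)"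
          proof (cases "j = 1")
            case False
            have "sum_list (map weight (take j (t # f))) \<noteq> length s"
            proof (cases j)
              case (Suc k)
              then have "k \<noteq> 0" "f \<noteq> []" using False j by auto
              then have "weight (hd f) \<le> sum_list (map weight (take k f))" by (rule weight_take_ge)
              moreover have "1 \<le> weight (hd f)"
                using weight_pos[of "hd f"] f \<open>f \<noteq> []\<close> by (auto simp: packed_forests_def)
              ultimately have "length s < sum_list (map weight (take j (t # f)))"
                unfolding Suc take_Suc_Cons list.map sum_list.Cons wt su(3) by linarith
              then show ?thesis by simp
            qed (use su i in simp)
            then show ?thesis using take0 False by simp
          qed (simp add: single)
        qed
        then show ?thesis using True by (simp del: sum.atMost_Suc)
      next
        case False
        have "(P_tree t :: 'k wqsym) \<in> WQSym i"
          using is_basis_mem[OF W2 t] i by (simp add: Prim_hom_def)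
        moreover have "(P_forest f :: 'k wqsym) \<in> WQSym (n - i)"
          by (rule P_forest_WQSym[OF prim f]) simp
        ultimately have "cf (P_tree t :: 'k wqsym) s * cf (P_forest f) u = 0"
          using False by (auto simp: WQSym_def in_keys_iff)
        then show ?thesis using False by (simp only: if_False)
      qed
    qed
    have ker: "{x \<in> low_left n i. \<forall>s t. ?D x s t = 0} = (low_left n (Suc i) :: 'k wqsym set)"
    proof (intro equalityI subsetI)
      fix x :: "'k wqsym" assume x: "x \<in> {x \<in> low_left n i. \<forall>s t. ?D x s t = 0}"
      have xW: "x \<in> WQSym n" using x by (auto simp: low_left_def)
      have "cop all_cuts x s t = 0" if p: "packed_word s" "packed_word t" "s \<noteq> []" "t \<noteq> []" "length s < Suc i" for s t
      proof (cases "length s = i \<and> length s + length t = n")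
        case True
        then have "s \<in> PW i" "t \<in> PW (n - i)" using p by (auto simp: PW_def)
        moreover have "?D x s t = 0" using x by blast
        ultimately show ?thesis by simp
      next
        case False
        then show ?thesis using x p cop_hom[OF xW, of s t] by (auto simp: low_left_def less_Suc_eq)
      qed
      then show "x \<in> low_left n (Suc i)" using x by (auto simp: low_left_def)
    next
      fix x :: "'k wqsym" assume x: "x \<in> low_left n (Suc i)"
      have "cop all_cuts x s t = 0" if "s \<in> PW i" "t \<in> PW (n - i)" for s t
      proof -
        have "packed_word s" "packed_word t" "s \<noteq> []" "t \<noteq> []" "length s < Suc i"
          using that i by (auto simp: PW_def)
        then show ?thesis using x unfolding low_left_def by blast
      qed
      then show "x \<in> {x \<in> low_left n i. \<forall>s t. ?D x s t = 0}"
        using x by (auto simp: low_left_def)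
    qed
    have "is_basis P_forest (?S (Suc i) \<union> ?E) (low_left n i :: 'k wqsym set)"
    proof (rule basis_step[where D = ?D and V = "Prim_hom i" and m = "n - i" and b = P_tree and
          b' = P_forest and I = "packed_trees i" and J = "packed_forests (n - i)" and \<iota> = ?\<iota>])
      show "is_basis P_forest (?S (Suc i)) {x \<in> low_left n i. \<forall>s t. ?D x s t = 0}"
        unfolding ker by (rule IH)
      show "is_basis P_tree (packed_trees i) (Prim_hom i :: 'k wqsym set)"
        using W2 i by simp
      show "is_basis P_forest (packed_forests (n - i)) (WQSym (n - i) :: 'k wqsym set)"
        using W1 i by simp
      show "bij_betw ?\<iota> (packed_trees i \<times> packed_forests (n - i)) ?E" by (rule bij)
      show "\<exists>v\<in>Prim_hom i. \<forall>s. cf v s = ?D x s t" if x: "x \<in> low_left n i" for x :: "'k wqsym" and t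
      proof (cases "t \<in> PW (n - i)")
        case True
        then have t: "packed_word t" "t \<noteq> []" using i by (auto simp: PW_def)
        show ?thesis
          using low_left_component[OF x _ t] i True by (intro bexI[of _ "of_fun i (\<lambda>s. cop all_cuts x s t)"])
            (simp_all add: cf_of_fun)
      next
        case False
        then show ?thesis
          using free.subspace_0[OF subspace_Prim_hom] by (intro bexI[of _ 0]) simp_all
      qed
      show "(P_forest (?\<iota> (t, f)) :: 'k wqsym) \<in> low_left n i"
        if "t \<in> packed_trees i" "f \<in> packed_forests (n - i)" for t f
        using P(1)[OF that] by simp
      show "?D (P_forest (?\<iota> (t, f))) s u = cf (P_tree t) s * cf (P_forest f) u"
        if "t \<in> packed_trees i" "f \<in> packed_forests (n - i)" for t f s u
        unfolding prod.case by (rule P(2)[OF that])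
    qed (use finS finite_packed_trees finite_packed_forests subspace_low_left in
        \<open>auto simp: cop_add cop_scale\<close>)
    moreover have "?S (Suc i) \<union> ?E = ?S i" by auto
    ultimately show ?thesis by simp
  qed
  have "is_basis P_forest (?S 1) (low_left n 1 :: 'k wqsym set)"
  proof (rule inc_induct[of 1 n "\<lambda>d. is_basis P_forest (?S d) (low_left n d :: 'k wqsym set)"])
    show "1 \<le> n" using n by simp
  qed (use top step in auto)
  moreover have "1 \<le> weight (hd f)" if "f \<in> packed_forests n" for f
    using weight_pos[of "hd f"] ne[OF that] that by (auto simp: packed_forests_def)
  then have "?S 1 = packed_forests n" by auto
  moreover have "low_left n 1 = (WQSym n :: 'k wqsym set)" by (auto simp: low_left_def)
  ultimately show ?thesis by simp
qed

section \<open>The simultaneous induction\<close>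

lemma all_bases:
  "is_basis P_forest (packed_forests n) (WQSym n :: 'k::field wqsym set) \<and>
   (n > 0 \<longrightarrow> is_basis P_tree (packed_trees n) (Prim_hom n :: 'k wqsym set) \<and>
     is_basis P_tree (packed_trees_left_empty n) (TPrim_hom n :: 'k wqsym set))"
proof (induction n rule: less_induct)
  case (less n)
  have prim: "prim_trees TYPE('k) m" if "m < n" for m
    unfolding prim_trees_def
  proof (intro allI impI)
    fix t assume t: "packed_tree t" "weight t \<le> m"
    then have "weight t < n" "0 < weight t" using that weight_pos[of t] by simp_all
    then have "is_basis P_tree (packed_trees (weight t)) (Prim_hom (weight t) :: 'k wqsym set)"
      using less by blast
    then show "(P_tree t :: 'k wqsym) \<in> Prim_hom (weight t)"
      by (rule is_basis_mem) (simp add: packed_trees_def t)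
  qed
  show ?case
  \<comment> \<open>Degree 0 supplies (1) for the empty forest; trees have positive weight.\<close>
  proof (cases "n = 0")
    case True
    then show ?thesis using forest_basis_0 by simp
  next
    case False
    then have n: "n > 0" by simp
    have W1: "is_basis P_forest (packed_forests i) (WQSym i :: 'k wqsym set)" if "i < n" for i
      using less that by blast
    have W3: "is_basis P_tree (packed_trees_left_empty n) (TPrim_hom n :: 'k wqsym set)"
      by (rule TPrim_basis_step[OF n prim W1])
    have W3': "is_basis P_tree (packed_trees_left_empty i) (TPrim_hom i :: 'k wqsym set)"
      if "0 < i" "i \<le> n" for i
      using W3 less that by (cases "i = n") auto
    have W2: "is_basis P_tree (packed_trees n) (Prim_hom n :: 'k wqsym set)"
      by (rule Prim_basis_step[OF n prim W1 W3'])
    have W2': "is_basis P_tree (packed_trees i) (Prim_hom i :: 'k wqsym set)"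
      if "0 < i" "i \<le> n" for i
      using W2 less that by (cases "i = n") auto
    \<comment> \<open>Only with (2) in degree \<open>n\<close> are the trees of weight
      \<open>n\<close> known to be primitive, which the coproduct formula for forests of weight
      \<open>n\<close> requires.\<close>
    have "prim_trees TYPE('k) n"
      unfolding prim_trees_def
    proof (intro allI impI)
      fix t assume t: "packed_tree t" "weight t \<le> n"
      have "is_basis P_tree (packed_trees (weight t)) (Prim_hom (weight t) :: 'k wqsym set)"
        using W2' t weight_pos[of t] by simp
      then show "(P_tree t :: 'k wqsym) \<in> Prim_hom (weight t)"
        by (rule is_basis_mem) (simp add: packed_trees_def t)
    qed
    then have "is_basis P_forest (packed_forests n) (WQSym n :: 'k wqsym set)"
      by (rule forest_basis_step[OF n _ W1 W2'])
    then show ?thesis using W2 W3 by blast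
  qed
qed

theorem theorem3p7:
  fixes n :: nat
  assumes "n > 0"
  shows "is_basis P_forest (packed_forests n) (WQSym n :: 'k::field wqsym set) \<and>
         is_basis P_tree (packed_trees n) (Prim_hom n :: 'k wqsym set) \<and>
         is_basis P_tree (packed_trees_left_empty n) (TPrim_hom n :: 'k wqsym set)"
  using all_bases[of n] assms by blast

end
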